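(* Let $n\ge 1$ and let $d_1<d_2<\cdots<d_n$ be positive integers, and let $s=\sigma+it$ with $\sigma\in(1/2,1]$ and $t>0$. Then for every $z_1,z_2,\ldots,z_n\in\mathbb{C}$ and every $\varepsilon>0$, the set of all positive real $\tau$ satisfying \[ \max_{1\leq k\leq n}\left|\log\zeta(s+id_k\tau)-z_k\right|<\varepsilon \] has positive lower density, i.e. \[ \liminf_{T\to\infty}\frac{1}{T}\,\mathrm{meas}\left\{\tau\in[0,T]:\max_{1\leq k\leq n}\left|\log\zeta(s+id_k\tau)-z_k\right|<\varepsilon\right\}>0, \] where $\mathrm{meas}$ is Lebesgue measure on $\mathbb{R}$.
   Context: $\zeta$ is the Riemann zeta-function. For $w$ with $\Re w>1/2$ not lying on a horizontal half-line $\{\rho+u: u\ge 0\}$ through a zero $\rho$ of $\zeta$, $\log\zeta(w)$ denotes the branch of the logarithm obtained by continuous continuation along the horizontal line from $+\infty$ (where it equals $\sum_p\sum_{m\ge1} p^{-mw}/m$) to $w$. *)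

theory Defs
  imports
    "HOL-Complex_Analysis.Complex_Analysis"
    "HOL-Computational_Algebra.Primes"
begin

definition zeta :: "complex \<Rightarrow> complex" where
  "zeta = (THE f. f holomorphic_on - {1} \<and>
      (\<forall>s. 1 < Re s \<longrightarrow> f s = (\<Sum>n. of_nat (Suc n) powr (- s))) \<and> f 1 = 0)"
  \<comment> \<open>the value at the pole is an arbitrary convention that makes the description definite\<close>

definition log_zeta_series :: "complex \<Rightarrow> complex" where
  "log_zeta_series w =
     (\<Sum>\<^sub>\<infinity>p\<in>{p::nat. prime p}. \<Sum>\<^sub>\<infinity>m\<in>{1::nat..}. of_nat p powr (- (of_nat m * w)) / of_nat m)"

definition log_zeta_branch :: "complex \<Rightarrow> (real \<Rightarrow> complex) \<Rightarrow> bool" where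
  "log_zeta_branch w L \<longleftrightarrow>
     continuous_on {Re w..} L \<and>
     (\<forall>x\<ge>Re w. exp (L x) = zeta (Complex x (Im w))) \<and>
     (\<forall>x\<ge>Re w. 1 < x \<longrightarrow> L x = log_zeta_series (Complex x (Im w)))"

definition log_zeta :: "complex \<Rightarrow> complex" where
  "log_zeta w = (THE l. \<exists>L. log_zeta_branch w L \<and> l = L (Re w))"

text \<open>
  All zeros are meant here, not only those to the right of the critical line. By the functional
  equation a zero \<open>\<rho>\<close> with \<open>Re \<rho> > 1/2\<close> comes with the zero \<open>1 - cnj \<rho>\<close> of the same ordinate and real
  part below \<open>1/2\<close>, so a point of this set has no zero (and, because of the trivial zeros, no pole)
  on its horizontal line, and the continuation from \<open>+\<infinity>\<close> exists.
\<close>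
definition log_zeta_domain :: "complex set" where
  "log_zeta_domain = {w. 1/2 < Re w \<and>
     \<not> (\<exists>\<rho> u. \<rho> \<noteq> 1 \<and> zeta \<rho> = 0 \<and> 0 \<le> u \<and> w = \<rho> + of_real u)}"

subsection \<open>The descriptions above are definite\<close>

lemma log_zeta_eqI:
  assumes "log_zeta_branch w L"
  shows "log_zeta w = L (Re w)"
proof -
  have eq: "M (Re w) = L (Re w)" if M: "log_zeta_branch w M" for M
  proof -
    let ?D = "\<lambda>x. M x - L x"
    have ex: "exp (?D x) = 1" if "x \<ge> Re w" for x
      using assms M that by (auto simp: log_zeta_branch_def exp_diff)
    have "?D constant_on {Re w..}"
    proof (rule continuous_discrete_range_constant)
      show "continuous_on {Re w..} ?D"
        using assms M by (auto simp: log_zeta_branch_def intro!: continuous_intros)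
      fix x assume x: "x \<in> {Re w..}"
      show "\<exists>e>0. \<forall>y. y \<in> {Re w..} \<and> ?D y \<noteq> ?D x \<longrightarrow> e \<le> norm (?D y - ?D x)"
      proof (intro exI conjI allI impI)
        fix y assume y: "y \<in> {Re w..} \<and> ?D y \<noteq> ?D x"
        have "exp (?D y - ?D x) = 1" using ex[of x] ex[of y] x y by (simp add: exp_diff)
        then obtain n :: int where n: "Re (?D y - ?D x) = 0" "Im (?D y - ?D x) = of_int (2 * n) * pi"
          unfolding exp_eq_1 by blast
        with y have "n \<noteq> 0" by (auto simp: complex_eq_iff)
        hence "1 \<le> \<bar>real_of_int n\<bar>" by linarith
        hence "pi \<le> \<bar>Im (?D y - ?D x)\<bar>" unfolding n(2) by (simp add: abs_mult)
        thus "pi \<le> norm (?D y - ?D x)" using abs_Im_le_cmod order_trans by blast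
      qed simp
    qed auto
    then obtain c where c: "\<And>x. x \<ge> Re w \<Longrightarrow> ?D x = c" by (auto simp: constant_on_def)
    have "?D (max (Re w) 2) = 0"
      using assms M by (simp add: log_zeta_branch_def)
    hence "c = 0" using c[of "max (Re w) 2"] by simp
    thus ?thesis using c[of "Re w"] by simp
  qed
  show ?thesis unfolding log_zeta_def
    using assms eq by (intro the_equality) blast+
qed

lemma dirichlet_zeta_sums:
  assumes "1 < Re s"
  shows "(\<lambda>n. of_nat (Suc n) powr (- s)) sums (\<Sum>n. of_nat (Suc n) powr (- s) :: complex)"
proof -
  have "summable (\<lambda>n. real (Suc n) powr (- Re s))"
    using assms summable_Suc_iff[of "\<lambda>n. real n powr (- Re s)"] by (simp add: summable_real_powr_iff)
  hence "summable (\<lambda>n. norm (of_nat (Suc n) powr (- s) :: complex))"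
    by (simp add: norm_powr_real_powr del: of_nat_Suc)
  thus ?thesis by (rule summable_sums[OF summable_norm_cancel])
qed

lemma powr_summable_local:
  fixes e :: "nat \<Rightarrow> complex \<Rightarrow> complex" and c :: "complex \<Rightarrow> complex"
  assumes c: "continuous_on UNIV c"
    and hol: "\<And>n. e n holomorphic_on {s. a < Re s}"
    and le: "\<And>n s. a < Re s \<Longrightarrow> norm (e n s) \<le> norm (c s) * real (Suc n) powr (a - 1 - Re s)"
  obtains g where "g holomorphic_on {s. a < Re s}" "\<And>s. a < Re s \<Longrightarrow> (\<lambda>n. e n s) sums g s"
proof -
  have op: "open {s. a < Re s}" by (simp add: open_halfspace_Re_gt)
  obtain g where g: "\<forall>x\<in>{s. a < Re s}. (\<lambda>n. e n x) sums g x \<and> g field_differentiable (at x)"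
  proof (rule series_differentiable_comparison_complex[OF op])
    fix n x assume "x \<in> {s. a < Re s}"
    thus "e n field_differentiable at x"
      using hol op holomorphic_on_imp_differentiable_at by blast
  next
    fix x :: complex assume "x \<in> {s. a < Re s}"
    hence x: "a < Re x" by simp
    define d where "d = (Re x - a) / 2"
    have d: "d > 0" using x by (simp add: d_def)
    have "compact (c ` cball x d)"
      by (intro compact_continuous_image continuous_on_subset[OF c]) auto
    then obtain K where K: "\<And>y. y \<in> cball x d \<Longrightarrow> norm (c y) \<le> K"
      by (meson bounded_iff compact_imp_bounded imageI)
    have K0: "K \<ge> 0" using K[of x] d norm_ge_zero[of "c x"] by (simp del: norm_ge_zero)
    define h where "h = (\<lambda>n. complex_of_real (K * real (Suc n) powr (- 1 - d)))"
    have "summable (\<lambda>n. real (Suc n) powr (- 1 - d))"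
      using d summable_Suc_iff[of "\<lambda>n. real n powr (- 1 - d)"] by (simp add: summable_real_powr_iff)
    hence "summable h" unfolding h_def by (intro summable_of_real summable_mult)
    moreover have "range h \<subseteq> \<real>\<^sub>\<ge>\<^sub>0" using K0 by (auto simp: h_def simp del: of_real_mult)
    moreover have "norm (e n y) \<le> norm (h n)" if y: "y \<in> ball x d \<inter> {s. a < Re s}" for n y
    proof -
      have "\<bar>Re (x - y)\<bar> \<le> norm (x - y)" by (rule abs_Re_le_cmod)
      also have "\<dots> < d" using y by (simp add: dist_norm)
      finally have "\<bar>Re x - Re y\<bar> < d" by simp
      hence "Re x - Re y < (Re x - a) / 2" unfolding d_def by linarith
      hence "a - 1 - Re y \<le> - 1 - d" by (simp add: d_def field_simps)
      hence "real (Suc n) powr (a - 1 - Re y) \<le> real (Suc n) powr (- 1 - d)"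
        by (intro powr_mono) auto
      moreover have "norm (c y) \<le> K" using y K by auto
      ultimately have "norm (c y) * real (Suc n) powr (a - 1 - Re y) \<le> K * real (Suc n) powr (- 1 - d)"
        using K0 by (intro mult_mono) auto
      moreover have "norm (h n) = K * real (Suc n) powr (- 1 - d)"
        unfolding h_def norm_of_real using K0 by simp
      ultimately show ?thesis using le[of y n] y by simp
    qed
    ultimately show "\<exists>d h. 0 < d \<and> summable h \<and> range h \<subseteq> \<real>\<^sub>\<ge>\<^sub>0 \<and>
        (\<forall>\<^sub>F n in sequentially. \<forall>y\<in>ball x d \<inter> {s. a < Re s}. cmod (e n y) \<le> cmod (h n))"
      using d by (intro exI[of _ d] exI[of _ h]) auto
  qed
  show ?thesis
  proof (rule that)
    show "g holomorphic_on {s. a < Re s}"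
      using g by (auto simp: holomorphic_on_def intro: field_differentiable_at_within)
  qed (use g in auto)
qed

text \<open>
  With \<open>P s i = (1 - s) (-s) \<dots> (2 - s - i)\<close>, summing the Taylor expansion of \<open>(n + 1)\<^sup>1\<^sup>-\<^sup>s\<close> about \<open>n\<close>
  over \<open>n\<close> expresses \<open>(s - 1) \<zeta>(s)\<close> by values \<open>\<zeta>(s + 1), \<zeta>(s + 2), \<dots>\<close> and a series that converges
  in a larger half-plane.
\<close>

lemma zeta_continuation_step:
  "\<exists>F. F holomorphic_on {s. 1 - real N < Re s} \<and>
     (\<forall>s. 1 < Re s \<longrightarrow> F s = (s - 1) * (\<Sum>n. of_nat (Suc n) powr (- s)))"
proof (induction N)
  case 0
  obtain g where g: "g holomorphic_on {s. 1 < Re s}"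
    "\<And>s. 1 < Re s \<Longrightarrow> (\<lambda>n. of_nat (Suc n) powr (- s)) sums g s"
  proof (rule powr_summable_local[where c = "\<lambda>_. 1" and a = 1
        and e = "\<lambda>n s. of_nat (Suc n) powr (- s)"])
    fix n show "(\<lambda>s. of_nat (Suc n) powr (- s) :: complex) holomorphic_on {s. 1 < Re s}"
      by (intro holomorphic_intros)
  qed (auto simp: norm_powr_real_powr simp del: of_nat_Suc)
  show ?case
    by (rule exI[of _ "\<lambda>s. (s - 1) * g s"])
       (use g in \<open>auto intro!: holomorphic_intros simp: sums_iff simp del: of_nat_Suc\<close>)
next
  case (Suc N)
  then obtain F where F: "F holomorphic_on {s. 1 - real N < Re s}"
    "\<And>s. 1 < Re s \<Longrightarrow> F s = (s - 1) * (\<Sum>n. of_nat (Suc n) powr (- s))" by blast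
  define J where "J = Suc N"
  define P :: "complex \<Rightarrow> nat \<Rightarrow> complex" where "P = (\<lambda>s i. \<Prod>j<i. 1 - s - of_nat j)"
  define e :: "nat \<Rightarrow> complex \<Rightarrow> complex" where
    "e = (\<lambda>n s. of_nat (Suc (Suc n)) powr (1 - s) -
            (\<Sum>i\<le>J. P s i * of_nat (Suc n) powr (1 - s - of_nat i) / fact i))"
  let ?a = "- real N"
  have Phol: "(\<lambda>s. P s i) holomorphic_on A" for i A
    unfolding P_def by (intro holomorphic_intros)
  have ehol: "e n holomorphic_on A" for n A
    unfolding e_def by (intro holomorphic_intros Phol) auto
  have ele: "norm (e n s) \<le> norm (P s (Suc J)) * real (Suc n) powr (?a - 1 - Re s)"
    if s: "?a < Re s" for n s
  proof -
    let ?S = "closed_segment (complex_of_real (Suc n)) (of_real (Suc (Suc n)))"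
    define f where "f = (\<lambda>i u. P s i * u powr (1 - s - of_nat i))"
    have S: "\<exists>r. u = of_real r \<and> real (Suc n) \<le> r" if "u \<in> ?S" for u
    proof -
      from that have "u \<in> of_real ` closed_segment (real (Suc n)) (real (Suc (Suc n)))"
        by (simp only: closed_segment_of_real)
      thus ?thesis by (auto simp: closed_segment_eq_real_ivl)
    qed
    have "norm (f 0 (of_real (Suc (Suc n))) -
            (\<Sum>i\<le>J. f i (of_real (Suc n)) * (of_real (Suc (Suc n)) - of_real (Suc n)) ^ i / fact i))
        \<le> (norm (P s (Suc J)) * real (Suc n) powr (?a - 1 - Re s)) *
            norm (complex_of_real (Suc (Suc n)) - of_real (Suc n)) ^ Suc J / fact J"
    proof (rule complex_Taylor[where S = ?S])
      fix i u assume u: "u \<in> ?S"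
      then obtain r where r: "u = of_real r" "real (Suc n) \<le> r" using S by blast
      have "u \<notin> \<real>\<^sub>\<le>\<^sub>0" using r by (auto simp: complex_nonpos_Reals_iff)
      hence "((\<lambda>u. u powr (1 - s - of_nat i)) has_field_derivative
               (1 - s - of_nat i) * u powr (1 - s - of_nat i - 1)) (at u)"
        by (rule has_field_derivative_powr)
      hence "(f i has_field_derivative P s i * ((1 - s - of_nat i) * u powr (1 - s - of_nat i - 1))) (at u)"
        unfolding f_def by (rule DERIV_cmult)
      moreover have "P s i * ((1 - s - of_nat i) * u powr (1 - s - of_nat i - 1)) = f (Suc i) u"
        by (simp add: f_def P_def algebra_simps)
      ultimately show "(f i has_field_derivative f (Suc i) u) (at u within ?S)"
        using has_field_derivative_at_within by metis
    next
      fix u assume u: "u \<in> ?S"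
      then obtain r where r: "u = of_real r" "real (Suc n) \<le> r" using S by blast
      have "norm (u powr (1 - s - of_nat (Suc J))) = r powr (?a - 1 - Re s)"
        using r by (subst norm_powr_real_powr) (auto simp: J_def intro!: arg_cong[of _ _ "(powr) r"])
      also have "\<dots> \<le> real (Suc n) powr (?a - 1 - Re s)"
        using r s by (intro powr_mono2') auto
      finally show "norm (f (Suc J) u) \<le> norm (P s (Suc J)) * real (Suc n) powr (?a - 1 - Re s)"
        unfolding f_def norm_mult by (intro mult_left_mono) auto
    qed auto
    also have "\<dots> \<le> norm (P s (Suc J)) * real (Suc n) powr (?a - 1 - Re s)"
    proof -
      have "X * 1 / fact J \<le> X" if "X \<ge> 0" for X :: real
        using that mult_left_mono[OF fact_ge_1[of J, where ?'a = real] that] by (simp add: field_simps)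
      thus ?thesis by simp
    qed
    finally show ?thesis by (simp add: e_def f_def P_def)
  qed
  obtain R where R: "R holomorphic_on {s. ?a < Re s}" "\<And>s. ?a < Re s \<Longrightarrow> (\<lambda>n. e n s) sums R s"
  proof (rule powr_summable_local[where c = "\<lambda>s. P s (Suc J)" and a = ?a and e = e])
    show "continuous_on UNIV (\<lambda>s. P s (Suc J))"
      using Phol holomorphic_on_imp_continuous_on by blast
  qed (use ele ehol in auto)
  define G where
    "G = (\<lambda>s. R s + 1 - (\<Sum>i=2..J. P s (i - 1) * F (s + of_nat (i - 1)) / fact i))"
  have "G holomorphic_on {s. ?a < Re s}"
    unfolding G_def
  proof (intro holomorphic_intros R Phol)
    fix i assume i: "i \<in> {2..J}"
    have "F \<circ> (\<lambda>s. s + of_nat (i - 1)) holomorphic_on {s. ?a < Re s}"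
      by (rule holomorphic_on_compose_gen[OF _ F(1)]) (use i in \<open>auto intro!: holomorphic_intros\<close>)
    thus "(\<lambda>s. F (s + of_nat (i - 1))) holomorphic_on {s. ?a < Re s}" by (simp add: o_def)
  qed auto
  moreover have "G s = (s - 1) * (\<Sum>n. of_nat (Suc n) powr (- s))" if s: "1 < Re s" for s
  proof -
    define Z :: "complex \<Rightarrow> complex" where "Z = (\<lambda>s. \<Sum>n. of_nat (Suc n) powr (- s))"
    have Z: "(\<lambda>n. of_nat (Suc n) powr (- w)) sums Z w" if "1 < Re w" for w
      unfolding Z_def using that by (rule dirichlet_zeta_sums)
    have FZ: "F w = (w - 1) * Z w" if "1 < Re w" for w
      using F(2)[OF that] by (simp add: Z_def)
    have "(\<lambda>n. of_nat (Suc n) powr (1 - s) :: complex) \<longlonglongrightarrow> 0"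
    proof (rule tendsto_neg_powr_complex_of_nat)
      show "filterlim Suc at_top sequentially" by (rule filterlim_Suc)
    qed (use s in auto)
    from telescope_sums[OF this]
    have T: "(\<lambda>n. of_nat (Suc (Suc n)) powr (1 - s) - of_nat (Suc n) powr (1 - s)) sums (- 1 :: complex)"
      by simp
    have "(\<lambda>n. (of_nat (Suc (Suc n)) powr (1 - s) - of_nat (Suc n) powr (1 - s)) -
              (\<Sum>i=1..J. P s i / fact i * of_nat (Suc n) powr (- (s + of_nat (i - 1)))))
          sums (- 1 - (\<Sum>i=1..J. P s i / fact i * Z (s + of_nat (i - 1))))"
      using s by (intro sums_diff T sums_sum sums_mult Z) auto
    moreover have "(of_nat (Suc (Suc n)) powr (1 - s) - of_nat (Suc n) powr (1 - s)) -
              (\<Sum>i=1..J. P s i / fact i * of_nat (Suc n) powr (- (s + of_nat (i - 1)))) = e n s" for n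
    proof -
      have "(\<Sum>i\<le>J. P s i * of_nat (Suc n) powr (1 - s - of_nat i) / fact i) =
            of_nat (Suc n) powr (1 - s) + (\<Sum>i=1..J. P s i * of_nat (Suc n) powr (1 - s - of_nat i) / fact i)"
        by (simp add: atMost_atLeast0 sum.atLeast_Suc_atMost P_def)
      also have "(\<Sum>i=1..J. P s i * of_nat (Suc n) powr (1 - s - of_nat i) / fact i) =
                 (\<Sum>i=1..J. P s i / fact i * of_nat (Suc n) powr (- (s + of_nat (i - 1))))"
        by (intro sum.cong refl) (auto simp: of_nat_diff algebra_simps)
      finally show ?thesis by (simp add: e_def)
    qed
    ultimately have "(\<lambda>n. e n s) sums (- 1 - (\<Sum>i=1..J. P s i / fact i * Z (s + of_nat (i - 1))))"
      by simp
    moreover have "(\<lambda>n. e n s) sums R s" using R(2) s by simp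
    ultimately have "R s = - 1 - (\<Sum>i=1..J. P s i / fact i * Z (s + of_nat (i - 1)))"
      using sums_unique2 by blast
    also have "(\<Sum>i=1..J. P s i / fact i * Z (s + of_nat (i - 1))) =
               (1 - s) * Z s + (\<Sum>i=2..J. P s i / fact i * Z (s + of_nat (i - 1)))"
      by (subst sum.atLeast_Suc_atMost) (auto simp: J_def P_def numeral_2_eq_2)
    also have "(\<Sum>i=2..J. P s i / fact i * Z (s + of_nat (i - 1))) =
               (\<Sum>i=2..J. - (P s (i - 1) * F (s + of_nat (i - 1)) / fact i))"
    proof (intro sum.cong refl)
      fix i assume i: "i \<in> {2..J}"
      then obtain k where k: "i = Suc k" by (cases i) auto
      have "F (s + of_nat k) = (s + of_nat k - 1) * Z (s + of_nat k)" using s by (intro FZ) simp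
      thus "P s i / fact i * Z (s + of_nat (i - 1)) = - (P s (i - 1) * F (s + of_nat (i - 1)) / fact i)"
        unfolding k by (simp add: P_def divide_simps del: fact_Suc) (simp add: algebra_simps)
    qed
    finally show ?thesis by (simp add: G_def Z_def sum_negf algebra_simps)
  qed
  ultimately show ?case by (intro exI[of _ G]) simp
qed

lemma ex1_zeta:
  "\<exists>!f. f holomorphic_on - {1} \<and>
      (\<forall>s. 1 < Re s \<longrightarrow> f s = (\<Sum>n. of_nat (Suc n) powr (- s))) \<and> f 1 = 0"
proof -
  let ?Z = "\<lambda>s::complex. \<Sum>n. of_nat (Suc n) powr (- s) :: complex"
  define H where "H = (\<lambda>N. {s. 1 - real N < Re s})"
  have opH: "open (H N)" for N by (simp add: H_def open_halfspace_Re_gt)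
  have conH: "connected (H N)" for N
    by (simp add: H_def convex_connected convex_halfspace_Re_gt)
  have H_mono: "H M \<subseteq> H N" if "M \<le> N" for M N using that by (auto simp: H_def)
  obtain F where F: "\<And>N. F N holomorphic_on H N"
     "\<And>N s. 1 < Re s \<Longrightarrow> F N s = (s - 1) * ?Z s"
    using zeta_continuation_step unfolding H_def by metis
  have FF: "F N s = F M s" if "s \<in> H M" "M \<le> N" for M N s
  proof (rule analytic_continuation_open[of "{s. 1 < Re s}" "H M" "F N" "F M" s])
    show "{s. 1 < Re s} \<noteq> {}" by (auto intro!: exI[of _ 2])
    show "F N holomorphic_on H M" using F(1) H_mono that(2) holomorphic_on_subset by blast
  qed (use that opH conH F in \<open>auto simp: H_def open_halfspace_Re_gt\<close>)
  define E where "E = (\<lambda>s. F (LEAST N. s \<in> H N) s)"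
  have E: "E s = F N s" if "s \<in> H N" for N s
    using FF[of s "LEAST N. s \<in> H N" N] LeastI[of "\<lambda>N. s \<in> H N", OF that]
      Least_le[of "\<lambda>N. s \<in> H N", OF that] by (simp add: E_def)
  have "E holomorphic_on H N" for N
    using F(1)[of N] E by (subst holomorphic_cong[OF refl, of _ _ "F N"]) auto
  hence "E holomorphic_on (\<Union>N. H N)" using opH by (intro holomorphic_on_UN_open) auto
  moreover have "s \<in> (\<Union>N. H N)" for s
    using reals_Archimedean2[of "1 - Re s"] by (auto simp: H_def algebra_simps)
  ultimately have Ehol: "E holomorphic_on UNIV" by (metis UNIV_eq_I)
  have Eeq: "E s = (s - 1) * ?Z s" if "1 < Re s" for s
    using E[of s 0] F(2)[OF that] that by (simp add: H_def)
  define f where "f = (\<lambda>s. E s / (s - 1))"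
  show ?thesis
  proof (rule ex1I[of _ f])
    have "f holomorphic_on - {1}" unfolding f_def
      by (intro holomorphic_intros holomorphic_on_subset[OF Ehol]) auto
    moreover have "f s = ?Z s" if "1 < Re s" for s using Eeq[OF that] that by (auto simp: f_def)
    ultimately show f: "f holomorphic_on - {1} \<and> (\<forall>s. 1 < Re s \<longrightarrow> f s = ?Z s) \<and> f 1 = 0"
      by (simp add: f_def)
    fix g assume g: "g holomorphic_on - {1} \<and> (\<forall>s. 1 < Re s \<longrightarrow> g s = ?Z s) \<and> g 1 = 0"
    have "g s = f s" if "s \<noteq> 1" for s
    proof (rule analytic_continuation_open[of "{s. 1 < Re s}" "- {1}" g f s])
      show "{s. 1 < Re s} \<noteq> {}" by (auto intro!: exI[of _ 2])
      show "connected (- {1::complex})" by (intro connected_punctured_universe) simp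
    qed (use that f g in \<open>auto simp: open_halfspace_Re_gt\<close>)
    thus "g = f" using f g by (metis ext)
  qed
qed

lemma holomorphic_zeta: "zeta holomorphic_on - {1}"
  and zeta_eq_series: "1 < Re s \<Longrightarrow> zeta s = (\<Sum>n. of_nat (Suc n) powr (- s))"
  using theI'[OF ex1_zeta, folded zeta_def] by blast+

end

theory Submission
  imports Defs
begin

text \<open>
  Write \<open>P\<^sub>N(w) = \<Prod>\<^sub>p\<^sub>\<le>\<^sub>N (1 - p\<^sup>-\<^sup>w)\<close>. To the right of the critical line \<open>P\<^sub>N \<zeta>\<close> is close to \<open>1\<close> along
  the whole horizontal half-line through \<open>\<sigma> + iy\<close>, except for \<open>y\<close> in a set whose density tends to \<open>0\<close>
  as \<open>N \<rightarrow> \<infinity>\<close>; off this set \<open>log \<zeta>\<close> is approximated by \<open>-log P\<^sub>N\<close>. The estimate is a mean-square bound: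
  for \<open>y\<close> of size \<open>T\<close> an Euler-Maclaurin type expansion replaces \<open>\<zeta>\<close> by a Dirichlet polynomial of length
  \<open>T\<^sup>1\<^sup>+\<^sup>\<delta>\<close>, whose off-diagonal terms are negligible because \<open>2 - 2\<sigma> < 1\<close>.

  Since \<open>\<Sum> p\<^sup>-\<^sup>\<sigma>\<close> diverges, \<open>\<Sum> p\<^sup>-\<^sup>2\<^sup>\<sigma>\<close> converges and the \<open>d\<^sub>k\<close> are distinct and positive, unimodular \<open>v\<^sub>p\<close> can
  be chosen greedily so that the sums \<open>-\<Sum>\<^sub>p log (1 - p\<^sup>-\<^sup>s v\<^sub>p\<^sup>d\<^sup>k)\<close> simultaneously approach all targets \<open>z\<^sub>k\<close>.

  Finally \<open>\<tau>\<close> is weighted by \<open>W(\<tau>) = \<Prod>\<^sub>p\<^sub>\<le>\<^sub>N |(1 + p\<^sup>-\<^sup>i\<^sup>\<tau> / v\<^sub>p) / 2|\<^sup>2\<^sup>m\<close>, which concentrates on the \<open>\<tau>\<close> with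
  \<open>p\<^sup>-\<^sup>i\<^sup>\<tau>\<close> close to \<open>v\<^sub>p\<close> for all \<open>p \<le> N\<close>. By unique factorisation the primes beyond \<open>N\<close> are independent
  of \<open>W\<close>, so their contribution is small for most \<open>\<tau>\<close> in the sense of \<open>W\<close>, and the exceptional set above,
  for a much larger \<open>N\<close>, has density below the mean of \<open>W\<close>. All densities are taken on \<open>[T, 2T]\<close>.
\<close>

section \<open>Approximation of zeta by Dirichlet polynomials\<close>

text \<open>The value of \<open>log_zeta\<close> at a point depends on \<open>zeta\<close> along the
  whole half-line to its right, so closeness of \<open>sifted_zeta\<close> to 1 at a single abscissa
  says nothing about the branch. Mean squares are therefore taken of a Dirichlet polynomial and of
  its derivative, which controls all abscissas at once; an exponent strictly between 1/2 and
  \<sigma> leaves room for the logarithm that the derivative produces. The weight does the work of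
  Kronecker's theorem. Being at most 1, it charges an exceptional set no more than its measure;
  being a trigonometric polynomial with explicit mean, it calls for no equidistribution. The order
  of the choices is decisive: the mean of the weight depends only on the first level
  \<open>N\<close> and the exponent \<open>m\<close>, so the exceptional set can be made small
  against it by choosing a second level afterwards. A single rotation per prime serves all shifts
  through its powers with exponents d_k. Orthogonality of these powers is what allows one rotation
  to move all n sums in useful directions.\<close>

text \<open>By the mean value theorem each term is at most the decrement of
  \<open>x powr (1 - b) / (b - 1)\<close> over the unit interval ending at its index, so the tail
  telescopes: the integral test with explicit constant.\<close>

lemma powr_tail_bound:
  fixes b :: real
  assumes "1 < b" "1 \<le> X"
  shows "summable (\<lambda>n. real (n + X + 1) powr (- b))"
    and "(\<Sum>n. real (n + X + 1) powr (- b)) \<le> real X powr (1 - b) / (b - 1)"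
proof -
  let ?g = "\<lambda>n. real (n + X) powr (1 - b) / (b - 1)"
  have le: "real (n + X + 1) powr (- b) \<le> ?g n - ?g (Suc n)" for n
  proof -
    have "\<exists>z. real (n + X) < z \<and> z < real (n + X) + 1 \<and>
        (real (n + X) + 1) powr (1 - b) - real (n + X) powr (1 - b)
          = (real (n + X) + 1 - real (n + X)) * ((1 - b) * z powr (1 - b - 1))"
      by (rule MVT2) (use assms in \<open>auto intro!: DERIV_cong[OF has_real_derivative_powr]\<close>)
    then obtain z where z: "real (n + X) < z" "z < real (n + X) + 1"
      "(real (n + X) + 1) powr (1 - b) - real (n + X) powr (1 - b) = (1 - b) * z powr (- b)"
      by auto
    have "real (n + X + 1) powr (- b) \<le> z powr (- b)"
      using z assms by (intro powr_mono2') auto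
    also have "\<dots> = (real (n + X) powr (1 - b) - (real (n + X) + 1) powr (1 - b)) / (b - 1)"
    proof -
      have "real (n + X) powr (1 - b) - (real (n + X) + 1) powr (1 - b) = (b - 1) * z powr (- b)"
        using z(3) by (simp add: algebra_simps)
      thus ?thesis using assms by simp
    qed
    also have "\<dots> = ?g n - ?g (Suc n)"
      by (simp add: diff_divide_distrib add.commute add.left_commute)
    finally show ?thesis .
  qed
  have lim: "?g \<longlonglongrightarrow> 0"
  proof -
    have "((\<lambda>n. real (n + X) powr (1 - b)) \<longlongrightarrow> 0) sequentially"
    proof (rule tendsto_neg_powr)
      show "filterlim (\<lambda>n. real (n + X)) at_top sequentially"
        by (intro filterlim_compose[OF filterlim_real_sequentially] filterlim_add_const_nat_at_top)
    qed (use assms in auto)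
    from tendsto_divide[OF this tendsto_const[of "b - 1"]] show ?thesis using assms by simp
  qed
  have sums: "(\<lambda>n. ?g n - ?g (Suc n)) sums (?g 0 - 0)"
    by (rule telescope_sums'[OF lim])
  show s: "summable (\<lambda>n. real (n + X + 1) powr (- b))"
    by (rule summable_comparison_test'[OF sums_summable[OF sums], of 0]) (use le in auto)
  have "(\<Sum>n. real (n + X + 1) powr (- b)) \<le> (\<Sum>n. ?g n - ?g (Suc n))"
    by (intro suminf_le le s sums_summable[OF sums])
  also have "\<dots> = ?g 0" using sums_unique[OF sums] by simp
  finally show "(\<Sum>n. real (n + X + 1) powr (- b)) \<le> real X powr (1 - b) / (b - 1)" by simp
qed

text \<open>Defined by subtraction from \<open>zeta\<close>, not as the tail of the series, so that
  it has a meaning to the left of Re s = 1.\<close>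

definition zeta_tail :: "nat \<Rightarrow> complex \<Rightarrow> complex" where
  "zeta_tail X s = zeta s - (\<Sum>n<X. of_nat (Suc n) powr (- s))"

lemma zeta_tail_sums:
  assumes "1 < Re s"
  shows "(\<lambda>n. of_nat (Suc (n + X)) powr (- s)) sums zeta_tail X s"
proof -
  have "(\<lambda>n. of_nat (Suc n) powr (- s)) sums zeta s"
    using dirichlet_zeta_sums[OF assms] zeta_eq_series[OF assms] by simp
  from sums_split_initial_segment[OF this, of X] show ?thesis by (simp add: zeta_tail_def)
qed

lemma zeta_tail_holomorphic: "zeta_tail X holomorphic_on - {1}"
  unfolding zeta_tail_def by (intro holomorphic_intros holomorphic_zeta)

text \<open>The coefficient produced by differentiating \<open>u powr (1 - s)\<close>
  \<open>i\<close> times.\<close>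

definition falling_prod :: "complex \<Rightarrow> nat \<Rightarrow> complex" where
  "falling_prod s i = (\<Prod>j<i. 1 - s - of_nat j)"

text \<open>The Taylor remainder of order \<open>J\<close> of \<open>u powr (1 - s)\<close>,
  expanded about \<open>Suc n\<close> and evaluated one step to the right.\<close>

definition taylor_rem :: "nat \<Rightarrow> nat \<Rightarrow> complex \<Rightarrow> complex" where
  "taylor_rem J n s = of_nat (Suc (Suc n)) powr (1 - s) -
            (\<Sum>i\<le>J. falling_prod s i * of_nat (Suc n) powr (1 - s - of_nat i) / fact i)"

lemma falling_prod_holomorphic: "(\<lambda>s. falling_prod s i) holomorphic_on A"
  unfolding falling_prod_def by (intro holomorphic_intros)

lemma taylor_rem_holomorphic: "taylor_rem J n holomorphic_on A"
  unfolding taylor_rem_def by (intro holomorphic_intros falling_prod_holomorphic) auto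

text \<open>On the unit segment the derivative of order \<open>J + 1\<close> is largest at the left
  end, because its exponent \<open>- Re s - J\<close> is negative.\<close>

lemma norm_taylor_rem_le:
  assumes s: "0 < Re s"
  shows "norm (taylor_rem J n s) \<le> norm (falling_prod s (Suc J)) * real (Suc n) powr (- Re s - J)"
proof -
  let ?S = "closed_segment (complex_of_real (Suc n)) (of_real (Suc (Suc n)))"
  define f where "f = (\<lambda>i u. falling_prod s i * u powr (1 - s - of_nat i))"
  have S: "\<exists>r. u = of_real r \<and> real (Suc n) \<le> r" if "u \<in> ?S" for u
  proof -
    from that have "u \<in> of_real ` closed_segment (real (Suc n)) (real (Suc (Suc n)))"
      by (simp only: closed_segment_of_real)
    thus ?thesis by (auto simp: closed_segment_eq_real_ivl)
  qed
  define B where "B = norm (falling_prod s (Suc J)) * real (Suc n) powr (- Re s - J)"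
  have "norm (f 0 (of_real (Suc (Suc n))) -
          (\<Sum>i\<le>J. f i (of_real (Suc n)) * (of_real (Suc (Suc n)) - of_real (Suc n)) ^ i / fact i))
      \<le> B * norm (complex_of_real (Suc (Suc n)) - of_real (Suc n)) ^ Suc J / fact J"
  proof (rule complex_Taylor[where S = ?S])
    fix i u assume u: "u \<in> ?S"
    then obtain r where r: "u = of_real r" "real (Suc n) \<le> r" using S by blast
    have "u \<notin> \<real>\<^sub>\<le>\<^sub>0" using r by (auto simp: complex_nonpos_Reals_iff)
    hence "((\<lambda>u. u powr (1 - s - of_nat i)) has_field_derivative
             (1 - s - of_nat i) * u powr (1 - s - of_nat i - 1)) (at u)"
      by (rule has_field_derivative_powr)
    hence "(f i has_field_derivative falling_prod s i * ((1 - s - of_nat i) * u powr (1 - s - of_nat i - 1))) (at u)"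
      unfolding f_def by (rule DERIV_cmult)
    moreover have "falling_prod s i * ((1 - s - of_nat i) * u powr (1 - s - of_nat i - 1)) = f (Suc i) u"
      by (simp add: f_def falling_prod_def algebra_simps)
    ultimately show "(f i has_field_derivative f (Suc i) u) (at u within ?S)"
      using has_field_derivative_at_within by metis
  next
    fix u assume u: "u \<in> ?S"
    then obtain r where r: "u = of_real r" "real (Suc n) \<le> r" using S by blast
    have "norm (u powr (1 - s - of_nat (Suc J))) = r powr (- Re s - J)"
      using r by (subst norm_powr_real_powr) (auto intro!: arg_cong[of _ _ "(powr) r"])
    also have "\<dots> \<le> real (Suc n) powr (- Re s - J)"
      using r s by (intro powr_mono2') auto
    finally show "norm (f (Suc J) u) \<le> B"
      unfolding f_def norm_mult B_def by (intro mult_left_mono) auto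
  qed auto
  also have "\<dots> \<le> B"
  proof -
    have "X * 1 / fact J \<le> X" if "X \<ge> 0" for X :: real
      using that mult_left_mono[OF fact_ge_1[of J, where ?'a = real] that] by (simp add: field_simps)
    from this[of B] show ?thesis by (simp add: B_def)
  qed
  finally show ?thesis by (simp add: taylor_rem_def f_def falling_prod_def B_def)
qed

text \<open>The factor 2 bounds \<open>1 / (Re s + J - 1)\<close>, the constant of the tail
  estimate, whose denominator is at least 1/2.\<close>

lemma norm_taylor_rem_sum_le:
  assumes s: "1/2 \<le> Re s" and J: "1 \<le> J" and X: "1 \<le> X"
    and E: "(\<lambda>n. taylor_rem J (n + X) s) sums E"
  shows "norm E \<le> 2 * norm (falling_prod s (Suc J)) * real X powr (1 - Re s - J)"
proof -
  let ?b = "Re s + J"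
  have b: "1 < ?b" "1/2 \<le> ?b - 1" using s J by auto
  have le: "norm (taylor_rem J (n + X) s) \<le> norm (falling_prod s (Suc J)) * real (n + X + 1) powr (- ?b)" for n
    using norm_taylor_rem_le[of s J "n + X"] s by (simp add: algebra_simps)
  have "norm E \<le> (\<Sum>n. norm (falling_prod s (Suc J)) * real (n + X + 1) powr (- ?b))"
    unfolding sums_unique[OF E]
    by (rule norm_suminf_le) (intro le summable_mult powr_tail_bound(1) b X)+
  also have "\<dots> = norm (falling_prod s (Suc J)) * (\<Sum>n. real (n + X + 1) powr (- ?b))"
    by (intro suminf_mult powr_tail_bound(1) b X)
  also have "\<dots> \<le> norm (falling_prod s (Suc J)) * (real X powr (1 - ?b) / (?b - 1))"
    by (intro mult_left_mono powr_tail_bound(2) b X) auto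
  also have "\<dots> \<le> norm (falling_prod s (Suc J)) * (2 * real X powr (1 - ?b))"
  proof (intro mult_left_mono)
    have "real X powr (1 - ?b) * 1 \<le> real X powr (1 - ?b) * (2 * (?b - 1))"
      using b by (intro mult_left_mono) auto
    thus "real X powr (1 - ?b) / (?b - 1) \<le> 2 * real X powr (1 - ?b)"
      using b by (simp add: field_simps)
  qed auto
  finally show ?thesis by (simp add: algebra_simps)
qed

text \<open>Summing the Taylor expansion of \<open>(m + 1)\<^sup>1\<^sup>-\<^sup>s\<close> about \<open>m\<close> over \<open>m > X\<close> telescopes on the left.\<close>

lemma zeta_tail_recursion:
  assumes J: "1 \<le> J"
  obtains E where "\<And>s. 0 < Re s \<Longrightarrow> (\<lambda>n. taylor_rem J (n + X) s) sums E s"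
    "\<And>s. 0 < Re s \<Longrightarrow> s \<noteq> 1 \<Longrightarrow> (1 - s) * zeta_tail X s = - (of_nat (Suc X) powr (1 - s)) - E s -
       (\<Sum>i=2..J. falling_prod s i / fact i * zeta_tail X (s + of_nat (i - 1)))"
proof -
  obtain E where E: "E holomorphic_on {s. 0 < Re s}" "\<And>s. 0 < Re s \<Longrightarrow> (\<lambda>n. taylor_rem J (n + X) s) sums E s"
  proof (rule powr_summable_local[where c = "\<lambda>s. falling_prod s (Suc J)" and a = 0 and e = "\<lambda>n. taylor_rem J (n + X)"])
    show "continuous_on UNIV (\<lambda>s. falling_prod s (Suc J))"
      using falling_prod_holomorphic holomorphic_on_imp_continuous_on by blast
    fix n and s :: complex assume s: "0 < Re s"
    have "real (Suc (n + X)) powr (- Re s - J) \<le> real (Suc n) powr (- Re s - J)"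
      using s by (intro powr_mono2') auto
    also have "\<dots> \<le> real (Suc n) powr (0 - 1 - Re s)"
      using J by (intro powr_mono) auto
    finally show "norm (taylor_rem J (n + X) s) \<le> norm (falling_prod s (Suc J)) * real (Suc n) powr (0 - 1 - Re s)"
      using norm_taylor_rem_le[OF s, of J "n + X"] mult_left_mono norm_ge_zero order_trans by blast
  qed (use taylor_rem_holomorphic in auto)
  define R where "R = (\<lambda>s. - (of_nat (Suc X) powr (1 - s)) - E s -
       (\<Sum>i=2..J. falling_prod s i / fact i * zeta_tail X (s + of_nat (i - 1))))"
  have main: "(1 - s) * zeta_tail X s = R s" if s: "1 < Re s" for s
  proof -
    have "(\<lambda>n. of_nat (Suc n) powr (1 - s) :: complex) \<longlonglongrightarrow> 0"
    proof (rule tendsto_neg_powr_complex_of_nat)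
      show "filterlim Suc at_top sequentially" by (rule filterlim_Suc)
    qed (use s in auto)
    from telescope_sums[OF LIMSEQ_ignore_initial_segment[OF this, of X]]
    have T: "(\<lambda>n. of_nat (Suc (Suc (n + X))) powr (1 - s) - of_nat (Suc (n + X)) powr (1 - s))
        sums (- (of_nat (Suc X) powr (1 - s)) :: complex)"
      by simp
    have "(\<lambda>n. (of_nat (Suc (Suc (n + X))) powr (1 - s) - of_nat (Suc (n + X)) powr (1 - s)) -
              (\<Sum>i=1..J. falling_prod s i / fact i * of_nat (Suc (n + X)) powr (- (s + of_nat (i - 1)))))
          sums (- (of_nat (Suc X) powr (1 - s)) - (\<Sum>i=1..J. falling_prod s i / fact i * zeta_tail X (s + of_nat (i - 1))))"
      using s by (intro sums_diff T sums_sum sums_mult zeta_tail_sums) auto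
    moreover have "(of_nat (Suc (Suc (n + X))) powr (1 - s) - of_nat (Suc (n + X)) powr (1 - s)) -
              (\<Sum>i=1..J. falling_prod s i / fact i * of_nat (Suc (n + X)) powr (- (s + of_nat (i - 1)))) = taylor_rem J (n + X) s" for n
    proof -
      have "(\<Sum>i\<le>J. falling_prod s i * of_nat (Suc (n + X)) powr (1 - s - of_nat i) / fact i) =
            of_nat (Suc (n + X)) powr (1 - s) + (\<Sum>i=1..J. falling_prod s i * of_nat (Suc (n + X)) powr (1 - s - of_nat i) / fact i)"
        by (simp add: atMost_atLeast0 sum.atLeast_Suc_atMost falling_prod_def)
      also have "(\<Sum>i=1..J. falling_prod s i * of_nat (Suc (n + X)) powr (1 - s - of_nat i) / fact i) =
                 (\<Sum>i=1..J. falling_prod s i / fact i * of_nat (Suc (n + X)) powr (- (s + of_nat (i - 1))))"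
        by (intro sum.cong refl) (auto simp: of_nat_diff algebra_simps)
      finally show ?thesis by (simp add: taylor_rem_def)
    qed
    ultimately have "(\<lambda>n. taylor_rem J (n + X) s) sums (- (of_nat (Suc X) powr (1 - s)) -
        (\<Sum>i=1..J. falling_prod s i / fact i * zeta_tail X (s + of_nat (i - 1))))"
      by simp
    moreover have "(\<lambda>n. taylor_rem J (n + X) s) sums E s" using E(2) s by simp
    ultimately have "E s = - (of_nat (Suc X) powr (1 - s)) - (\<Sum>i=1..J. falling_prod s i / fact i * zeta_tail X (s + of_nat (i - 1)))"
      using sums_unique2 by blast
    \<comment> \<open>The term \<open>i = 1\<close> contains \<open>zeta_tail X s\<close> itself,
      with the factor \<open>falling_prod s 1 = 1 - s\<close>; solving for it gives the
      recursion.\<close>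
    also have "(\<Sum>i=1..J. falling_prod s i / fact i * zeta_tail X (s + of_nat (i - 1))) =
               (1 - s) * zeta_tail X s + (\<Sum>i=2..J. falling_prod s i / fact i * zeta_tail X (s + of_nat (i - 1)))"
      using J by (subst sum.atLeast_Suc_atMost) (auto simp: falling_prod_def numeral_2_eq_2)
    finally show ?thesis unfolding R_def by (simp add: algebra_simps)
  qed
  \<comment> \<open>Both sides are holomorphic on the half-plane without 1, which is still
    connected; the shifted arguments avoid the pole because their real parts exceed 1.\<close>
  have "(1 - s) * zeta_tail X s = R s" if s: "0 < Re s" "s \<noteq> 1" for s
  proof (rule analytic_continuation_open[of "{s. 1 < Re s}" "{s. 0 < Re s} - {1}"
        "\<lambda>s. (1 - s) * zeta_tail X s" R s])
    show "{s. 1 < Re s} \<noteq> {}" by (auto intro!: exI[of _ 2])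
    show "connected ({s. 0 < Re s} - {1::complex})"
      by (intro connected_open_delete convex_connected convex_halfspace_Re_gt)
         (auto simp: open_halfspace_Re_gt)
    show "(\<lambda>s. (1 - s) * zeta_tail X s) holomorphic_on {s. 0 < Re s} - {1}"
      by (intro holomorphic_intros holomorphic_on_subset[OF zeta_tail_holomorphic]) auto
    show "R holomorphic_on {s. 0 < Re s} - {1}"
      unfolding R_def
    proof (intro holomorphic_intros falling_prod_holomorphic)
      show "E holomorphic_on {s. 0 < Re s} - {1}" by (rule holomorphic_on_subset[OF E(1)]) auto
      fix i assume i: "i \<in> {2..J}"
      have "zeta_tail X \<circ> (\<lambda>s. s + of_nat (i - 1)) holomorphic_on {s. 0 < Re s} - {1}"
      proof (rule holomorphic_on_compose_gen[OF _ zeta_tail_holomorphic])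
        have "s + of_nat (i - 1) \<noteq> 1" if "0 < Re s" for s
        proof
          assume "s + of_nat (i - 1) = 1"
          hence "Re s + real (i - 1) = 1" by (metis one_complex.sel(1) plus_complex.sel(1) complex_Re_of_nat)
          moreover have "real (i - 1) \<ge> 1" using i by auto
          ultimately show False using that by linarith
        qed
        thus "(\<lambda>s. s + of_nat (i - 1)) ` ({s. 0 < Re s} - {1}) \<subseteq> - {1}" by auto
      qed (auto intro!: holomorphic_intros)
      thus "(\<lambda>s. zeta_tail X (s + of_nat (i - 1))) holomorphic_on {s. 0 < Re s} - {1}" by (simp add: o_def)
    qed auto
  qed (use s main in \<open>auto simp: open_halfspace_Re_gt intro!: open_delete\<close>)
  thus ?thesis unfolding R_def by (intro that[of E] E(2))
qed

text \<open>The factor \<open>1 - s\<close> is kept apart because it cancels against the left-hand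
  side of the recursion; each further factor grows at most linearly in
  \<open>norm s\<close>.\<close>

lemma norm_falling_prod_le:
  assumes "1 \<le> norm s" "1 \<le> i" "i \<le> Suc J"
  shows "norm (falling_prod s i) \<le> norm (1 - s) * ((real J + 2) * norm s) ^ (i - 1)"
proof -
  obtain k where k: "i = Suc k" using assms by (cases i) auto
  have "norm (\<Prod>j<k. - s - of_nat j) \<le> (\<Prod>j<k. (real J + 2) * norm s)"
    unfolding prod_norm[symmetric]
  proof (intro prod_mono conjI)
    fix j assume j: "j \<in> {..<k}"
    have "norm (- s - of_nat j) \<le> norm s + real j"
      using norm_triangle_ineq4[of "- s" "of_nat j"] by simp
    also have "\<dots> \<le> norm s + real j * norm s"
      using assms mult_left_mono[of 1 "norm s" "real j"] by simp
    also have "\<dots> = (1 + real j) * norm s" by (simp add: algebra_simps)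
    also have "\<dots> \<le> (real J + 2) * norm s"
      using j k assms by (intro mult_right_mono) auto
    finally show "norm (- s - of_nat j) \<le> (real J + 2) * norm s" .
  qed auto
  moreover have "falling_prod s i = (1 - s) * (\<Prod>j<k. - s - of_nat j)"
    unfolding falling_prod_def k prod.lessThan_Suc_shift by (simp add: algebra_simps)
  ultimately show ?thesis by (auto simp: norm_mult k intro!: mult_left_mono)
qed

text \<open>In the recursion each shift of \<open>s\<close> by \<open>i - 1\<close> gains \<open>X\<^sup>1\<^sup>-\<^sup>i\<close> and costs \<open>|s|\<^sup>i\<^sup>-\<^sup>1\<close>; it may therefore be estimated with the exponent \<open>J - i + 1\<close>.\<close>

lemma zeta_tail_bound:
  "1 \<le> J \<Longrightarrow> \<exists>C\<ge>0. \<forall>s X. 1/2 \<le> Re s \<longrightarrow> 1 \<le> Im s \<longrightarrow> 1 \<le> X \<longrightarrow>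
     norm (zeta_tail X s) \<le> C * real X powr (1 - Re s) * (1 / Im s + (norm s / real X) ^ J)"
proof (induction J rule: less_induct)
  case (less J)
  have "\<forall>k\<in>{1..<J}. \<exists>C\<ge>0. \<forall>s X. 1/2 \<le> Re s \<longrightarrow> 1 \<le> Im s \<longrightarrow> 1 \<le> X \<longrightarrow>
     norm (zeta_tail X s) \<le> C * real X powr (1 - Re s) * (1 / Im s + (norm s / real X) ^ k)"
    using less.IH by auto
  then obtain C where C: "\<And>k. k \<in> {1..<J} \<Longrightarrow> C k \<ge> 0"
    "\<And>k s X. k \<in> {1..<J} \<Longrightarrow> 1/2 \<le> Re s \<Longrightarrow> 1 \<le> Im s \<Longrightarrow> 1 \<le> X \<Longrightarrow>
     norm (zeta_tail X s) \<le> C k * real X powr (1 - Re s) * (1 / Im s + (norm s / real X) ^ k)"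
    unfolding bchoice_iff by blast
  define c where "c = real J + 2"
  have c: "c \<ge> 1" by (simp add: c_def)
  define D where "D = (\<lambda>i. 2 * c ^ (i - 1) * (C (J - i + 1) * c ^ J))"
  \<comment> \<open>The three parts of \<open>K\<close> belong to the boundary term, the Taylor
    remainder and the shifted tails of the recursion.\<close>
  define K where "K = 2 + 2 * c ^ J + (\<Sum>i=2..J. D i)"
  have D0: "D i \<ge> 0" if "i \<in> {2..J}" for i
    unfolding D_def using that c C(1)[of "J - i + 1"] by (intro mult_nonneg_nonneg) auto
  have "norm (zeta_tail X s) \<le> K * real X powr (1 - Re s) * (1 / Im s + (norm s / real X) ^ J)"
    if s: "1/2 \<le> Re s" "1 \<le> Im s" and X: "1 \<le> X" for s X
  proof -
    define q where "q = norm s / real X"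
    define A where "A = real X powr (1 - Re s)"
    define Y where "Y = 1 / Im s + q ^ J"
    have q0: "q \<ge> 0" by (simp add: q_def)
    have A0: "A \<ge> 0" by (simp add: A_def)
    have y: "0 < Im s" "1 / Im s \<le> 1" using s by auto
    have Y0: "Y \<ge> 0" "1 / Im s \<le> Y" "q ^ J \<le> Y" using y q0 by (auto simp: Y_def)
    have ns: "1 \<le> norm s" using s abs_Im_le_cmod[of s] by linarith
    have n1: "Im s \<le> norm (1 - s)" using abs_Im_le_cmod[of "1 - s"] s by simp
    hence n1': "0 < norm (1 - s)" using s by linarith
    have s1: "s \<noteq> 1" using s by auto
    have qs: "q * real X = norm s" using X by (simp add: q_def)
    obtain E where E: "\<And>s. 0 < Re s \<Longrightarrow> (\<lambda>n. taylor_rem J (n + X) s) sums E s"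
      "\<And>s. 0 < Re s \<Longrightarrow> s \<noteq> 1 \<Longrightarrow> (1 - s) * zeta_tail X s = - (of_nat (Suc X) powr (1 - s)) - E s -
         (\<Sum>i=2..J. falling_prod s i / fact i * zeta_tail X (s + of_nat (i - 1)))"
      by (rule zeta_tail_recursion[OF less.prems, of X]) (rule that)
    \<comment> \<open>Dividing the boundary term by \<open>norm (1 - s)\<close>, which is at least
      \<open>Im s\<close>, produces the summand \<open>1 / Im s\<close> of the bound.\<close>
    have t1: "norm (of_nat (Suc X) powr (1 - s)) \<le> norm (1 - s) * (2 * A * Y)"
    proof -
      have "norm (of_nat (Suc X) powr (1 - s) :: complex) = real (Suc X) powr (1 - Re s)"
        by (subst norm_powr_real_powr) auto
      also have "\<dots> \<le> 2 * A"
      proof (cases "Re s \<le> 1")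
        case True
        have "real (Suc X) powr (1 - Re s) \<le> (2 * real X) powr (1 - Re s)"
          using X True by (intro powr_mono2) auto
        also have "\<dots> = 2 powr (1 - Re s) * A" by (simp add: A_def powr_mult)
        also have "2 powr (1 - Re s) \<le> (2::real) powr 1" using s by (intro powr_mono) auto
        finally show ?thesis using A0 by (simp add: mult_right_mono)
      next
        case False
        have "real (Suc X) powr (1 - Re s) \<le> A"
          unfolding A_def using X False by (intro powr_mono2') auto
        thus ?thesis using A0 by simp
      qed
      also have "\<dots> \<le> norm (1 - s) * (2 * A * (1 / Im s))"
        using n1 y A0 mult_right_mono[OF n1, of "2 * A"] by (simp add: field_simps)
      also have "\<dots> \<le> norm (1 - s) * (2 * A * Y)"
        using Y0 A0 by (intro mult_left_mono) auto
      finally show ?thesis .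
    qed
    have t2: "norm (E s) \<le> norm (1 - s) * (2 * c ^ J * A * Y)"
    proof -
      have "norm (E s) \<le> 2 * norm (falling_prod s (Suc J)) * real X powr (1 - Re s - J)"
        using norm_taylor_rem_sum_le[OF s(1) less.prems X E(1)] s by simp
      also have "\<dots> \<le> 2 * (norm (1 - s) * (c * norm s) ^ J) * real X powr (1 - Re s - J)"
        using norm_falling_prod_le[OF ns, of "Suc J" J] by (intro mult_right_mono mult_left_mono) (auto simp: c_def)
      also have "\<dots> = norm (1 - s) * (2 * c ^ J * A * q ^ J)"
        using X by (simp add: A_def q_def powr_diff powr_realpow power_mult_distrib power_divide)
      also have "\<dots> \<le> norm (1 - s) * (2 * c ^ J * A * Y)"
        using Y0 A0 c by (intro mult_left_mono mult_nonneg_nonneg) auto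
      finally show ?thesis .
    qed
    have t3: "norm (falling_prod s i / fact i * zeta_tail X (s + of_nat (i - 1))) \<le> norm (1 - s) * (D i * A * Y)"
      if i: "i \<in> {2..J}" for i
    proof -
      define k where "k = J - i + 1"
      have k: "k \<in> {1..<J}" "i - 1 + k = J" using i by (auto simp: k_def)
      have f1: "norm (falling_prod s i / fact i) \<le> norm (1 - s) * (c * norm s) ^ (i - 1)"
      proof -
        have "norm (falling_prod s i / fact i) \<le> norm (falling_prod s i) / 1"
          unfolding norm_divide using fact_ge_1[of i, where ?'a = real]
          by (intro divide_left_mono) (auto simp: norm_fact)
        thus ?thesis using norm_falling_prod_le[OF ns, of i J] i by (auto simp: c_def)
      qed
      have nn: "norm (s + of_nat (i - 1)) \<le> c * norm s"
      proof -
        have "norm (s + of_nat (i - 1)) \<le> norm s + real (i - 1)"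
          using norm_triangle_ineq[of s "of_nat (i - 1)"] by simp
        also have "\<dots> \<le> norm s + real (i - 1) * norm s"
          using ns mult_left_mono[of 1 "norm s" "real (i - 1)"] by simp
        also have "\<dots> = (1 + real (i - 1)) * norm s" by (simp add: algebra_simps)
        also have "\<dots> \<le> c * norm s" using i by (intro mult_right_mono) (auto simp: c_def)
        finally show ?thesis .
      qed
      have Ck: "C k \<ge> 0" using C(1) k by simp
      have "norm (zeta_tail X (s + of_nat (i - 1))) \<le>
         C k * real X powr (1 - Re (s + of_nat (i - 1))) * (1 / Im (s + of_nat (i - 1)) + (norm (s + of_nat (i - 1)) / real X) ^ k)"
        using k s X by (intro C(2)) auto
      also have "\<dots> \<le> C k * real X powr (1 - Re (s + of_nat (i - 1))) * (1 / Im s + (c * norm s / real X) ^ k)"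
        using nn Ck X by (intro mult_left_mono add_mono power_mono divide_right_mono mult_nonneg_nonneg) auto
      also have "real X powr (1 - Re (s + of_nat (i - 1))) = A / real X ^ (i - 1)"
        using X by (simp add: A_def powr_realpow[symmetric] powr_diff[symmetric] algebra_simps)
      also have "C k * (A / real X ^ (i - 1)) * (1 / Im s + (c * norm s / real X) ^ k) \<le>
                 C k * (A / real X ^ (i - 1)) * (c ^ J * (1 / Im s + q ^ k))"
      proof (intro mult_left_mono)
        have "(c * norm s / real X) ^ k = c ^ k * q ^ k" by (simp add: q_def power_mult_distrib power_divide)
        also have "\<dots> \<le> c ^ J * q ^ k" using c k q0 by (intro mult_right_mono power_increasing) auto
        finally have "(c * norm s / real X) ^ k \<le> c ^ J * q ^ k" .
        moreover have "1 / Im s \<le> c ^ J * (1 / Im s)"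
          using mult_right_mono[OF one_le_power[OF c, of J], of "1 / Im s"] y by simp
        ultimately show "1 / Im s + (c * norm s / real X) ^ k \<le> c ^ J * (1 / Im s + q ^ k)"
          by (simp only: distrib_left)
      qed (use Ck A0 in auto)
      finally have f2: "norm (zeta_tail X (s + of_nat (i - 1))) \<le>
          C k * (A / real X ^ (i - 1)) * (c ^ J * (1 / Im s + q ^ k))" .
      have "norm (falling_prod s i / fact i * zeta_tail X (s + of_nat (i - 1))) \<le>
          (norm (1 - s) * (c * norm s) ^ (i - 1)) * (C k * (A / real X ^ (i - 1)) * (c ^ J * (1 / Im s + q ^ k)))"
        unfolding norm_mult by (rule mult_mono[OF f1 f2]) (use c in auto)
      also have "\<dots> = norm (1 - s) * (c ^ (i - 1) * (C k * c ^ J) * A * (q ^ (i - 1) * (1 / Im s + q ^ k)))"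
        by (simp add: q_def power_mult_distrib power_divide)
      also have "\<dots> \<le> norm (1 - s) * (c ^ (i - 1) * (C k * c ^ J) * A * (2 * Y))"
      proof (intro mult_left_mono)
        \<comment> \<open>An intermediate power lies below 1 if \<open>q \<le> 1\<close> and below
          the highest power otherwise.\<close>
        have "q ^ (i - 1) \<le> 1 + q ^ J"
        proof (cases "q \<le> 1")
          case True
          hence "q ^ (i - 1) \<le> 1" using q0 by (simp add: power_le_one)
          thus ?thesis using q0 by (simp add: add_increasing2)
        next
          case False
          hence "q ^ (i - 1) \<le> q ^ J" using i by (intro power_increasing) auto
          thus ?thesis by simp
        qed
        hence "q ^ (i - 1) * (1 / Im s) \<le> (1 + q ^ J) * (1 / Im s)"
          using y by (intro mult_right_mono) auto
        also have "\<dots> \<le> 1 / Im s + q ^ J"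
          using mult_left_mono[OF y(2), of "q ^ J"] q0 by (simp add: algebra_simps)
        finally have "q ^ (i - 1) * (1 / Im s) \<le> Y" by (simp add: Y_def)
        moreover have "q ^ (i - 1) * q ^ k \<le> Y" using Y0 k by (simp add: power_add[symmetric])
        ultimately show "q ^ (i - 1) * (1 / Im s + q ^ k) \<le> 2 * Y" by (simp add: distrib_left)
      qed (use c Ck A0 in auto)
      also have "\<dots> = norm (1 - s) * (D i * A * Y)" by (simp add: D_def k_def)
      finally show ?thesis .
    qed
    have "norm (1 - s) * norm (zeta_tail X s) = norm (- (of_nat (Suc X) powr (1 - s)) - E s -
         (\<Sum>i=2..J. falling_prod s i / fact i * zeta_tail X (s + of_nat (i - 1))))"
      using E(2)[of s] s s1 by (simp add: norm_mult[symmetric])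
    also have "\<dots> \<le> norm (of_nat (Suc X) powr (1 - s) :: complex) + norm (E s) +
         norm (\<Sum>i=2..J. falling_prod s i / fact i * zeta_tail X (s + of_nat (i - 1)))"
      using norm_triangle_ineq4[of "- (of_nat (Suc X) powr (1 - s)) - E s" "\<Sum>i=2..J. falling_prod s i / fact i * zeta_tail X (s + of_nat (i - 1))"]
        norm_triangle_ineq4[of "- (of_nat (Suc X) powr (1 - s))" "E s"] by simp
    also have "norm (\<Sum>i=2..J. falling_prod s i / fact i * zeta_tail X (s + of_nat (i - 1))) \<le>
        (\<Sum>i=2..J. norm (1 - s) * (D i * A * Y))"
      by (intro sum_norm_le t3)
    also have "(\<Sum>i=2..J. norm (1 - s) * (D i * A * Y)) = norm (1 - s) * ((\<Sum>i=2..J. D i) * A * Y)"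
      by (simp add: sum_distrib_left sum_distrib_right)
    also note t1
    also note t2
    finally have "norm (1 - s) * norm (zeta_tail X s) \<le> norm (1 - s) * (K * A * Y)"
      by (simp add: K_def algebra_simps)
    hence "norm (zeta_tail X s) \<le> K * A * Y" using n1' by (rule mult_left_le_imp_le)
    thus ?thesis by (simp add: A_def Y_def q_def)
  qed
  moreover have "K \<ge> 0" unfolding K_def using c D0 by (intro add_nonneg_nonneg sum_nonneg) auto
  ultimately show ?case by blast
qed

text \<open>For \<open>X\<close> of size \<open>T powr (1 + \<delta>)\<close> the quotient
  \<open>norm s / X\<close> is at most \<open>5 * T powr (- \<delta>)\<close>. With
  \<open>J \<ge> 1 / \<delta>\<close> its \<open>J\<close>-th power is of the same order as the
  other error \<open>1 / Im s\<close>, so a length only slightly above \<open>T\<close>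
  suffices.\<close>

lemma zeta_dirichlet_approx:
  fixes \<alpha> \<delta> :: real
  assumes "1/2 < \<alpha>" "\<alpha> < 1" "0 < \<delta>"
  obtains C where "C \<ge> 0" "\<And>T s. 1 \<le> T \<Longrightarrow> \<alpha> \<le> Re s \<Longrightarrow> Re s \<le> 2 \<Longrightarrow> T \<le> Im s \<Longrightarrow> Im s \<le> 3 * T \<Longrightarrow>
     norm (zeta_tail (nat \<lceil>T powr (1 + \<delta>)\<rceil>) s) \<le> C * T powr ((1 + \<delta>) * (1 - \<alpha>) - 1)"
proof -
  define J where "J = nat \<lceil>1 / \<delta>\<rceil>"
  have Jd: "\<delta> * J \<ge> 1" using assms by (auto simp: J_def field_simps) (metis le_of_int_ceiling mult.commute pos_divide_le_eq)
  have J: "1 \<le> J" using Jd by (cases J) auto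
  obtain C where C: "C \<ge> 0" "\<And>s X. 1/2 \<le> Re s \<Longrightarrow> 1 \<le> Im s \<Longrightarrow> 1 \<le> X \<Longrightarrow>
     norm (zeta_tail X s) \<le> C * real X powr (1 - Re s) * (1 / Im s + (norm s / real X) ^ J)"
    using zeta_tail_bound[OF J] by blast
  show ?thesis
  proof (rule that[of "C * 2 * (1 + 5 ^ J)"])
    show "C * 2 * (1 + 5 ^ J) \<ge> 0" using C by simp
    fix T :: real and s :: complex
    assume T: "1 \<le> T" and s: "\<alpha> \<le> Re s" "Re s \<le> 2" "T \<le> Im s" "Im s \<le> 3 * T"
    define X where "X = nat \<lceil>T powr (1 + \<delta>)\<rceil>"
    have T1: "1 \<le> T powr (1 + \<delta>)" using T assms by (intro ge_one_powr_ge_zero) auto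
    have XT: "T powr (1 + \<delta>) \<le> real X" "real X \<le> 2 * T powr (1 + \<delta>)" "1 \<le> X"
      using T1 by (auto simp: X_def intro: real_nat_ceiling_ge) linarith+
    have ns: "norm s \<le> 5 * T"
      using cmod_le[of s] s T assms by auto
    have a: "real X powr (1 - Re s) \<le> 2 * T powr ((1 + \<delta>) * (1 - \<alpha>))"
    proof -
      have "real X powr (1 - Re s) \<le> real X powr (1 - \<alpha>)" using XT s by (intro powr_mono) auto
      also have "\<dots> \<le> (2 * T powr (1 + \<delta>)) powr (1 - \<alpha>)" using XT assms by (intro powr_mono2) auto
      also have "\<dots> = 2 powr (1 - \<alpha>) * T powr ((1 + \<delta>) * (1 - \<alpha>))" by (simp add: powr_mult powr_powr)
      also have "\<dots> \<le> 2 powr 1 * T powr ((1 + \<delta>) * (1 - \<alpha>))"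
        using assms by (intro mult_right_mono powr_mono) auto
      finally show ?thesis by simp
    qed
    have "norm s / real X \<le> 5 * T / T powr (1 + \<delta>)"
      using ns XT T1 T by (intro frac_le) auto
    also have "\<dots> = 5 * T powr (- \<delta>)" using T by (simp add: powr_add powr_minus field_simps)
    finally have "(norm s / real X) ^ J \<le> (5 * T powr (- \<delta>)) ^ J" by (intro power_mono) auto
    also have "\<dots> = 5 ^ J * T powr (- (\<delta> * J))"
      using T by (simp add: power_mult_distrib powr_powr powr_realpow[symmetric])
    also have "\<dots> \<le> 5 ^ J * T powr (- 1)"
      using T Jd by (intro mult_left_mono powr_mono) auto
    finally have "(norm s / real X) ^ J \<le> 5 ^ J * T powr (- 1)" .
    moreover have "1 / Im s \<le> T powr (- 1)"
      using s T by (simp add: powr_minus_divide frac_le)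
    ultimately have b: "1 / Im s + (norm s / real X) ^ J \<le> (1 + 5 ^ J) * T powr (- 1)"
      unfolding distrib_right mult_1_left by (rule add_mono[rotated])
    have "norm (zeta_tail X s) \<le> C * real X powr (1 - Re s) * (1 / Im s + (norm s / real X) ^ J)"
      using s T XT assms by (intro C(2)) auto
    also have "\<dots> \<le> C * (2 * T powr ((1 + \<delta>) * (1 - \<alpha>))) * ((1 + 5 ^ J) * T powr (- 1))"
      using a b C s T by (intro mult_mono mult_left_mono) auto
    also have "\<dots> = C * 2 * (1 + 5 ^ J) * T powr ((1 + \<delta>) * (1 - \<alpha>) - 1)"
      unfolding diff_conv_add_uminus powr_add by (simp only: mult_ac)
    finally show "norm (zeta_tail (nat \<lceil>T powr (1 + \<delta>)\<rceil>) s) \<le> C * 2 * (1 + 5 ^ J) * T powr ((1 + \<delta>) * (1 - \<alpha>) - 1)"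
      by (simp add: X_def)
  qed
qed

section \<open>Mean squares of Dirichlet polynomials\<close>

lemma integral_cis_bound:
  fixes \<mu> :: real
  assumes "lo \<le> hi" "\<mu> \<noteq> 0"
  obtains I where "((\<lambda>y. cis (y * \<mu>)) has_integral I) {lo..hi}" "norm I \<le> 2 / \<bar>\<mu>\<bar>"
proof
  let ?F = "\<lambda>y. cis (y * \<mu>) / (\<i> * of_real \<mu>)"
  show "((\<lambda>y. cis (y * \<mu>)) has_integral (?F hi - ?F lo)) {lo..hi}"
  proof (rule fundamental_theorem_of_calculus[OF assms(1)])
    fix x assume "x \<in> {lo..hi}"
    show "(?F has_vector_derivative cis (x * \<mu>)) (at x within {lo..hi})"
    proof -
      have "((\<lambda>z. exp (\<i> * (z * of_real \<mu>))) has_field_derivative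
          exp (\<i> * (of_real x * of_real \<mu>)) * (\<i> * of_real \<mu>)) (at (of_real x))"
        by (auto intro!: derivative_eq_intros)
      from DERIV_cdivide[OF this, of "\<i> * of_real \<mu>"]
      have "((\<lambda>z. exp (\<i> * (z * of_real \<mu>)) / (\<i> * of_real \<mu>)) has_field_derivative
          exp (\<i> * (of_real x * of_real \<mu>))) (at (of_real x))"
        using assms by simp
      from has_vector_derivative_real_field[OF this] show ?thesis
        by (simp add: cis_conv_exp)
    qed
  qed
  have "norm (?F hi - ?F lo) \<le> norm (?F hi) + norm (?F lo)" by (rule norm_triangle_ineq4)
  also have "\<dots> = 2 / \<bar>\<mu>\<bar>" by (simp add: norm_divide norm_mult)
  finally show "norm (?F hi - ?F lo) \<le> 2 / \<bar>\<mu>\<bar>" .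
qed

text \<open>After expanding the square the diagonal contributes the length of the interval, and each
  pair of distinct frequencies oscillates and has a bounded integral. The pairs are estimated one by
  one; no Hilbert inequality enters.\<close>

lemma mean_value_exponential_sum:
  fixes a :: "'i \<Rightarrow> complex" and l :: "'i \<Rightarrow> real"
  assumes A: "finite A" "inj_on l A" and "lo \<le> hi"
  shows "\<bar>integral {lo..hi} (\<lambda>y. (norm (\<Sum>n\<in>A. a n * cis (y * l n)))\<^sup>2) - (hi - lo) * (\<Sum>n\<in>A. (norm (a n))\<^sup>2)\<bar>
     \<le> (\<Sum>m\<in>A. \<Sum>n\<in>A - {m}. 2 * norm (a m) * norm (a n) / \<bar>l m - l n\<bar>)"
proof -
  have "\<exists>I. ((\<lambda>y. cis (y * (l m - l n))) has_integral I) {lo..hi} \<and>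
      (if m = n then I = of_real (hi - lo) else norm I \<le> 2 / \<bar>l m - l n\<bar>)"
    if "m \<in> A" "n \<in> A" for m n
  proof (cases "m = n")
    case True
    have "((\<lambda>y. 1::complex) has_integral of_real (hi - lo)) {lo..hi}"
      using has_integral_const_real[of "1::complex" lo hi] assms(3) by (simp add: scaleR_conv_of_real)
    thus ?thesis using True by auto
  next
    case False
    hence "l m - l n \<noteq> 0" using A that by (auto simp: inj_on_def)
    from integral_cis_bound[OF assms(3) this] show ?thesis using False by metis
  qed
  then obtain I where I: "\<And>m n. m \<in> A \<Longrightarrow> n \<in> A \<Longrightarrow> ((\<lambda>y. cis (y * (l m - l n))) has_integral I m n) {lo..hi}"
    "\<And>m. m \<in> A \<Longrightarrow> I m m = of_real (hi - lo)"
    "\<And>m n. m \<in> A \<Longrightarrow> n \<in> A \<Longrightarrow> m \<noteq> n \<Longrightarrow> norm (I m n) \<le> 2 / \<bar>l m - l n\<bar>"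
    by metis
  let ?S = "\<lambda>y. \<Sum>n\<in>A. a n * cis (y * l n)"
  have S: "complex_of_real ((norm (?S y))\<^sup>2) = (\<Sum>m\<in>A. \<Sum>n\<in>A. (a m * cnj (a n)) * cis (y * (l m - l n)))" for y
  proof -
    have "complex_of_real ((norm (?S y))\<^sup>2) = ?S y * cnj (?S y)"
      by (simp only: complex_norm_square)
    also have "\<dots> = (\<Sum>m\<in>A. \<Sum>n\<in>A. (a m * cis (y * l m)) * cnj (a n * cis (y * l n)))"
      unfolding cnj_sum sum_product ..
    also have "\<dots> = (\<Sum>m\<in>A. \<Sum>n\<in>A. (a m * cnj (a n)) * cis (y * (l m - l n)))"
      by (intro sum.cong refl) (simp add: cis_cnj cis_mult right_diff_distrib mult_ac)
    finally show ?thesis .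
  qed
  have "((\<lambda>y. complex_of_real ((norm (?S y))\<^sup>2)) has_integral (\<Sum>m\<in>A. \<Sum>n\<in>A. (a m * cnj (a n)) * I m n)) {lo..hi}"
    unfolding S by (intro has_integral_sum has_integral_mult_right I A)
  moreover have int: "(\<lambda>y. (norm (?S y))\<^sup>2) integrable_on {lo..hi}"
    by (intro integrable_continuous_real continuous_intros)
  have "((\<lambda>y. complex_of_real ((norm (?S y))\<^sup>2)) has_integral of_real (integral {lo..hi} (\<lambda>y. (norm (?S y))\<^sup>2))) {lo..hi}"
    by (rule has_integral_of_real[OF integrable_integral[OF int], unfolded o_def])
  ultimately have eq: "complex_of_real (integral {lo..hi} (\<lambda>y. (norm (?S y))\<^sup>2)) = (\<Sum>m\<in>A. \<Sum>n\<in>A. (a m * cnj (a n)) * I m n)"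
    by (rule has_integral_unique[rotated])
  have "complex_of_real (integral {lo..hi} (\<lambda>y. (norm (?S y))\<^sup>2) - (hi - lo) * (\<Sum>n\<in>A. (norm (a n))\<^sup>2)) =
      (\<Sum>m\<in>A. (\<Sum>n\<in>A. (a m * cnj (a n)) * I m n) - of_real (hi - lo) * (of_real (norm (a m)))\<^sup>2)"
    by (simp add: eq sum_subtractf sum_distrib_left)
  also have "\<dots> = (\<Sum>m\<in>A. (\<Sum>n\<in>A - {m}. (a m * cnj (a n)) * I m n))"
  proof (intro sum.cong refl)
    fix m assume m: "m \<in> A"
    have "(\<Sum>n\<in>A. (a m * cnj (a n)) * I m n) = a m * cnj (a m) * of_real (hi - lo) + (\<Sum>n\<in>A - {m}. (a m * cnj (a n)) * I m n)"
      by (simp add: sum.remove[OF A(1) m] I(2)[OF m])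
    moreover have "a m * cnj (a m) = (of_real (norm (a m)))\<^sup>2" by (simp add: complex_norm_square[symmetric])
    ultimately show "(\<Sum>n\<in>A. (a m * cnj (a n)) * I m n) - of_real (hi - lo) * (of_real (norm (a m)))\<^sup>2 =
      (\<Sum>n\<in>A - {m}. (a m * cnj (a n)) * I m n)" by (simp only: mult.commute add_diff_cancel_left')
  qed
  also have "norm \<dots> \<le> (\<Sum>m\<in>A. \<Sum>n\<in>A - {m}. 2 * norm (a m) * norm (a n) / \<bar>l m - l n\<bar>)"
  proof (intro sum_norm_le)
    fix m n assume "m \<in> A" "n \<in> A - {m}"
    hence "norm (I m n) \<le> 2 / \<bar>l m - l n\<bar>" using I(3) by auto
    from mult_left_mono[OF this, of "norm (a m) * norm (a n)"]
    show "norm (a m * cnj (a n) * I m n) \<le> 2 * norm (a m) * norm (a n) / \<bar>l m - l n\<bar>"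
      by (simp add: norm_mult mult_ac)
  qed
  finally show ?thesis by (simp only: norm_of_real)
qed

text \<open>Splitting off the convergent \<open>m powr (- 1 - \<kappa>)\<close> treats the
  logarithmic case \<open>\<beta> = 1\<close> together with the others, at the price of
  \<open>X powr \<kappa>\<close>.\<close>

lemma sum_powr_le:
  fixes \<beta> \<kappa> :: real
  assumes "0 < \<kappa>" "\<beta> \<le> 1 + \<kappa>"
  obtains C where "C \<ge> 0" "\<And>X. (\<Sum>m=1..X. real m powr (- \<beta>)) \<le> C * real X powr (1 - \<beta> + \<kappa>)"
proof
  let ?f = "\<lambda>m. real m powr (- 1 - \<kappa>)"
  have s: "summable ?f" using assms by (simp add: summable_real_powr_iff)
  show "suminf ?f \<ge> 0" by (intro suminf_nonneg s) auto
  fix X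
  have "(\<Sum>m=1..X. real m powr (- \<beta>)) \<le> (\<Sum>m=1..X. ?f m * real X powr (1 - \<beta> + \<kappa>))"
  proof (intro sum_mono)
    fix m assume m: "m \<in> {1..X}"
    have "real m powr (- \<beta>) = ?f m * real m powr (1 - \<beta> + \<kappa>)"
      by (simp add: powr_add[symmetric])
    also have "\<dots> \<le> ?f m * real X powr (1 - \<beta> + \<kappa>)"
      using m assms by (intro mult_left_mono powr_mono2) auto
    finally show "real m powr (- \<beta>) \<le> ?f m * real X powr (1 - \<beta> + \<kappa>)" .
  qed
  also have "\<dots> = (\<Sum>m=1..X. ?f m) * real X powr (1 - \<beta> + \<kappa>)" by (simp add: sum_distrib_right)
  also have "\<dots> \<le> suminf ?f * real X powr (1 - \<beta> + \<kappa>)"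
    by (intro mult_right_mono sum_le_suminf s) auto
  finally show "(\<Sum>m=1..X. real m powr (- \<beta>)) \<le> suminf ?f * real X powr (1 - \<beta> + \<kappa>)" .
qed

text \<open>With truncated subtraction \<open>(m - n) + (n - m)\<close> is the distance of
  \<open>m\<close> and \<open>n\<close>, and a given distance from \<open>m\<close> occurs at most
  twice.\<close>

lemma sum_diff_le:
  fixes g :: "nat \<Rightarrow> real"
  assumes "m \<in> {1..X}" "\<And>h. 0 \<le> g h"
  shows "(\<Sum>n\<in>{1..X} - {m}. g ((m - n) + (n - m))) \<le> 2 * (\<Sum>h=1..X. g h)"
proof -
  have eq: "{1..X} - {m} = {1..<m} \<union> {m<..X}" using assms by auto
  have "(\<Sum>n\<in>{1..X} - {m}. g ((m - n) + (n - m))) =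
      (\<Sum>n\<in>{1..<m}. g ((m - n) + (n - m))) + (\<Sum>n\<in>{m<..X}. g ((m - n) + (n - m)))"
    unfolding eq by (rule sum.union_disjoint) auto
  also have "(\<Sum>n\<in>{1..<m}. g ((m - n) + (n - m))) = (\<Sum>h\<in>(\<lambda>n. m - n) ` {1..<m}. g h)"
    by (subst sum.reindex) (auto simp: inj_on_def)
  also have "\<dots> \<le> (\<Sum>h=1..X. g h)"
    using assms by (intro sum_mono2) auto
  also have "(\<Sum>n\<in>{m<..X}. g ((m - n) + (n - m))) = (\<Sum>h\<in>(\<lambda>n. n - m) ` {m<..X}. g h)"
    by (subst sum.reindex) (auto simp: inj_on_def)
  also have "\<dots> \<le> (\<Sum>h=1..X. g h)"
    using assms by (intro sum_mono2) auto
  finally show ?thesis by simp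
qed

text \<open>After division by \<open>(x + y) powr c\<close> this is \<open>t \<le> t powr c\<close>
  for \<open>0 < t \<le> 1\<close>, applied to the two shares of \<open>x + y\<close>.\<close>

lemma powr_add_le:
  fixes x y c :: real
  assumes "0 < x" "0 < y" "0 \<le> c" "c \<le> 1"
  shows "(x + y) powr c \<le> x powr c + y powr c"
proof -
  have *: "t \<le> t powr c" if "0 < t" "t \<le> 1" for t :: real
    using powr_mono'[of c 1 t] that assms by simp
  have "1 = x / (x + y) + y / (x + y)" using assms by (simp add: add_divide_distrib[symmetric])
  also have "\<dots> \<le> (x / (x + y)) powr c + (y / (x + y)) powr c"
    using assms by (intro add_mono *) auto
  also have "\<dots> = (x powr c + y powr c) / (x + y) powr c"
    using assms by (simp add: powr_divide add_divide_distrib)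
  finally show ?thesis using assms by (simp add: field_simps)
qed

text \<open>For \<open>n = m + h\<close> one has \<open>log (n / m) \<ge> h / n\<close>, and \<open>n\<^sup>1\<^sup>-\<^sup>\<alpha> \<le> m\<^sup>1\<^sup>-\<^sup>\<alpha> + h\<^sup>1\<^sup>-\<^sup>\<alpha>\<close> separates the variables \<open>m\<close> and \<open>h\<close>.\<close>

lemma offdiagonal_bound:
  fixes \<alpha> \<kappa> :: real
  assumes "1/2 < \<alpha>" "\<alpha> < 1" "0 < \<kappa>"
  obtains C where "C \<ge> 0" "\<And>X. (\<Sum>m=1..X. \<Sum>n\<in>{1..X} - {m}. real m powr (- \<alpha>) * real n powr (- \<alpha>) / \<bar>ln (real m) - ln (real n)\<bar>)
      \<le> C * real X powr (2 - 2 * \<alpha> + 2 * \<kappa>)"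
proof -
  define G where "G = (\<lambda>m h. real m powr (- (2 * \<alpha> - 1)) * real h powr (- 1) + real m powr (- \<alpha>) * real h powr (- \<alpha>))"
  have G0: "G m h \<ge> 0" for m h by (simp add: G_def)
  have key: "real m powr (- \<alpha>) * real n powr (- \<alpha>) / (ln (real n) - ln (real m)) \<le> G m (n - m)"
    if "1 \<le> m" "m < n" for m n
  proof -
    define h where "h = n - m"
    have n: "real n = real m + real h" and h: "0 < real h" and m: "0 < real m" using that by (auto simp: h_def)
    have "real h / real n = 1 - inverse (real n / real m)" using n h m by (simp add: field_simps)
    also have "\<dots> \<le> ln (real n / real m)"
      using ln_le_minus_one[of "inverse (real n / real m)"] m n h by (simp add: ln_inverse ln_div)
    also have "\<dots> = ln (real n) - ln (real m)" using m n h by (simp add: ln_div)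
    finally have l: "real h / real n \<le> ln (real n) - ln (real m)" .
    have "real m powr (- \<alpha>) * real n powr (- \<alpha>) / (ln (real n) - ln (real m)) \<le>
          real m powr (- \<alpha>) * real n powr (- \<alpha>) / (real h / real n)"
    proof (rule divide_left_mono[OF l])
      have "0 < real h / real n" using h n by simp
      thus "0 < (ln (real n) - ln (real m)) * (real h / real n)" using l by (intro mult_pos_pos) auto
    qed auto
    also have "\<dots> = real m powr (- \<alpha>) * (real n powr (1 - \<alpha>) / real h)"
      using n h m by (simp add: powr_diff powr_minus field_simps)
    also have "\<dots> \<le> real m powr (- \<alpha>) * ((real m powr (1 - \<alpha>) + real h powr (1 - \<alpha>)) / real h)"
      unfolding n using h m assms by (intro mult_left_mono divide_right_mono powr_add_le) auto
    also have "\<dots> = G m h"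
    proof -
      have "real m powr (- \<alpha>) * real m powr (1 - \<alpha>) = real m powr (1 - 2 * \<alpha>)" by (simp add: powr_add[symmetric])
      moreover have "real h powr (1 - \<alpha>) / real h = real h powr (- \<alpha>)"
        using h by (simp add: powr_diff powr_minus field_simps)
      moreover have "real m powr (- \<alpha>) * ((real m powr (1 - \<alpha>) + real h powr (1 - \<alpha>)) / real h) =
          (real m powr (- \<alpha>) * real m powr (1 - \<alpha>)) / real h + real m powr (- \<alpha>) * (real h powr (1 - \<alpha>) / real h)"
        by (simp add: add_divide_distrib distrib_left)
      ultimately show ?thesis using h by (simp add: G_def powr_minus divide_inverse)
    qed
    finally show ?thesis by (simp add: h_def)
  qed
  \<comment> \<open>Adding the nonnegative term of the opposite order makes the bound symmetric, so
    the double sum needs no separation into \<open>m < n\<close> and \<open>n < m\<close>.\<close>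
  have key2: "real m powr (- \<alpha>) * real n powr (- \<alpha>) / \<bar>ln (real m) - ln (real n)\<bar>
      \<le> G m ((m - n) + (n - m)) + G n ((n - m) + (m - n))" if "m \<in> {1..X}" "n \<in> {1..X} - {m}" for m n X
  proof (cases "m < n")
    case True
    hence "ln (real m) < ln (real n)" using that by auto
    thus ?thesis using key[of m n] that True G0[of n "n - m"] by simp
  next
    case False
    hence "n < m" using that by auto
    moreover from this have "ln (real n) < ln (real m)" using that by auto
    ultimately show ?thesis using key[of n m] that G0[of m "m - n"] by (simp add: mult.commute)
  qed
  obtain C1 where C1: "C1 \<ge> 0" "\<And>X. (\<Sum>m=1..X. real m powr (- (2 * \<alpha> - 1))) \<le> C1 * real X powr (1 - (2 * \<alpha> - 1) + \<kappa>)"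
    using sum_powr_le[of \<kappa> "2 * \<alpha> - 1"] assms by auto
  obtain C2 where C2: "C2 \<ge> 0" "\<And>X. (\<Sum>m=1..X. real m powr (- 1)) \<le> C2 * real X powr (1 - 1 + \<kappa>)"
    using sum_powr_le[of \<kappa> 1] assms by auto
  obtain C3 where C3: "C3 \<ge> 0" "\<And>X. (\<Sum>m=1..X. real m powr (- \<alpha>)) \<le> C3 * real X powr (1 - \<alpha> + \<kappa>)"
    using sum_powr_le[of \<kappa> \<alpha>] assms by auto
  show ?thesis
  proof (rule that)
    show "4 * (C1 * C2 + C3 * C3) \<ge> 0" using C1 C2 C3 by auto
    fix X
    have "(\<Sum>m=1..X. \<Sum>n\<in>{1..X} - {m}. real m powr (- \<alpha>) * real n powr (- \<alpha>) / \<bar>ln (real m) - ln (real n)\<bar>)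
      \<le> (\<Sum>m=1..X. \<Sum>n\<in>{1..X} - {m}. G m ((m - n) + (n - m)) + G n ((n - m) + (m - n)))"
      by (intro sum_mono key2)
    also have "\<dots> = (\<Sum>m=1..X. \<Sum>n\<in>{1..X} - {m}. G m ((m - n) + (n - m))) + (\<Sum>m=1..X. \<Sum>n\<in>{1..X} - {m}. G n ((n - m) + (m - n)))"
      by (simp add: sum.distrib)
    also have "(\<Sum>m=1..X. \<Sum>n\<in>{1..X} - {m}. G n ((n - m) + (m - n))) = (\<Sum>n=1..X. \<Sum>m\<in>{1..X} - {n}. G n ((n - m) + (m - n)))"
    proof -
      have *: "{1..X} - {m} = {n \<in> {1..X}. n \<noteq> m}" for m by auto
      show ?thesis unfolding * by (subst sum.swap_restrict) (auto intro!: sum.cong)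
    qed
    also have "(\<Sum>m=1..X. \<Sum>n\<in>{1..X} - {m}. G m ((m - n) + (n - m))) + \<dots> = 2 * (\<Sum>m=1..X. \<Sum>n\<in>{1..X} - {m}. G m ((m - n) + (n - m)))"
      by simp
    also have "\<dots> \<le> 2 * (\<Sum>m=1..X. 2 * (\<Sum>h=1..X. G m h))"
      by (intro mult_left_mono sum_mono sum_diff_le G0) auto
    also have "\<dots> = 4 * ((\<Sum>m=1..X. real m powr (- (2 * \<alpha> - 1))) * (\<Sum>h=1..X. real h powr (- 1)) +
        (\<Sum>m=1..X. real m powr (- \<alpha>)) * (\<Sum>h=1..X. real h powr (- \<alpha>)))"
      by (simp only: G_def sum.distrib sum_product sum_distrib_left[symmetric])
    also have "\<dots> \<le> 4 * ((C1 * real X powr (1 - (2 * \<alpha> - 1) + \<kappa>)) * (C2 * real X powr (1 - 1 + \<kappa>)) +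
        (C3 * real X powr (1 - \<alpha> + \<kappa>)) * (C3 * real X powr (1 - \<alpha> + \<kappa>)))"
      using C1 C2 C3 by (intro mult_left_mono add_mono mult_mono sum_nonneg mult_nonneg_nonneg) auto
    also have "\<dots> = 4 * (C1 * C2 + C3 * C3) * real X powr (2 - 2 * \<alpha> + 2 * \<kappa>)"
    proof -
      have "real X powr (1 - (2 * \<alpha> - 1) + \<kappa>) * real X powr (1 - 1 + \<kappa>) = real X powr (2 - 2 * \<alpha> + 2 * \<kappa>)"
        "real X powr (1 - \<alpha> + \<kappa>) * real X powr (1 - \<alpha> + \<kappa>) = real X powr (2 - 2 * \<alpha> + 2 * \<kappa>)"
        by (simp_all only: powr_add[symmetric]) (simp_all add: algebra_simps)
      moreover have "4 * ((a * p) * (b * q) + (c * r) * (c * r)) = 4 * (a * b + c * c) * Q"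
        if "p * q = Q" "r * r = Q" for a b c p q r Q :: real
      proof -
        have "(a * p) * (b * q) = a * b * (p * q)" "(c * r) * (c * r) = c * c * (r * r)" by (simp_all only: mult_ac)
        thus ?thesis by (simp only: that distrib_right mult.assoc)
      qed
      ultimately show ?thesis by (simp only:)
    qed
    finally show "(\<Sum>m=1..X. \<Sum>n\<in>{1..X} - {m}. real m powr (- \<alpha>) * real n powr (- \<alpha>) / \<bar>ln (real m) - ln (real n)\<bar>)
      \<le> 4 * (C1 * C2 + C3 * C3) * real X powr (2 - 2 * \<alpha> + 2 * \<kappa>)" .
  qed
qed

text \<open>Only the majorant \<open>K * n powr (- \<alpha>)\<close> enters off the diagonal, with a
  constant common to all lengths, intervals and coefficients. The diagonal keeps the true
  coefficients, since in the application these vanish up to \<open>N\<close>.\<close>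

lemma mean_square_dirichlet_polynomial:
  fixes \<alpha> \<kappa> :: real
  assumes "1/2 < \<alpha>" "\<alpha> < 1" "0 < \<kappa>"
  obtains C where "C \<ge> 0" "\<And>X (a :: nat \<Rightarrow> complex) K lo hi. lo \<le> hi \<Longrightarrow> 0 \<le> K \<Longrightarrow>
      (\<forall>n\<in>{1..X}. norm (a n) \<le> K * real n powr (- \<alpha>)) \<Longrightarrow>
      integral {lo..hi} (\<lambda>y. (norm (\<Sum>n=1..X. a n * cis (y * - ln (real n))))\<^sup>2)
      \<le> (hi - lo) * (\<Sum>n=1..X. (norm (a n))\<^sup>2) + C * K\<^sup>2 * real X powr (2 - 2 * \<alpha> + 2 * \<kappa>)"
proof -
  obtain C where C: "C \<ge> 0" "\<And>X. (\<Sum>m=1..X. \<Sum>n\<in>{1..X} - {m}. real m powr (- \<alpha>) * real n powr (- \<alpha>) / \<bar>ln (real m) - ln (real n)\<bar>)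
      \<le> C * real X powr (2 - 2 * \<alpha> + 2 * \<kappa>)"
    using offdiagonal_bound[OF assms] by blast
  show ?thesis
  proof (rule that)
    show "2 * C \<ge> 0" using C by simp
    fix X and a :: "nat \<Rightarrow> complex" and K lo hi :: real
    assume lh: "lo \<le> hi" and K: "0 \<le> K" and a: "\<forall>n\<in>{1..X}. norm (a n) \<le> K * real n powr (- \<alpha>)"
    have inj: "inj_on (\<lambda>n. - ln (real n)) {1..X}" by (auto simp: inj_on_def)
    have "integral {lo..hi} (\<lambda>y. (norm (\<Sum>n=1..X. a n * cis (y * - ln (real n))))\<^sup>2) - (hi - lo) * (\<Sum>n=1..X. (norm (a n))\<^sup>2)
      \<le> (\<Sum>m=1..X. \<Sum>n\<in>{1..X} - {m}. 2 * norm (a m) * norm (a n) / \<bar>- ln (real m) - - ln (real n)\<bar>)"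
      using mean_value_exponential_sum[OF _ inj lh, of a] by (simp only: abs_le_iff finite_atLeastAtMost)
    also have "\<dots> \<le> (\<Sum>m=1..X. \<Sum>n\<in>{1..X} - {m}. 2 * K\<^sup>2 * (real m powr (- \<alpha>) * real n powr (- \<alpha>) / \<bar>ln (real m) - ln (real n)\<bar>))"
    proof (intro sum_mono)
      fix m n assume mn: "m \<in> {1..X}" "n \<in> {1..X} - {m}"
      have "norm (a m) * norm (a n) \<le> (K * real m powr (- \<alpha>)) * (K * real n powr (- \<alpha>))"
        using mn K a by (intro mult_mono) auto
      from divide_right_mono[OF mult_left_mono[OF this, of 2], of "\<bar>ln (real m) - ln (real n)\<bar>"]
      show "2 * norm (a m) * norm (a n) / \<bar>- ln (real m) - - ln (real n)\<bar> \<le>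
          2 * K\<^sup>2 * (real m powr (- \<alpha>) * real n powr (- \<alpha>) / \<bar>ln (real m) - ln (real n)\<bar>)"
        by (simp add: power2_eq_square mult_ac abs_minus_commute)
    qed
    also have "\<dots> = 2 * K\<^sup>2 * (\<Sum>m=1..X. \<Sum>n\<in>{1..X} - {m}. (real m powr (- \<alpha>) * real n powr (- \<alpha>) / \<bar>ln (real m) - ln (real n)\<bar>))"
      by (simp only: sum_distrib_left)
    also have "\<dots> \<le> 2 * K\<^sup>2 * (C * real X powr (2 - 2 * \<alpha> + 2 * \<kappa>))"
      by (intro mult_left_mono C) auto
    finally show "integral {lo..hi} (\<lambda>y. (norm (\<Sum>n=1..X. a n * cis (y * - ln (real n))))\<^sup>2)
      \<le> (hi - lo) * (\<Sum>n=1..X. (norm (a n))\<^sup>2) + 2 * C * K\<^sup>2 * real X powr (2 - 2 * \<alpha> + 2 * \<kappa>)"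
      by (simp only: mult_ac)
  qed
qed

section \<open>Removing small primes from the zeta function\<close>

lemma sum_tail_powr_le:
  fixes b :: real
  assumes "1 < b" "1 \<le> N"
  shows "(\<Sum>m\<in>{N<..M}. real m powr (- b)) \<le> real N powr (1 - b) / (b - 1)"
proof -
  have "(\<Sum>m\<in>{N<..M}. real m powr (- b)) = (\<Sum>n<M-N. real (n + N + 1) powr (- b))"
    by (rule sum.reindex_bij_witness[of _ "\<lambda>n. n + N + 1" "\<lambda>m. m - N - 1"]) auto
  also have "\<dots> \<le> (\<Sum>n. real (n + N + 1) powr (- b))"
    by (rule sum_le_suminf[OF powr_tail_bound(1)[OF assms]]) auto
  also have "\<dots> \<le> real N powr (1 - b) / (b - 1)" by (rule powr_tail_bound(2)[OF assms])
  finally show ?thesis .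
qed

section \<open>Sieved coefficients of Dirichlet series\<close>

lemma nat_powr_mult:
  "of_nat (m * n) powr s = of_nat m powr s * (of_nat n powr s :: complex)"
proof (cases "m = 0 \<or> n = 0")
  case False
  have "Ln (of_nat (m * n) :: complex) = of_real (ln (real (m * n)))" using False by (intro Ln_of_nat) simp
  also have "\<dots> = of_real (ln (real m)) + of_real (ln (real n))" using False by (simp add: ln_mult)
  finally have "Ln (of_nat (m * n) :: complex) = of_real (ln (real m)) + of_real (ln (real n))" .
  thus ?thesis using False by (simp add: powr_def distrib_left exp_add del: of_nat_mult)
qed auto

lemma norm_nat_powr: "0 < n \<Longrightarrow> norm (of_nat n powr s :: complex) = real n powr Re s"
  by (simp add: norm_powr_real_powr)

text \<open>The coefficients of \<open>\<Prod>\<^sub>p\<^sub>\<le>\<^sub>N (1 - p\<^sup>-\<^sup>s) \<cdot> \<Sum> c(m) m\<^sup>-\<^sup>s\<close>.\<close>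

primrec sieve :: "(nat \<Rightarrow> complex) \<Rightarrow> nat \<Rightarrow> nat \<Rightarrow> complex" where
  "sieve c 0 = c"
| "sieve c (Suc N) = (\<lambda>m. sieve c N m - (if prime (Suc N) \<and> Suc N dvd m then sieve c N (m div Suc N) else 0))"

definition euler_prod :: "nat \<Rightarrow> complex \<Rightarrow> complex" where
  "euler_prod N s = (\<Prod>p\<in>{p. prime p \<and> p \<le> N}. 1 - of_nat p powr (- s))"

lemma finite_primes_le [simp]: "finite {p::nat. prime p \<and> p \<le> N}"
  by (rule finite_subset[of _ "{..N}"]) auto

lemma primes_le_Suc: "{p. prime p \<and> p \<le> Suc N} =
    (if prime (Suc N) then insert (Suc N) {p. prime p \<and> p \<le> N} else {p. prime p \<and> p \<le> N})"
  using le_Suc_eq by auto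

lemma euler_prod_Suc: "euler_prod (Suc N) s = (if prime (Suc N) then (1 - of_nat (Suc N) powr (- s)) * euler_prod N s else euler_prod N s)"
  by (simp add: euler_prod_def primes_le_Suc)

lemma euler_prod_0 [simp]: "euler_prod 0 s = 1"
proof -
  have "{p::nat. prime p \<and> p \<le> 0} = {}" using not_prime_0 by auto
  thus ?thesis by (simp add: euler_prod_def)
qed

text \<open>Multiplication by \<open>1 - p powr (- s)\<close> subtracts the series moved to the
  multiples of \<open>p\<close>. Unordered summation allows this reindexing along
  \<open>m \<mapsto> p * m\<close> without regard to order.\<close>

lemma sieve_has_sum:
  assumes "((\<lambda>m. c m * of_nat m powr (- s)) has_sum S) UNIV"
  shows "((\<lambda>m. sieve c N m * of_nat m powr (- s)) has_sum (euler_prod N s * S)) UNIV"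
proof (induction N)
  case 0
  show ?case using assms by simp
next
  case (Suc N)
  show ?case
  proof (cases "prime (Suc N)")
    case False
    thus ?thesis using Suc by (simp add: euler_prod_Suc del: of_nat_Suc)
  next
    case True
    define p where "p = Suc N"
    have p: "p > 0" by (simp add: p_def)
    define g where "g = (\<lambda>k. sieve c N (k div p) * (of_nat k powr (- s) :: complex))"
    have inj: "inj (\<lambda>m. p * m)" using p by (auto simp: inj_on_def)
    have "((\<lambda>m. of_nat p powr (- s) * (sieve c N m * of_nat m powr (- s))) has_sum (of_nat p powr (- s) * (euler_prod N s * S))) UNIV"
      by (rule has_sum_cmult_right[OF Suc])
    hence "((g \<circ> (\<lambda>m. p * m)) has_sum (of_nat p powr (- s) * (euler_prod N s * S))) UNIV"
      using p unfolding g_def o_def nat_powr_mult by (simp add: mult_ac)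
    hence "(g has_sum (of_nat p powr (- s) * (euler_prod N s * S))) (range (\<lambda>m. p * m))"
      using has_sum_reindex[OF inj] by blast
    hence "((\<lambda>m. (if p dvd m then sieve c N (m div p) else 0) * of_nat m powr (- s)) has_sum (of_nat p powr (- s) * (euler_prod N s * S))) UNIV"
      by (subst has_sum_cong_neutral[where T = "range (\<lambda>m. p * m)" and g = g]) (auto simp: g_def elim!: dvdE)
    note sum = has_sum_add[OF Suc has_sum_uminusI[OF this]]
    have "sieve c (Suc N) m * of_nat m powr (- s) = sieve c N m * of_nat m powr (- s) +
        - ((if p dvd m then sieve c N (m div p) else 0) * of_nat m powr (- s))" for m
      using True by (simp add: p_def left_diff_distrib)
    moreover have "euler_prod (Suc N) s * S = euler_prod N s * S + - (of_nat p powr (- s) * (euler_prod N s * S))"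
      unfolding euler_prod_Suc p_def using True by (simp add: left_diff_distrib del: of_nat_Suc)
    ultimately show ?thesis using sum by (simp only:)
  qed
qed

text \<open>The recursion inspects only \<open>m\<close> and smaller arguments; hence cutting off
  \<open>c\<close> beyond \<open>X\<close> leaves the sieved coefficients up to \<open>X\<close>
  unchanged.\<close>

lemma sieve_cong: "(\<And>k. k \<le> X \<Longrightarrow> c k = c' k) \<Longrightarrow> m \<le> X \<Longrightarrow> sieve c N m = sieve c' N m"
proof (induction N arbitrary: m)
  case (Suc N)
  have "m div Suc N \<le> X" using Suc.prems div_le_dividend order_trans by blast
  thus ?case using Suc by simp
qed auto

text \<open>Each step at most doubles the bound. This is crude but harmless, as \<open>N\<close>
  stays fixed while \<open>T\<close> tends to infinity.\<close>

lemma norm_sieve_le: "(\<And>k. norm (c k) \<le> 1) \<Longrightarrow> norm (sieve c N m) \<le> 2 ^ N"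
proof (induction N arbitrary: m)
  case (Suc N)
  have "norm (sieve c (Suc N) m) \<le> norm (sieve c N m) + norm (if prime (Suc N) \<and> Suc N dvd m then sieve c N (m div Suc N) else 0)"
    by (simp del: if_image_distrib add: norm_triangle_ineq4)
  also have "\<dots> \<le> 2 ^ N + 2 ^ N" using Suc by (intro add_mono) auto
  finally show ?case by simp
qed auto

text \<open>Each sieving step stretches the support by a factor of at most \<open>Suc N\<close>;
  \<open>fact N\<close> is a convenient majorant of the product of the primes up to
  \<open>N\<close>.\<close>

lemma sieve_eq_0: "(\<And>k. k > X \<Longrightarrow> c k = 0) \<Longrightarrow> m > X * fact N \<Longrightarrow> sieve c N m = 0"
proof (induction N arbitrary: m)
  case (Suc N)
  have "X * fact N \<le> X * fact (Suc N)" by (intro mult_le_mono2 fact_mono_nat) simp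
  hence 1: "X * fact N < m" using Suc.prems(2) by linarith
  have 2: "X * fact N < m div Suc N" if dvd: "Suc N dvd m"
  proof -
    from dvd obtain k where k: "m = Suc N * k" by (elim dvdE)
    have "Suc N * (X * fact N) < Suc N * k" using Suc.prems(2) unfolding k by (simp add: algebra_simps)
    hence "X * fact N < k" by (simp only: mult_less_cancel1)
    thus ?thesis unfolding k by (simp del: mult_Suc)
  qed
  show ?case using 1 2 Suc by simp
qed auto

text \<open>The sieve of Eratosthenes. If the new prime divides \<open>m\<close>, then
  \<open>m\<close> and its quotient have the same prime divisors up to \<open>N\<close>, so the two
  coefficients agree and cancel.\<close>

lemma sieve_one:
  "sieve (\<lambda>m. of_bool (0 < m)) N m = of_bool (0 < m \<and> (\<forall>p. prime p \<and> p \<le> N \<longrightarrow> \<not> p dvd m))"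
proof (induction N arbitrary: m)
  case 0
  show ?case using not_prime_0 by auto
next
  case (Suc N)
  show ?case
  proof (cases "prime (Suc N) \<and> Suc N dvd m")
    case False
    have "(\<forall>p. prime p \<and> p \<le> Suc N \<longrightarrow> \<not> p dvd m) \<longleftrightarrow> (\<forall>p. prime p \<and> p \<le> N \<longrightarrow> \<not> p dvd m)"
      using False le_Suc_eq by auto
    moreover have "sieve (\<lambda>m. of_bool (0 < m)) (Suc N) m = sieve (\<lambda>m. of_bool (0 < m)) N m" using False by auto
    ultimately show ?thesis using Suc[of m] by simp
  next
    case True
    then obtain k where k: "m = Suc N * k" by (elim conjE dvdE)
    have "p dvd m \<longleftrightarrow> p dvd k" if "prime p" "p \<le> N" for p
    proof
      assume "p dvd m"
      hence "p dvd Suc N \<or> p dvd k" using that by (simp only: k prime_dvd_mult_iff)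
      moreover have "\<not> p dvd Suc N" using True that
        by (metis Suc_n_not_le_n not_prime_1 primes_dvd_imp_eq)
      ultimately show "p dvd k" by simp
    qed (auto simp: k)
    hence "(\<forall>p. prime p \<and> p \<le> N \<longrightarrow> \<not> p dvd m) \<longleftrightarrow> (\<forall>p. prime p \<and> p \<le> N \<longrightarrow> \<not> p dvd k)" by blast
    moreover have "m div Suc N = k" by (simp only: k nonzero_mult_div_cancel_left)
    moreover have "0 < m \<longleftrightarrow> 0 < k" by (auto simp: k)
    ultimately show ?thesis using True Suc[of m] Suc[of k] by auto
  qed
qed

lemma sieve_one_cases:
  shows "sieve (\<lambda>m. of_bool (0 < m)) N 1 = 1"
    and "2 \<le> m \<Longrightarrow> m \<le> N \<Longrightarrow> sieve (\<lambda>m. of_bool (0 < m)) N m = 0"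
    and "norm (sieve (\<lambda>m. of_bool (0 < m)) N m) \<le> 1"
proof -
  show "sieve (\<lambda>m. of_bool (0 < m)) N 1 = 1" by (auto simp: sieve_one)
  show "norm (sieve (\<lambda>m. of_bool (0 < m)) N m) \<le> 1" by (simp add: sieve_one)
  assume m: "2 \<le> m" "m \<le> N"
  obtain p where p: "prime p" "p dvd m" using m prime_factor_nat[of m] by auto
  hence "p \<le> N" using m dvd_imp_le[of p m] by auto
  thus "sieve (\<lambda>m. of_bool (0 < m)) N m = 0" using p by (auto simp: sieve_one)
qed

lemma zeta_has_sum:
  assumes "1 < Re s"
  shows "((\<lambda>m. of_bool (0 < m) * of_nat m powr (- s)) has_sum zeta s) UNIV"
proof (rule norm_summable_imp_has_sum)
  have "(\<lambda>n. of_nat (Suc n) powr (- s)) sums zeta s"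
    using dirichlet_zeta_sums[OF assms] zeta_eq_series[OF assms] by simp
  hence "(\<lambda>n. of_bool (0 < Suc n) * of_nat (Suc n) powr (- s)) sums zeta s" by simp
  thus "(\<lambda>m. of_bool (0 < m) * of_nat m powr (- s)) sums zeta s"
    by (subst (asm) sums_Suc_iff) simp
  have "summable (\<lambda>n. real n powr (- Re s))" using assms by (simp add: summable_real_powr_iff)
  thus "summable (\<lambda>m. norm (of_bool (0 < m) * (of_nat m powr (- s) :: complex)))"
    by (rule summable_comparison_test'[of _ 0]) (auto simp: norm_mult norm_nat_powr)
qed

definition sifted_zeta :: "nat \<Rightarrow> complex \<Rightarrow> complex" where
  "sifted_zeta N s = euler_prod N s * zeta s"

text \<open>The sieved coefficients are 1 at 1, vanish from 2 to \<open>N\<close> and are bounded by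
  1 beyond, which leaves a tail of the zeta series.\<close>

lemma norm_sifted_zeta_minus_1_le:
  assumes s: "1 < Re s" and N: "1 \<le> N"
  shows "norm (sifted_zeta N s - 1) \<le> real N powr (1 - Re s) / (Re s - 1)"
proof -
  let ?c = "sieve (\<lambda>m. of_bool (0 < m)) N"
  let ?f = "\<lambda>m. ?c m * of_nat m powr (- s)"
  have "?f sums sifted_zeta N s"
    unfolding sifted_zeta_def by (intro has_sum_imp_sums sieve_has_sum zeta_has_sum s)
  from sums_split_initial_segment[OF this, of "N + 1"]
  have *: "(\<lambda>n. ?f (n + (N + 1))) sums (sifted_zeta N s - (\<Sum>m<N+1. ?f m))" .
  have "(\<Sum>m<N+1. ?f m) = (\<Sum>m\<in>{1}. ?f m)"
  proof (rule sum.mono_neutral_right)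
    show "\<forall>m\<in>{..<N+1} - {1}. ?f m = 0"
    proof
      fix m assume m: "m \<in> {..<N+1} - {1}"
      show "?f m = 0"
      proof (cases "m = 0")
        case False
        hence "2 \<le> m" "m \<le> N" using m by auto
        thus ?thesis by (simp add: sieve_one_cases)
      qed auto
    qed
  qed (use N in auto)
  also have "\<dots> = 1" using sieve_one_cases(1)[of N] by simp
  finally have sums: "(\<lambda>n. ?f (n + (N + 1))) sums (sifted_zeta N s - 1)" using * by simp
  have "norm (?f (n + (N + 1))) \<le> real (n + N + 1) powr (- Re s)" for n
  proof -
    have "norm (?f (n + (N + 1))) = norm (?c (n + (N + 1))) * real (n + N + 1) powr (- Re s)"
      by (simp only: norm_mult norm_nat_powr add_gr_0 zero_less_one uminus_complex.sel add.assoc simp_thms)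
    also have "\<dots> \<le> 1 * real (n + N + 1) powr (- Re s)"
      by (intro mult_right_mono sieve_one_cases) auto
    finally show ?thesis by simp
  qed
  hence "norm (sifted_zeta N s - 1) \<le> (\<Sum>n. real (n + N + 1) powr (- Re s))"
    unfolding sums_unique[OF sums] by (intro norm_suminf_le powr_tail_bound(1) s N)
  also have "\<dots> \<le> real N powr (1 - Re s) / (Re s - 1)"
    by (intro powr_tail_bound(2) s N)
  finally show ?thesis .
qed

section \<open>Prime sums and the series of log zeta to the right of 1\<close>

definition prime_log_sum :: "nat \<Rightarrow> complex \<Rightarrow> complex" where
  "prime_log_sum N s = (\<Sum>p\<in>{p. prime p \<and> p \<le> N}. - Ln (1 - of_nat p powr (- s)))"

lemma prime_powr_norm_less_1:
  assumes "prime p" "0 < Re s"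
  shows "norm (of_nat p powr (- s) :: complex) < 1"
proof -
  have "real p powr (- Re s) < real p powr 0"
    using assms prime_gt_1_nat[of p] by (intro powr_less_mono) auto
  thus ?thesis using assms prime_gt_0_nat[of p] by (simp add: norm_nat_powr)
qed

lemma exp_prime_log_sum:
  assumes "0 < Re s"
  shows "exp (prime_log_sum N s) * euler_prod N s = 1" "euler_prod N s \<noteq> 0"
proof -
  have "1 - of_nat p powr (- s) \<noteq> (0::complex)" if "prime p" for p
    using prime_powr_norm_less_1[OF that assms] by auto
  thus "exp (prime_log_sum N s) * euler_prod N s = 1"
    by (simp add: prime_log_sum_def euler_prod_def exp_sum exp_minus prod.distrib[symmetric])
  thus "euler_prod N s \<noteq> 0" by auto
qed

lemma prime_log_series:
  assumes "prime p" "0 < Re w"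
  shows "(\<Sum>\<^sub>\<infinity>m\<in>{1::nat..}. of_nat p powr (- (of_nat m * w)) / of_nat m) = - Ln (1 - of_nat p powr (- w))"
proof -
  let ?u = "of_nat p powr (- w) :: complex"
  have u: "norm ?u < 1" using prime_powr_norm_less_1 assms by blast
  have "(\<lambda>n. - ((- (- ?u)) ^ n) / of_nat n) sums Ln (1 + - ?u)"
    using Ln_series'[of "- ?u"] u by simp
  hence "(\<lambda>n. ?u ^ n / of_nat n) sums - Ln (1 - ?u)"
    using sums_minus by fastforce
  moreover have "summable (\<lambda>n. norm (?u ^ n / of_nat n))"
  proof (rule summable_comparison_test'[of "\<lambda>n. norm ?u ^ n" 0])
    show "summable (\<lambda>n. norm ?u ^ n)" using u by (simp add: summable_geometric)
    fix n :: nat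
    have "norm ?u ^ n / real n \<le> norm ?u ^ n / 1" if "n > 0"
      using that by (intro divide_left_mono) auto
    thus "norm (norm (?u ^ n / of_nat n)) \<le> norm ?u ^ n"
      by (cases "n = 0") (auto simp: norm_divide norm_power)
  qed
  ultimately have "((\<lambda>n. ?u ^ n / of_nat n) has_sum - Ln (1 - ?u)) UNIV"
    by (intro norm_summable_imp_has_sum)
  \<comment> \<open>The index 0 carries the value 0, since division by \<open>of_nat 0\<close> gives
    0.\<close>
  also have "?this \<longleftrightarrow> ((\<lambda>m. of_nat p powr (- (of_nat m * w)) / of_nat m) has_sum - Ln (1 - ?u)) {1..}"
  proof (rule has_sum_cong_neutral)
    fix m :: nat
    have "p > 0" using assms prime_gt_0_nat by blast
    thus "?u ^ m / of_nat m = of_nat p powr (- (of_nat m * w)) / of_nat m"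
      by (simp add: powr_def exp_of_nat_mult[symmetric] mult_ac)
  qed auto
  finally show ?thesis by (rule infsumI)
qed

lemma norm_prime_log_le:
  assumes "prime p" "1 < Re w"
  shows "norm (- Ln (1 - of_nat p powr (- w))) \<le> 2 * real p powr (- Re w)"
proof -
  have p: "2 \<le> p" using assms prime_ge_2_nat by blast
  have "real p powr (- Re w) < real p powr (- 1)" using assms p by (intro powr_less_mono) auto
  also have "\<dots> \<le> 1 / 2" using p by (simp add: powr_minus field_simps)
  finally have "norm (- (of_nat p powr (- w)) :: complex) < 1/2" using p by (simp add: norm_nat_powr)
  from norm_Ln_le[OF this] show ?thesis using p by (simp add: norm_nat_powr)
qed

lemma prime_log_sum_conv_sum: "prime_log_sum N w = (\<Sum>n<N. if prime (Suc n) then - Ln (1 - of_nat (Suc n) powr (- w)) else 0)"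
proof (induction N)
  case 0
  have "{p::nat. prime p \<and> p \<le> 0} = {}" using not_prime_0 by auto
  thus ?case by (simp add: prime_log_sum_def)
next
  case (Suc N)
  have "prime_log_sum (Suc N) w = (if prime (Suc N) then - Ln (1 - of_nat (Suc N) powr (- w)) else 0) + prime_log_sum N w"
    by (simp add: prime_log_sum_def primes_le_Suc del: of_nat_Suc)
  thus ?case using Suc by (simp del: of_nat_Suc)
qed

text \<open>Turns the unordered double sum of the definition into an ordinary series whose partial
  sums are the \<open>prime_log_sum N w\<close>.\<close>

lemma log_zeta_series_sums:
  assumes w: "1 < Re w"
  shows "(\<lambda>n. if prime (Suc n) then - Ln (1 - of_nat (Suc n) powr (- w)) else 0) sums log_zeta_series w"
proof -
  let ?f = "\<lambda>n. if prime n then - Ln (1 - of_nat n powr (- w)) else 0"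
  have "summable (\<lambda>n. 2 * real n powr (- Re w))" using assms by (simp add: summable_real_powr_iff)
  hence s: "summable (\<lambda>n. norm (?f n))"
    by (rule summable_comparison_test'[of _ 0]) (use norm_prime_log_le[OF _ w] in auto)
  have "?f sums suminf ?f" by (rule summable_sums[OF summable_norm_cancel[OF s]])
  define S where "S = suminf ?f"
  define F where "F = (\<lambda>n. if prime n then - Ln (1 - of_nat n powr (- w)) else 0)"
  define G where "G = (\<lambda>p::nat. \<Sum>\<^sub>\<infinity>m\<in>{1::nat..}. of_nat p powr (- (of_nat m * w)) / of_nat m)"
  have sums: "F sums S" using \<open>?f sums suminf ?f\<close> by (simp add: S_def F_def)
  have "(F has_sum S) UNIV" by (rule norm_summable_imp_has_sum[OF _ sums]) (use s in \<open>simp add: F_def\<close>)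
  moreover have "(F has_sum S) UNIV \<longleftrightarrow> (G has_sum S) {p. prime p}"
  proof (rule has_sum_cong_neutral)
    fix p :: nat assume "p \<in> UNIV \<inter> {p. prime p}"
    hence p: "prime p" by simp
    have w0: "0 < Re w" using w by simp
    show "F p = G p"
      unfolding F_def G_def prime_log_series[OF p w0] using p by simp
  qed (auto simp: F_def)
  ultimately have "log_zeta_series w = S" unfolding log_zeta_series_def G_def using infsumI by blast
  hence "?f sums log_zeta_series w" using sums by (simp add: F_def)
  hence "(\<lambda>n. ?f (Suc n)) sums (log_zeta_series w - ?f 0)" by (subst sums_Suc_iff) simp
  moreover have "?f 0 = 0" using not_prime_0 by simp
  ultimately show ?thesis by simp
qed

lemma log_zeta_series_holomorphic: "log_zeta_series holomorphic_on {s. 1 < Re s}"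
proof -
  let ?e = "\<lambda>n w. if prime (Suc n) then - Ln (1 - of_nat (Suc n) powr (- w)) else (0::complex)"
  obtain g where g: "g holomorphic_on {s. 1 < Re s}" "\<And>s. 1 < Re s \<Longrightarrow> (\<lambda>n. ?e n s) sums g s"
  proof (rule powr_summable_local[where c = "\<lambda>_. 2" and a = 1 and e = ?e])
    fix n
    show "?e n holomorphic_on {s. 1 < Re s}"
    proof (cases "prime (Suc n)")
      case True
      have "1 - of_nat (Suc n) powr (- w) \<notin> \<real>\<^sub>\<le>\<^sub>0" if "1 < Re w" for w
      proof -
        have "norm (of_nat (Suc n) powr (- w) :: complex) < 1"
          using prime_powr_norm_less_1[OF True, of w] that by simp
        hence "Re (of_nat (Suc n) powr (- w)) < 1"
          using complex_Re_le_cmod order_le_less_trans by blast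
        thus ?thesis by (auto simp: complex_nonpos_Reals_iff)
      qed
      thus ?thesis using True by (auto intro!: holomorphic_intros simp del: of_nat_Suc)
    qed auto
    fix s :: complex assume "1 < Re s"
    thus "norm (?e n s) \<le> norm (2::complex) * real (Suc n) powr (1 - 1 - Re s)"
      using norm_prime_log_le[of "Suc n" s] by (auto simp del: of_nat_Suc)
  qed auto
  have "g s = log_zeta_series s" if "1 < Re s" for s
    using g(2)[OF that] log_zeta_series_sums[OF that] sums_unique2 by blast
  thus ?thesis using g(1) by (subst holomorphic_cong[of _ _ _ g]) auto
qed

lemma prime_log_sum_tendsto: "1 < Re w \<Longrightarrow> (\<lambda>N. prime_log_sum N w) \<longlonglongrightarrow> log_zeta_series w"
  using log_zeta_series_sums unfolding prime_log_sum_conv_sum sums_def by blast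

lemma norm_log_zeta_series_minus_prime_log_sum_le:
  assumes w: "1 < Re w" and N: "1 \<le> N"
  shows "norm (log_zeta_series w - prime_log_sum N w) \<le> 2 * (real N powr (1 - Re w) / (Re w - 1))"
proof -
  let ?f = "\<lambda>n. if prime (Suc n) then - Ln (1 - of_nat (Suc n) powr (- w)) else 0"
  have sums: "(\<lambda>n. ?f (n + N)) sums (log_zeta_series w - prime_log_sum N w)"
    unfolding prime_log_sum_conv_sum by (rule sums_split_initial_segment[OF log_zeta_series_sums[OF w]])
  have "norm (?f (n + N)) \<le> 2 * real (n + N + 1) powr (- Re w)" for n
    using norm_prime_log_le[of "Suc (n + N)" w] w by (auto simp del: of_nat_Suc)
  hence "norm (log_zeta_series w - prime_log_sum N w) \<le> (\<Sum>n. 2 * real (n + N + 1) powr (- Re w))"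
    unfolding sums_unique[OF sums] by (intro norm_suminf_le summable_mult powr_tail_bound(1) w N)
  also have "\<dots> = 2 * (\<Sum>n. real (n + N + 1) powr (- Re w))"
    by (intro suminf_mult powr_tail_bound(1) w N)
  also have "\<dots> \<le> 2 * (real N powr (1 - Re w) / (Re w - 1))"
    by (intro mult_left_mono powr_tail_bound(2) w N) auto
  finally show ?thesis .
qed

lemma sifted_zeta_tendsto_1:
  assumes s: "1 < Re s"
  shows "(\<lambda>N. sifted_zeta N s) \<longlonglongrightarrow> 1"
proof -
  have "(\<lambda>N. real N powr (1 - Re s) / (Re s - 1)) \<longlonglongrightarrow> 0 / (Re s - 1)"
    using s by (intro tendsto_intros tendsto_neg_powr filterlim_real_sequentially) auto
  hence "(\<lambda>N. sifted_zeta N s - 1) \<longlonglongrightarrow> 0"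
    by (intro Lim_null_comparison[OF _ tendsto_eq_rhs])
       (auto intro!: eventually_sequentiallyI[of 1] norm_sifted_zeta_minus_1_le[OF s])
  thus ?thesis using LIM_zero_iff by blast
qed

text \<open>The product \<open>exp (prime_log_sum N s) * sifted_zeta N s\<close> equals
  \<open>zeta s\<close> for every \<open>N\<close>, while its factors tend to
  \<open>exp (log_zeta_series s)\<close> and 1.\<close>

lemma exp_log_zeta_series:
  assumes s: "1 < Re s"
  shows "exp (log_zeta_series s) = zeta s"
proof -
  have "(\<lambda>N. exp (prime_log_sum N s) * sifted_zeta N s) \<longlonglongrightarrow> exp (log_zeta_series s) * 1"
    by (intro tendsto_intros prime_log_sum_tendsto sifted_zeta_tendsto_1 s)
  moreover have "exp (prime_log_sum N s) * sifted_zeta N s = zeta s" for N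
    using exp_prime_log_sum[of s N] s unfolding sifted_zeta_def by (simp add: mult.assoc[symmetric])
  ultimately show ?thesis using LIMSEQ_unique[of "\<lambda>_. zeta s"] by simp
qed

lemma zeta_nonzero: "1 < Re s \<Longrightarrow> zeta s \<noteq> 0"
  using exp_log_zeta_series[of s] by (metis exp_not_eq_zero)

text \<open>Euler's argument: convergence would bound \<open>log_zeta_series\<close>, hence
  \<open>zeta\<close>, uniformly on the reals beyond 1. Letting the exponent decrease to 1 in
  finitely many terms would then bound the harmonic numbers.\<close>

lemma prime_reciprocals_diverge: "\<not> summable (\<lambda>p. if prime p then 1 / real p else 0)"
proof
  let ?g = "\<lambda>p. if prime p then 1 / real p else 0"
  assume S: "summable ?g"
  define C where "C = 2 * suminf ?g"
  have "harm K \<le> exp C" for K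
  proof -
    have "(\<Sum>n<K. real (Suc n) powr (- x)) \<le> exp C" if x: "1 < x" for x :: real
    proof -
      have "(\<Sum>n<K. real (Suc n) powr (- x)) \<le> (\<Sum>n. real (Suc n) powr (- x))"
      proof (rule sum_le_suminf)
        show "summable (\<lambda>n. real (Suc n) powr (- x))"
          using x summable_Suc_iff[of "\<lambda>n. real n powr (- x)"] by (simp add: summable_real_powr_iff)
      qed auto
      also have "\<dots> = norm (zeta (of_real x))"
      proof -
        have "(\<lambda>n. real (Suc n) powr (- x)) sums (\<Sum>n. real (Suc n) powr (- x))"
          using x summable_Suc_iff[of "\<lambda>n. real n powr (- x)"] by (simp add: summable_real_powr_iff summable_sums)
        hence "(\<lambda>n. complex_of_real (real (Suc n) powr (- x))) sums of_real (\<Sum>n. real (Suc n) powr (- x))"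
          by (rule sums_of_real)
        moreover have "complex_of_real (real (Suc n) powr (- x)) = of_nat (Suc n) powr (- of_real x)" for n
          using powr_of_real[of "real (Suc n)" "- x"] by simp
        ultimately have "zeta (of_real x) = of_real (\<Sum>n. real (Suc n) powr (- x))"
          using zeta_eq_series[of "of_real x"] x by (simp add: sums_iff)
        moreover have "(\<Sum>n. real (Suc n) powr (- x)) \<ge> 0"
          using x summable_Suc_iff[of "\<lambda>n. real n powr (- x)"] by (intro suminf_nonneg) (auto simp: summable_real_powr_iff)
        ultimately show ?thesis by simp
      qed
      also have "\<dots> = exp (Re (log_zeta_series (of_real x)))"
        using exp_log_zeta_series[of "of_real x"] x by (metis Re_complex_of_real norm_exp_eq_Re)
      also have "\<dots> \<le> exp C"
      proof -
        let ?f = "\<lambda>n. if prime (Suc n) then - Ln (1 - of_nat (Suc n) powr (- of_real x)) else 0"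
        have sums: "?f sums log_zeta_series (of_real x)" using x by (intro log_zeta_series_sums) simp
        have S': "summable (\<lambda>n. ?g (Suc n))" using S by (subst summable_Suc_iff)
        have "Re (log_zeta_series (of_real x)) \<le> norm (log_zeta_series (of_real x))" by (rule complex_Re_le_cmod)
        also have "\<dots> \<le> (\<Sum>n. 2 * ?g (Suc n))"
          unfolding sums_unique[OF sums]
        proof (rule norm_suminf_le)
          fix n
          have "real (Suc n) powr (- x) \<le> real (Suc n) powr (- 1)" using x by (intro powr_mono) auto
          hence "2 * real (Suc n) powr (- x) \<le> 2 * (1 / real (Suc n))" by (simp add: powr_minus_divide)
          thus "norm (?f n) \<le> 2 * ?g (Suc n)"
            using norm_prime_log_le[of "Suc n" "of_real x"] x by (auto simp del: of_nat_Suc)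
        qed (use S' in \<open>intro summable_mult\<close>)
        also have "\<dots> = 2 * (\<Sum>n. ?g (Suc n))" using S' by (intro suminf_mult)
        also have "(\<Sum>n. ?g (Suc n)) = suminf ?g" using suminf_split_head[OF S] not_prime_0 by simp
        finally show ?thesis by (simp add: C_def)
      qed
      finally show ?thesis .
    qed
    moreover have "((\<lambda>x. \<Sum>n<K. real (Suc n) powr (- x)) \<longlongrightarrow> (\<Sum>n<K. real (Suc n) powr (- 1))) (at_right 1)"
      by (intro tendsto_intros) auto
    ultimately have "(\<Sum>n<K. real (Suc n) powr (- 1)) \<le> exp C"
      by (intro tendsto_upperbound[where F = "at_right (1::real)"]) (auto simp: eventually_at_right_less intro!: eventually_at_rightI[of 1 2])
    thus ?thesis unfolding harm_def One_nat_def sum.atLeast1_atMost_eq by (simp add: powr_minus)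
  qed
  hence "bounded (range (harm :: nat \<Rightarrow> real))"
    by (intro boundedI[of _ "exp C"]) (auto simp: abs_of_nonneg harm_nonneg)
  moreover have "incseq (harm :: nat \<Rightarrow> real)" by (intro incseq_SucI) (simp add: harm_Suc)
  ultimately have "convergent (harm :: nat \<Rightarrow> real)"
    using Bseq_mono_convergent[of harm] by (auto simp: Bseq_eq_bounded incseq_def)
  thus False using not_convergent_harm by blast
qed

text \<open>Already for \<open>p = 2\<close> the norm of \<open>u\<close> is at most
  \<open>1 / sqrt 2 \<le> 3/4\<close>, and 4 is \<open>1 / (1 - 3/4)\<close>. Only the size of
  \<open>u\<close> is prescribed, so that rotated terms are covered.\<close>

lemma norm_prime_log_linear_le:
  assumes "prime p" "1/2 \<le> Re s" "norm u \<le> real p powr (- Re s)"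
  shows "norm (- Ln (1 - u) - u) \<le> 4 * (norm u)\<^sup>2"
proof -
  have p: "2 \<le> p" using assms prime_ge_2_nat by blast
  have "norm u \<le> real p powr (- Re s)" by (rule assms)
  also have "\<dots> \<le> real p powr (- (1/2))" using p assms by (intro powr_mono) auto
  also have "\<dots> \<le> 2 powr (- (1/2))" using p by (intro powr_mono2') auto
  also have "\<dots> \<le> (3/4::real)"
  proof -
    have "(2::real) powr (- (1/2)) = 1 / sqrt 2" unfolding powr_minus by (subst powr_half_sqrt) (simp_all add: divide_inverse)
    moreover have "4 / 3 \<le> sqrt 2" by (rule real_le_rsqrt) (simp add: power2_eq_square)
    moreover have "1 / sqrt 2 \<le> 1 / (4 / 3)" by (rule divide_left_mono) (use \<open>4 / 3 \<le> sqrt 2\<close> in auto)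
    ultimately show ?thesis by simp
  qed
  finally have u: "norm u \<le> 3/4" .
  have "- Ln (1 - u) - u = - (Ln (1 + (- u)) - (- u))" by simp
  hence "norm (- Ln (1 - u) - u) = norm (Ln (1 + (- u)) - (- u))" by (simp only: norm_minus_cancel)
  also have "\<dots> \<le> norm (- u) ^ 2 / (1 - norm (- u))" using u by (intro Ln_approx_linear) simp
  also have "\<dots> \<le> (norm u)\<^sup>2 / (1/4)" using u by (simp only: norm_minus_cancel) (intro divide_left_mono, auto)
  finally show ?thesis by simp
qed

section \<open>The set where the sifted zeta function is far from 1\<close>

lemma chebyshev_continuous:
  fixes g :: "real \<Rightarrow> real"
  assumes g: "continuous_on {a..b} g" "\<And>y. y \<in> {a..b} \<Longrightarrow> 0 \<le> g y" and c: "0 < c"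
  shows "{y \<in> {a..b}. c \<le> g y} \<in> sets lebesgue"
    and "c * measure lebesgue {y \<in> {a..b}. c \<le> g y} \<le> integral {a..b} g"
proof -
  let ?B = "{y \<in> {a..b}. c \<le> g y}"
  have "?B = {a..b} \<inter> g -` {c..}" by auto
  hence "closed ?B" using continuous_closed_preimage[OF g(1)] by simp
  moreover have "bounded ?B" by (rule bounded_subset[of "{a..b}"]) auto
  ultimately have "compact ?B" by (simp add: compact_eq_bounded_closed)
  hence B: "?B \<in> lmeasurable" by (rule lmeasurable_compact)
  thus Bs: "?B \<in> sets lebesgue" by auto
  have "set_integrable lebesgue ?B g"
    by (rule set_integrable_subset[OF absolutely_integrable_continuous_real[OF g(1)] Bs]) auto
  hence gB: "g integrable_on ?B" by (rule set_lebesgue_integral_eq_integral)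
  have "c * measure lebesgue ?B = integral ?B (\<lambda>_. c)"
    using lmeasure_integral[OF B] integral_mult_right[of ?B c "\<lambda>_. 1"] by simp
  also have "\<dots> \<le> integral ?B g"
    by (rule integral_le) (use gB integrable_on_const[OF B] in auto)
  also have "\<dots> \<le> integral {a..b} g"
    by (rule integral_subset_le) (use g gB in \<open>auto intro: integrable_continuous_real\<close>)
  finally show "c * measure lebesgue ?B \<le> integral {a..b} g" .
qed

section \<open>Dirichlet polynomials on whole half-strips\<close>

definition dirichlet_poly :: "(nat \<Rightarrow> complex) \<Rightarrow> nat \<Rightarrow> complex \<Rightarrow> complex" where
  "dirichlet_poly b M s = (\<Sum>m=1..M. b m * of_nat m powr (- s))"

lemma nat_powr_Complex:
  assumes "0 < m"
  shows "of_nat m powr (- Complex x y) = of_real (real m powr (- x)) * cis (y * - ln (real m))"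
proof -
  have "- Complex x y = of_real (- x) + \<i> * of_real (- y)" by (simp add: complex_eq_iff)
  hence "of_nat m powr (- Complex x y) = exp ((of_real (- x) + \<i> * of_real (- y)) * of_real (ln (real m)))"
    using assms by (simp add: powr_def)
  also have "\<dots> = of_real (exp (- x * ln (real m))) * exp (\<i> * of_real (y * - ln (real m)))"
  proof -
    have "(of_real (- x) + \<i> * of_real (- y)) * of_real (ln (real m)) =
        of_real (- x * ln (real m)) + \<i> * of_real (y * - ln (real m))" by (simp add: algebra_simps)
    thus ?thesis by (simp only: exp_add exp_of_real)
  qed
  finally show ?thesis using assms by (simp add: powr_def cis_conv_exp)
qed

lemma dirichlet_poly_Complex:
  "dirichlet_poly b M (Complex x y) = (\<Sum>m=1..M. (b m * of_real (real m powr (- x))) * cis (y * - ln (real m)))"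
  unfolding dirichlet_poly_def by (intro sum.cong refl) (simp add: nat_powr_Complex mult_ac)

lemma dirichlet_poly_deriv:
  "(dirichlet_poly b M has_field_derivative - dirichlet_poly (\<lambda>m. b m * of_real (ln (real m))) M s) (at s)"
proof -
  have "((\<lambda>s. \<Sum>m=1..M. b m * of_nat m powr (- s)) has_field_derivative
     (\<Sum>m=1..M. - (b m * of_real (ln (real m)) * of_nat m powr (- s)))) (at s)"
  proof (rule DERIV_sum)
    fix m assume m: "m \<in> {1..M}"
    show "((\<lambda>s. b m * of_nat m powr (- s)) has_field_derivative - (b m * of_real (ln (real m)) * of_nat m powr (- s))) (at s)"
    proof -
      have "of_nat m \<noteq> (0 :: complex)" using m by simp
      from DERIV_cmult[OF DERIV_chain2[OF has_field_derivative_powr_right[OF this] DERIV_minus[OF DERIV_ident]]]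
      show ?thesis by (rule DERIV_cong) (use m in \<open>simp add: mult_ac\<close>)
    qed
  qed
  thus ?thesis by (simp add: dirichlet_poly_def[abs_def] sum_negf)
qed

lemma continuous_on_dirichlet_poly [continuous_intros]:
  assumes "continuous_on A f"
  shows "continuous_on A (\<lambda>x. dirichlet_poly b M (f x))"
proof -
  have "continuous_on UNIV (dirichlet_poly b M)"
    using dirichlet_poly_deriv by (intro DERIV_continuous_on[where D = "\<lambda>s. - dirichlet_poly (\<lambda>m. b m * of_real (ln (real m))) M s"]) (auto intro: has_field_derivative_at_within)
  from continuous_on_compose2[OF this assms] show ?thesis by simp
qed

text \<open>A one-dimensional Sobolev inequality: the square of the polynomial at \<open>x\<close>
  differs from its square at 2 by the integral of twice the polynomial times its derivative
  \<open>- F1\<close>, and \<open>2 a b \<le> a^2 + b^2\<close>. The right-hand side does not depend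
  on \<open>x\<close>.\<close>

lemma norm_dirichlet_poly_le_integral:
  assumes "\<sigma> \<le> x" "x \<le> 2" and F1_def: "F1 = dirichlet_poly (\<lambda>m. b m * of_real (ln (real m))) M"
  shows "(norm (dirichlet_poly b M (Complex x y)))\<^sup>2 \<le> (norm (dirichlet_poly b M (Complex 2 y)))\<^sup>2 +
     integral {\<sigma>..2} (\<lambda>u. (norm (dirichlet_poly b M (Complex u y)))\<^sup>2 + (norm (F1 (Complex u y)))\<^sup>2)"
proof -
  let ?F = "dirichlet_poly b M"
  let ?h = "\<lambda>u. (norm (?F (Complex u y)))\<^sup>2 + (norm (F1 (Complex u y)))\<^sup>2"
  let ?h' = "\<lambda>u. 2 * ?F (Complex u y) * - F1 (Complex u y)"
  have "(?h' has_integral (?F (Complex 2 y))\<^sup>2 - (?F (Complex x y))\<^sup>2) {x..2}"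
  proof (rule fundamental_theorem_of_calculus[OF assms(2)])
    fix u assume "u \<in> {x..2}"
    have C: "Complex v y = of_real v + \<i> * of_real y" for v by (rule Complex_eq)
    have "((\<lambda>z. (?F (z + \<i> * of_real y))\<^sup>2) has_field_derivative
        2 * ?F (of_real u + \<i> * of_real y) * - F1 (of_real u + \<i> * of_real y)) (at (of_real u))"
      unfolding F1_def
      by (auto intro!: derivative_eq_intros DERIV_chain2[OF dirichlet_poly_deriv])
    from has_vector_derivative_real_field[OF this]
    show "((\<lambda>u. (?F (Complex u y))\<^sup>2) has_vector_derivative ?h' u) (at u within {x..2})"
      unfolding C .
  qed
  note hi = this
  have eq: "integral {x..2} ?h' = (?F (Complex 2 y))\<^sup>2 - (?F (Complex x y))\<^sup>2" and int: "?h' integrable_on {x..2}"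
    by (rule integral_unique[OF hi], rule has_integral_integrable[OF hi])
  have hint: "?h integrable_on {v..2}" for v
    unfolding F1_def by (intro integrable_continuous_real continuous_intros)
  have "norm (integral {x..2} ?h') \<le> integral {x..2} ?h"
  proof (rule Henstock_Kurzweil_Integration.integral_norm_bound_integral[OF int hint])
    fix u
    have "0 \<le> (norm (?F (Complex u y)) - norm (F1 (Complex u y)))\<^sup>2" by simp
    thus "norm (?h' u) \<le> ?h u" by (simp add: norm_mult power2_diff)
  qed
  also have "\<dots> \<le> integral {\<sigma>..2} ?h"
    using assms(1) by (intro integral_subset_le hint) auto
  finally have "norm ((?F (Complex 2 y))\<^sup>2 - (?F (Complex x y))\<^sup>2) \<le> integral {\<sigma>..2} ?h" by (simp only: eq)
  moreover have "norm ((?F (Complex x y))\<^sup>2) \<le> norm ((?F (Complex 2 y))\<^sup>2) + norm ((?F (Complex 2 y))\<^sup>2 - (?F (Complex x y))\<^sup>2)"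
    by (metis norm_minus_commute norm_triangle_sub)
  ultimately show ?thesis by (simp add: norm_power)
qed

text \<open>Chebyshev's inequality for the majorant \<open>G\<close> that the Sobolev inequality
  provides for all abscissas simultaneously. The line Re = 2 contributes \<open>V\<close> and the
  strip, of width at most 2, contributes at most \<open>4 * V\<close>.\<close>

lemma dirichlet_poly_exceptional_set:
  fixes \<sigma> V c lo hi :: real
  assumes \<sigma>: "0 \<le> \<sigma>" "\<sigma> \<le> 2" and c: "0 < c" and lh: "lo \<le> hi"
    and V: "\<And>u. u \<in> {\<sigma>..2} \<Longrightarrow> integral {lo..hi} (\<lambda>y. (norm (dirichlet_poly b M (Complex u y)))\<^sup>2) \<le> V"
       "\<And>u. u \<in> {\<sigma>..2} \<Longrightarrow> integral {lo..hi} (\<lambda>y. (norm (dirichlet_poly (\<lambda>m. b m * of_real (ln (real m))) M (Complex u y)))\<^sup>2) \<le> V"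
  obtains B where "B \<in> sets lebesgue" "B \<subseteq> {lo..hi}" "c * measure lebesgue B \<le> 5 * V"
    "\<And>x y. y \<in> {lo..hi} - B \<Longrightarrow> x \<in> {\<sigma>..2} \<Longrightarrow> (norm (dirichlet_poly b M (Complex x y)))\<^sup>2 < c"
proof -
  let ?F1 = "dirichlet_poly (\<lambda>m. b m * of_real (ln (real m))) M"
  let ?h = "\<lambda>y u. (norm (dirichlet_poly b M (Complex u y)))\<^sup>2 + (norm (?F1 (Complex u y)))\<^sup>2"
  define G where "G = (\<lambda>y. (norm (dirichlet_poly b M (Complex 2 y)))\<^sup>2 + integral {\<sigma>..2} (?h y))"
  have V0: "0 \<le> V"
  proof -
    have "0 \<le> integral {lo..hi} (\<lambda>y. (norm (dirichlet_poly b M (Complex 2 y)))\<^sup>2)"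
      by (intro Henstock_Kurzweil_Integration.integral_nonneg integrable_continuous_real continuous_intros) auto
    thus ?thesis using V(1)[of 2] \<sigma> by simp
  qed
  have cont: "continuous_on UNIV (\<lambda>y. integral {\<sigma>..2} (?h y))"
  proof -
    have "continuous_on (UNIV \<times> cbox \<sigma> 2) (\<lambda>(y, u). ?h y u)"
      unfolding split_beta by (intro continuous_intros)
    from integral_continuous_on_param[OF this] show ?thesis by simp
  qed
  have Gcont: "continuous_on {lo..hi} G"
    unfolding G_def by (intro continuous_intros continuous_on_subset[OF cont]) auto
  have G0: "0 \<le> G y" for y
    unfolding G_def
    by (intro add_nonneg_nonneg Henstock_Kurzweil_Integration.integral_nonneg integrable_continuous_real continuous_intros) auto
  have intG: "integral {lo..hi} G \<le> 5 * V"
  proof -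
    have "integral {lo..hi} G = integral {lo..hi} (\<lambda>y. (norm (dirichlet_poly b M (Complex 2 y)))\<^sup>2) + integral {lo..hi} (\<lambda>y. integral {\<sigma>..2} (?h y))"
      unfolding G_def
      by (intro Henstock_Kurzweil_Integration.integral_add integrable_continuous_real continuous_intros continuous_on_subset[OF cont]) auto
    also have "integral {lo..hi} (\<lambda>y. integral {\<sigma>..2} (?h y)) = integral {\<sigma>..2} (\<lambda>u. integral {lo..hi} (\<lambda>y. ?h y u))"
    proof -
      have "continuous_on (cbox (lo, \<sigma>) (hi, 2)) (\<lambda>(y, u). ?h y u)"
        unfolding split_beta by (intro continuous_intros)
      from integral_swap_continuous[OF this] show ?thesis by simp
    qed
    also have "\<dots> \<le> integral {\<sigma>..2} (\<lambda>u. 2 * V)"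
    proof (rule integral_le)
      have "continuous_on (UNIV \<times> cbox lo hi) (\<lambda>(u, y). ?h y u)"
        unfolding split_beta by (intro continuous_intros)
      from integral_continuous_on_param[OF this] have "continuous_on UNIV (\<lambda>u. integral {lo..hi} (\<lambda>y. ?h y u))" by simp
      thus "(\<lambda>u. integral {lo..hi} (\<lambda>y. ?h y u)) integrable_on {\<sigma>..2}"
        by (intro integrable_continuous_real continuous_on_subset[where s = UNIV and t = "{\<sigma>..2}"]) auto
      fix u assume u: "u \<in> {\<sigma>..2}"
      have "integral {lo..hi} (\<lambda>y. ?h y u) = integral {lo..hi} (\<lambda>y. (norm (dirichlet_poly b M (Complex u y)))\<^sup>2) + integral {lo..hi} (\<lambda>y. (norm (?F1 (Complex u y)))\<^sup>2)"
        by (intro Henstock_Kurzweil_Integration.integral_add integrable_continuous_real continuous_intros)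
      thus "integral {lo..hi} (\<lambda>y. ?h y u) \<le> 2 * V" using V[OF u] by simp
    qed auto
    also have "\<dots> = (2 - \<sigma>) * (2 * V)" using \<sigma> by simp
    also have "\<dots> \<le> 2 * (2 * V)" using \<sigma> V0 by (intro mult_right_mono) auto
    finally show ?thesis using V(1)[of 2] \<sigma> by simp
  qed
  show ?thesis
  proof (rule that[of "{y \<in> {lo..hi}. c \<le> G y}"])
    show "{y \<in> {lo..hi}. c \<le> G y} \<in> sets lebesgue"
      by (rule chebyshev_continuous[OF Gcont G0 c])
    show "c * measure lebesgue {y \<in> {lo..hi}. c \<le> G y} \<le> 5 * V"
      using chebyshev_continuous(2)[OF Gcont G0 c] intG by linarith
    fix x y assume y: "y \<in> {lo..hi} - {y \<in> {lo..hi}. c \<le> G y}" and x: "x \<in> {\<sigma>..2}"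
    have "(norm (dirichlet_poly b M (Complex x y)))\<^sup>2 \<le> G y"
      unfolding G_def using norm_dirichlet_poly_le_integral[of \<sigma> x ?F1 b M y] x by auto
    also have "G y < c" using y by auto
    finally show "(norm (dirichlet_poly b M (Complex x y)))\<^sup>2 < c" .
  qed auto
qed

section \<open>The sifted zeta function at height T\<close>

lemma norm_euler_prod_le:
  assumes "0 < Re s"
  shows "norm (euler_prod N s) \<le> 2 ^ N"
proof -
  have "norm (euler_prod N s) \<le> (\<Prod>p\<in>{p. prime p \<and> p \<le> N}. 2)"
    unfolding euler_prod_def prod_norm[symmetric]
  proof (intro prod_mono conjI)
    fix p assume "p \<in> {p. prime p \<and> p \<le> N}"
    hence "norm (of_nat p powr (- s) :: complex) < 1" using prime_powr_norm_less_1[OF _ assms] by simp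
    thus "norm (1 - of_nat p powr (- s)) \<le> 2"
      using norm_triangle_ineq4[of 1 "of_nat p powr (- s)"] by simp
  qed auto
  also have "\<dots> = 2 ^ card {p. prime p \<and> p \<le> N}" by simp
  also have "\<dots> \<le> 2 ^ N"
  proof (rule power_increasing)
    have "{p. prime p \<and> p \<le> N} \<subseteq> {1..N}" using prime_gt_0_nat by (force simp: Suc_le_eq)
    from card_mono[OF _ this] show "card {p. prime p \<and> p \<le> N} \<le> N" by simp
  qed auto
  finally show ?thesis .
qed

text \<open>With coefficients of finite support the summation rule for the sieve holds at every
  \<open>s\<close>, so the partial sum of zeta times the Euler factors is again a Dirichlet
  polynomial.\<close>

lemma dirichlet_poly_sieve:
  "dirichlet_poly (sieve (\<lambda>m. of_bool (0 < m \<and> m \<le> X)) N) (X * fact N) s = euler_prod N s * (\<Sum>n<X. of_nat (Suc n) powr (- s))"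
proof -
  let ?c = "\<lambda>m. of_bool (0 < m \<and> m \<le> X) :: complex"
  have "((\<lambda>m. ?c m * of_nat m powr (- s)) has_sum (\<Sum>m=1..X. ?c m * of_nat m powr (- s))) UNIV"
    by (rule has_sum_finite_neutralI[of "{1..X}"]) auto
  also have "(\<Sum>m=1..X. ?c m * of_nat m powr (- s)) = (\<Sum>m=1..X. of_nat m powr (- s))"
    by (intro sum.cong) auto
  also have "\<dots> = (\<Sum>n<X. of_nat (Suc n) powr (- s))"
    unfolding One_nat_def sum.atLeast1_atMost_eq ..
  finally have "((\<lambda>m. sieve ?c N m * of_nat m powr (- s)) has_sum (euler_prod N s * (\<Sum>n<X. of_nat (Suc n) powr (- s)))) UNIV"
    by (rule sieve_has_sum)
  moreover have "((\<lambda>m. sieve ?c N m * of_nat m powr (- s)) has_sum dirichlet_poly (sieve ?c N) (X * fact N) s) UNIV"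
  proof (rule has_sum_finite_neutralI[of "{1..X * fact N}"])
    fix m assume m: "m \<in> UNIV - {1..X * fact N}"
    show "sieve ?c N m * of_nat m powr (- s) = 0"
    proof (cases "m = 0")
      case False
      hence "X * fact N < m" using m by auto
      hence "sieve ?c N m = 0" by (intro sieve_eq_0[of X]) auto
      thus ?thesis by simp
    qed auto
  qed (auto simp: dirichlet_poly_def)
  ultimately show ?thesis using has_sum_unique by blast
qed

text \<open>Up to the error from \<open>zeta_tail\<close>, \<open>sifted_zeta N - 1\<close> is a
  Dirichlet polynomial without terms up to \<open>N\<close>. Its diagonal is governed by a tail of
  \<open>\<Sum> m powr (- 2 * \<alpha>)\<close>, which is small for large \<open>N\<close>; the
  damage done by truncation at \<open>X\<close> and the off-diagonal terms are \<open>o(T)\<close>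
  for fixed \<open>N\<close>.\<close>

lemma sifted_zeta_close_to_1:
  fixes \<sigma> \<eta> \<kappa> :: real
  assumes \<sigma>: "1/2 < \<sigma>" "\<sigma> \<le> 1" and \<eta>: "0 < \<eta>" and \<kappa>: "0 < \<kappa>"
  shows "\<forall>\<^sub>F N in sequentially. \<forall>\<^sub>F T in at_top. \<exists>B. B \<in> sets lebesgue \<and> B \<subseteq> {T..3*T} \<and>
    measure lebesgue B \<le> \<kappa> * T \<and> (\<forall>y\<in>{T..3*T} - B. \<forall>x\<ge>\<sigma>. norm (sifted_zeta N (Complex x y) - 1) < \<eta>)"
proof -
  \<comment> \<open>The midpoint is still above 1/2, is below 1 even for
    \<open>\<sigma> = 1\<close>, and leaves the margin \<open>\<rho>\<close> for a
    logarithm.\<close>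
  define \<alpha> where "\<alpha> = (1/2 + \<sigma>) / 2"
  define \<rho> where "\<rho> = \<sigma> - \<alpha>"
  define t where "t = 2 * \<alpha> - 1"
  \<comment> \<open>The same \<delta> serves as the excess of the length over \<open>T\<close> and
    as the loss in the mean square. The off-diagonal terms then have size
    \<open>T powr ((1 + \<delta>) * e)\<close>, and t / 8 is small enough to keep this exponent
    below 1.\<close>
  define \<delta> where "\<delta> = t / 8"
  define e where "e = 2 - 2 * \<alpha> + 2 * \<delta>"
  \<comment> \<open>Since \<open>ln m \<le> m powr \<rho> / \<rho>\<close>, this \<open>K\<close>
    covers the coefficients of the polynomial as well as those of its derivative.\<close>
  define K where "K = 1 + 1 / \<rho>"
  define tl where "tl = (\<lambda>x. x powr (1 - 2 * \<alpha>) / (2 * \<alpha> - 1))"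
  have \<alpha>: "1/2 < \<alpha>" "\<alpha> < 1" "\<alpha> < \<sigma>" using \<sigma> by (auto simp: \<alpha>_def)
  have \<rho>: "0 < \<rho>" using \<alpha> by (simp add: \<rho>_def)
  have t: "0 < t" "t < 1" using \<alpha> by (auto simp: t_def)
  have \<delta>: "0 < \<delta>" using t by (simp add: \<delta>_def)
  have K: "1 \<le> K" using \<rho> by (simp add: K_def)
  have e: "e = 1 - 3/4 * t" by (simp add: e_def \<delta>_def t_def field_simps)
  have e0: "0 < e" using e t by simp
  have de: "(1 + \<delta>) * e < 1"
  proof -
    have "(1 + \<delta>) * e = 1 - 5/8 * t - 3/32 * (t * t)" unfolding e \<delta>_def by (simp add: algebra_simps)
    moreover have "0 < t * t" using t by simp
    ultimately show ?thesis using t by linarith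
  qed
  have d1: "(1 + \<delta>) * (1 - \<alpha>) < 1"
  proof -
    have "(1 + \<delta>) * (1 - \<alpha>) \<le> (1 + \<delta>) * e" using \<alpha> \<delta> by (intro mult_left_mono) (auto simp: e_def)
    thus ?thesis using de by linarith
  qed
  obtain C1 where C1: "C1 \<ge> 0" "\<And>X (a :: nat \<Rightarrow> complex) K lo hi. lo \<le> hi \<Longrightarrow> 0 \<le> K \<Longrightarrow>
      (\<forall>n\<in>{1..X}. norm (a n) \<le> K * real n powr (- \<alpha>)) \<Longrightarrow>
      integral {lo..hi} (\<lambda>y. (norm (\<Sum>n=1..X. a n * cis (y * - ln (real n))))\<^sup>2)
      \<le> (hi - lo) * (\<Sum>n=1..X. (norm (a n))\<^sup>2) + C1 * K\<^sup>2 * real X powr e"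
    by (rule mean_square_dirichlet_polynomial[OF \<alpha>(1,2) \<delta>, folded e_def]) (rule that)
  obtain C2 where C2: "C2 \<ge> 0" "\<And>T s. 1 \<le> T \<Longrightarrow> \<alpha> \<le> Re s \<Longrightarrow> Re s \<le> 2 \<Longrightarrow> T \<le> Im s \<Longrightarrow> Im s \<le> 3 * T \<Longrightarrow>
     norm (zeta_tail (nat \<lceil>T powr (1 + \<delta>)\<rceil>) s) \<le> C2 * T powr ((1 + \<delta>) * (1 - \<alpha>) - 1)"
    by (rule zeta_dirichlet_approx[OF \<alpha>(1,2) \<delta>]) (rule that)
  \<comment> \<open>The 60 collects the 5 of the exceptional set lemma, the 3 in \<open>V\<close>
    and the 4 from the threshold \<open>(\<eta> / 2)^2\<close>.\<close>
  have "\<forall>\<^sub>F N in sequentially. 60 * K\<^sup>2 / \<eta>\<^sup>2 * tl (real N) < \<kappa>"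
  proof (rule order_tendstoD(2))
    show "(\<lambda>N. 60 * K\<^sup>2 / \<eta>\<^sup>2 * tl (real N)) \<longlonglongrightarrow> 60 * K\<^sup>2 / \<eta>\<^sup>2 * (0 / (2 * \<alpha> - 1))"
      unfolding tl_def using \<alpha> by (intro tendsto_intros tendsto_neg_powr filterlim_real_sequentially) auto
  qed (use \<kappa> in auto)
  moreover have "\<forall>\<^sub>F N in sequentially. 1 / real N < \<eta>"
    using lim_1_over_n \<eta> by (rule order_tendstoD(2))
  moreover have "\<forall>\<^sub>F N in sequentially. 1 \<le> N" by (rule eventually_ge_at_top)
  ultimately show ?thesis
  proof eventually_elim
    case (elim N)
    have N: "1 \<le> N" "1 / real N < \<eta>" "60 * K\<^sup>2 / \<eta>\<^sup>2 * tl (real N) < \<kappa>" using elim by auto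
    have tlN: "0 < tl (real N)" using N \<alpha> by (simp add: tl_def)
    have "\<forall>\<^sub>F T in at_top. 2 * K\<^sup>2 * 4 ^ N * tl T + C1 * (K * 2 ^ N)\<^sup>2 * (2 * fact N) powr e * T powr ((1 + \<delta>) * e - 1) < K\<^sup>2 * tl (real N)"
    proof (rule order_tendstoD(2))
      show "((\<lambda>T. 2 * K\<^sup>2 * 4 ^ N * tl T + C1 * (K * 2 ^ N)\<^sup>2 * (2 * fact N) powr e * T powr ((1 + \<delta>) * e - 1)) \<longlongrightarrow>
          2 * K\<^sup>2 * 4 ^ N * (0 / (2 * \<alpha> - 1)) + C1 * (K * 2 ^ N)\<^sup>2 * (2 * fact N) powr e * 0) at_top"
        unfolding tl_def using \<alpha> de by (intro tendsto_intros tendsto_neg_powr filterlim_ident) auto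
    qed (use tlN K in auto)
    moreover have "\<forall>\<^sub>F T in at_top. 2 ^ N * (C2 * T powr ((1 + \<delta>) * (1 - \<alpha>) - 1)) < \<eta> / 2"
    proof (rule order_tendstoD(2))
      show "((\<lambda>T. 2 ^ N * (C2 * T powr ((1 + \<delta>) * (1 - \<alpha>) - 1))) \<longlongrightarrow> 2 ^ N * (C2 * 0)) at_top"
        using d1 by (intro tendsto_intros tendsto_neg_powr filterlim_ident) auto
    qed (use \<eta> in auto)
    moreover have "\<forall>\<^sub>F T in at_top. real N \<le> T" by (rule eventually_ge_at_top)
    ultimately show ?case
    proof eventually_elim
      case (elim T)
      have T: "real N \<le> T" "1 \<le> T" using elim N by auto
      define X where "X = nat \<lceil>T powr (1 + \<delta>)\<rceil>"
      define M where "M = X * fact N"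
      define cf where "cf = sieve (\<lambda>m. of_bool (0 < m \<and> m \<le> X)) N"
      \<comment> \<open>Dropping the coefficient \<open>cf 1 = 1\<close> is the subtraction of 1
        from \<open>sifted_zeta\<close>.\<close>
      define b where "b = (\<lambda>m. if m = 1 then 0 else cf m)"
      have T1: "T \<le> T powr (1 + \<delta>)" using powr_mono[of 1 "1 + \<delta>" T] T \<delta> by simp
      have X: "T powr (1 + \<delta>) \<le> real X" "real X \<le> 2 * T powr (1 + \<delta>)"
        using T1 T by (auto simp: X_def intro: real_nat_ceiling_ge) linarith+
      have XN: "N \<le> X" "1 \<le> X" "T \<le> real X" using X T1 T N by linarith+
      have M1: "1 \<le> M" unfolding M_def using XN by (simp add: Suc_le_eq)
      have cf_one: "cf m = sieve (\<lambda>m. of_bool (0 < m)) N m" if "m \<le> X" for m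
        unfolding cf_def by (rule sieve_cong[of X]) (use that in auto)
      have cf1: "cf 1 = 1" using cf_one[of 1] sieve_one_cases(1)[of N] XN by simp
      have b2: "norm (b m) \<le> 2 ^ N" for m
        unfolding b_def cf_def using norm_sieve_le[of "\<lambda>m. of_bool (0 < m \<and> m \<le> X)" N m] by auto
      have b1: "norm (b m) \<le> of_bool (N < m)" if "1 \<le> m" "m \<le> X" for m
        using cf_one[OF that(2)] sieve_one_cases(2)[of m N] sieve_one_cases(3)[of N m] that
        by (auto simp: b_def not_less)
      \<comment> \<open>Up to \<open>X\<close> truncation has no effect and the coefficients are
        indicators supported beyond \<open>N\<close>; after \<open>X\<close> only the bound
        \<open>2 ^ N\<close> remains.\<close>
      have bsq: "(norm (b m))\<^sup>2 \<le> of_bool (N < m) + 4 ^ N * of_bool (X < m)" if "1 \<le> m" for m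
      proof (cases "m \<le> X")
        case True
        have "(norm (b m))\<^sup>2 \<le> (of_bool (N < m))\<^sup>2" using b1[OF that True] by (intro power_mono) auto
        also have "\<dots> \<le> of_bool (N < m) + 4 ^ N * of_bool (X < m)" by simp
        finally show ?thesis .
      next
        case False
        have "(norm (b m))\<^sup>2 \<le> (2 ^ N)\<^sup>2" using b2[of m] by (intro power_mono) auto
        also have "\<dots> = 4 ^ N" by (simp add: power2_eq_square power_mult_distrib[symmetric])
        finally show ?thesis using False by (simp add: add_increasing)
      qed
      have zN: "sifted_zeta N s - 1 = dirichlet_poly b M s + euler_prod N s * zeta_tail X s" for s
      proof -
        have "dirichlet_poly cf M s = 1 + dirichlet_poly b M s"
        proof -
          have "dirichlet_poly cf M s = cf 1 * of_nat 1 powr (- s) + (\<Sum>m\<in>{1..M} - {1}. cf m * of_nat m powr (- s))"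
            unfolding dirichlet_poly_def using M1 by (intro sum.remove) auto
          also have "(\<Sum>m\<in>{1..M} - {1}. cf m * of_nat m powr (- s)) = (\<Sum>m\<in>{1..M} - {1}. b m * of_nat m powr (- s))"
            by (intro sum.cong) (auto simp: b_def)
          also have "\<dots> = dirichlet_poly b M s"
            unfolding dirichlet_poly_def by (intro sum.mono_neutral_left) (auto simp: b_def)
          finally show ?thesis using cf1 by simp
        qed
        moreover have "dirichlet_poly cf M s = euler_prod N s * (\<Sum>n<X. of_nat (Suc n) powr (- s))"
          unfolding cf_def M_def by (rule dirichlet_poly_sieve)
        ultimately show ?thesis by (simp add: sifted_zeta_def zeta_tail_def algebra_simps)
      qed
      \<comment> \<open>Two of the three units come from the length \<open>2 * T\<close> of the
        interval; the third absorbs all terms that vanish as \<open>T\<close> grows.\<close>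
      define V where "V = 3 * K\<^sup>2 * tl (real N) * T"
      have mean: "integral {T..3*T} (\<lambda>y. (norm (\<Sum>m=1..M. (b m * of_real (f m)) * cis (y * - ln (real m))))\<^sup>2) \<le> V"
        if f: "\<And>m. 1 \<le> m \<Longrightarrow> 0 \<le> f m \<and> f m \<le> K * real m powr (- \<alpha>)" for f :: "nat \<Rightarrow> real"
      proof -
        have "integral {T..3*T} (\<lambda>y. (norm (\<Sum>m=1..M. (b m * of_real (f m)) * cis (y * - ln (real m))))\<^sup>2)
          \<le> (3 * T - T) * (\<Sum>m=1..M. (norm (b m * of_real (f m)))\<^sup>2) + C1 * (K * 2 ^ N)\<^sup>2 * real M powr e"
        proof (intro C1(2) ballI)
          fix m assume m: "m \<in> {1..M}"
          have "norm (b m * of_real (f m)) = f m * norm (b m)" using f[of m] m by (simp add: norm_mult)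
          also have "\<dots> \<le> (K * real m powr (- \<alpha>)) * 2 ^ N" using f[of m] m b2[of m] K by (intro mult_mono) auto
          finally show "norm (b m * of_real (f m)) \<le> K * 2 ^ N * real m powr (- \<alpha>)" by (simp add: mult_ac)
        qed (use T K in auto)
        also have "(\<Sum>m=1..M. (norm (b m * of_real (f m)))\<^sup>2) \<le> K\<^sup>2 * tl (real N) + K\<^sup>2 * 4 ^ N * tl T"
        proof -
          have "(\<Sum>m=1..M. (norm (b m * of_real (f m)))\<^sup>2) \<le>
             (\<Sum>m=1..M. K\<^sup>2 * (of_bool (N < m) * real m powr (- (2 * \<alpha>))) + K\<^sup>2 * 4 ^ N * (of_bool (X < m) * real m powr (- (2 * \<alpha>))))"
          proof (rule sum_mono)
            fix m assume m: "m \<in> {1..M}"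
            have "(norm (b m * of_real (f m)))\<^sup>2 = (f m)\<^sup>2 * (norm (b m))\<^sup>2" using f[of m] m by (simp add: norm_mult power_mult_distrib)
            also have "\<dots> \<le> (K * real m powr (- \<alpha>))\<^sup>2 * (of_bool (N < m) + 4 ^ N * of_bool (X < m))"
              using f[of m] m bsq[of m] by (intro mult_mono power_mono) auto
            also have "(K * real m powr (- \<alpha>))\<^sup>2 = K\<^sup>2 * real m powr (- (2 * \<alpha>))"
              by (simp add: power_mult_distrib power2_eq_square powr_add[symmetric])
            finally show "(norm (b m * of_real (f m)))\<^sup>2 \<le>
              K\<^sup>2 * (of_bool (N < m) * real m powr (- (2 * \<alpha>))) + K\<^sup>2 * 4 ^ N * (of_bool (X < m) * real m powr (- (2 * \<alpha>)))"
              by (simp only: distrib_left mult_ac)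
          qed
          also have "\<dots> = K\<^sup>2 * (\<Sum>m\<in>{N<..M}. real m powr (- (2 * \<alpha>))) + K\<^sup>2 * 4 ^ N * (\<Sum>m\<in>{X<..M}. real m powr (- (2 * \<alpha>)))"
          proof -
            have "(\<Sum>m=1..M. of_bool (L < m) * real m powr (- (2 * \<alpha>))) = (\<Sum>m\<in>{L<..M}. real m powr (- (2 * \<alpha>)))" for L
              by (rule sum.mono_neutral_cong_right) auto
            thus ?thesis by (simp add: sum.distrib sum_distrib_left[symmetric])
          qed
          also have "\<dots> \<le> K\<^sup>2 * tl (real N) + K\<^sup>2 * 4 ^ N * tl (real X)"
            unfolding tl_def using XN N \<alpha> by (intro add_mono mult_left_mono sum_tail_powr_le) auto
          also have "\<dots> \<le> K\<^sup>2 * tl (real N) + K\<^sup>2 * 4 ^ N * tl T"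
            unfolding tl_def using XN T \<alpha> by (intro add_left_mono mult_left_mono divide_right_mono powr_mono2') auto
          finally show ?thesis .
        qed
        also have "real M powr e \<le> (2 * fact N) powr e * T powr ((1 + \<delta>) * e - 1) * T"
        proof -
          have "real M \<le> (2 * fact N) * T powr (1 + \<delta>)"
            using mult_right_mono[OF X(2), of "fact N"] by (simp add: M_def mult_ac)
          hence "real M powr e \<le> ((2 * fact N) * T powr (1 + \<delta>)) powr e" using e0 by (intro powr_mono2) auto
          also have "\<dots> = (2 * fact N) powr e * T powr ((1 + \<delta>) * e)" by (simp add: powr_mult powr_powr)
          also have "T powr ((1 + \<delta>) * e) = T powr ((1 + \<delta>) * e - 1) * T"
            using T powr_add[of T "(1 + \<delta>) * e - 1" 1] by simp
          finally show ?thesis by (simp add: mult_ac)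
        qed
        finally have "integral {T..3*T} (\<lambda>y. (norm (\<Sum>m=1..M. (b m * of_real (f m)) * cis (y * - ln (real m))))\<^sup>2)
            \<le> (3 * T - T) * (K\<^sup>2 * tl (real N) + K\<^sup>2 * 4 ^ N * tl T) +
              C1 * (K * 2 ^ N)\<^sup>2 * ((2 * fact N) powr e * T powr ((1 + \<delta>) * e - 1) * T)"
          using T C1 by (simp add: mult_left_mono add_mono)
        also have "\<dots> = (2 * K\<^sup>2 * tl (real N) + (2 * K\<^sup>2 * 4 ^ N * tl T + C1 * (K * 2 ^ N)\<^sup>2 * (2 * fact N) powr e * T powr ((1 + \<delta>) * e - 1))) * T"
          by (simp add: algebra_simps)
        also have "\<dots> \<le> (2 * K\<^sup>2 * tl (real N) + K\<^sup>2 * tl (real N)) * T"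
          by (intro mult_right_mono add_left_mono less_imp_le[OF elim(1)]) (use T in auto)
        finally show ?thesis by (simp add: V_def algebra_simps)
      qed
      have f1: "0 \<le> real m powr (- u) \<and> real m powr (- u) \<le> K * real m powr (- \<alpha>)" if "1 \<le> m" "\<sigma> \<le> u" for m :: nat and u
      proof -
        have "real m powr (- u) \<le> 1 * real m powr (- \<alpha>)" using that \<alpha> by (simp add: powr_mono)
        also have "\<dots> \<le> K * real m powr (- \<alpha>)" using K by (intro mult_right_mono) auto
        finally show ?thesis by simp
      qed
      have f2: "0 \<le> ln (real m) * real m powr (- u) \<and> ln (real m) * real m powr (- u) \<le> K * real m powr (- \<alpha>)" if "1 \<le> m" "\<sigma> \<le> u" for m :: nat and u
      proof -
        have "ln (real m) * real m powr (- u) \<le> (real m powr \<rho> / \<rho>) * real m powr (- \<sigma>)"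
          using that \<rho> by (intro mult_mono ln_powr_bound powr_mono) auto
        also have "\<dots> = 1 / \<rho> * real m powr (- \<alpha>)" by (simp add: \<rho>_def powr_add[symmetric])
        also have "\<dots> \<le> K * real m powr (- \<alpha>)" by (intro mult_right_mono) (auto simp: K_def)
        finally show ?thesis using that by simp
      qed
      obtain B where B: "B \<in> sets lebesgue" "B \<subseteq> {T..3*T}" "(\<eta> / 2)\<^sup>2 * measure lebesgue B \<le> 5 * V"
        "\<And>x y. y \<in> {T..3*T} - B \<Longrightarrow> x \<in> {\<sigma>..2} \<Longrightarrow> (norm (dirichlet_poly b M (Complex x y)))\<^sup>2 < (\<eta> / 2)\<^sup>2"
      proof (rule dirichlet_poly_exceptional_set[where \<sigma> = \<sigma> and V = V and c = "(\<eta> / 2)\<^sup>2" and lo = T and hi = "3 * T" and b = b and M = M])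
        fix u assume u: "u \<in> {\<sigma>..2}"
        show "integral {T..3*T} (\<lambda>y. (norm (dirichlet_poly b M (Complex u y)))\<^sup>2) \<le> V"
          unfolding dirichlet_poly_Complex by (rule mean) (use f1 u in auto)
        show "integral {T..3*T} (\<lambda>y. (norm (dirichlet_poly (\<lambda>m. b m * of_real (ln (real m))) M (Complex u y)))\<^sup>2) \<le> V"
          unfolding dirichlet_poly_Complex using mean[of "\<lambda>m. ln (real m) * real m powr (- u)"] f2 u by (simp add: mult_ac)
      qed (use \<sigma> \<eta> T in auto)
      show ?case
      proof (intro exI[of _ B] conjI ballI allI impI)
        have "measure lebesgue B * \<eta>\<^sup>2 \<le> 60 * K\<^sup>2 * tl (real N) * T" using B(3) by (simp add: V_def power_divide field_simps)
        hence "measure lebesgue B \<le> 60 * K\<^sup>2 / \<eta>\<^sup>2 * tl (real N) * T" using \<eta> by (simp add: field_simps)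
        also have "\<dots> \<le> \<kappa> * T" using N T by (intro mult_right_mono) auto
        finally show "measure lebesgue B \<le> \<kappa> * T" .
        fix y x assume y: "y \<in> {T..3*T} - B" and x: "\<sigma> \<le> x"
        show "norm (sifted_zeta N (Complex x y) - 1) < \<eta>"
        proof (cases "x \<le> 2")
          case True
          have "norm (dirichlet_poly b M (Complex x y)) < \<eta> / 2"
            using B(4)[OF y, of x] x True \<eta> by (intro power_less_imp_less_base[of _ 2 "\<eta> / 2"]) auto
          moreover have "norm (euler_prod N (Complex x y) * zeta_tail X (Complex x y)) \<le> 2 ^ N * (C2 * T powr ((1 + \<delta>) * (1 - \<alpha>) - 1))"
            unfolding norm_mult X_def using x True y \<alpha> T \<sigma> C2(1)
            by (intro mult_mono norm_euler_prod_le C2(2)) auto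
          moreover have "2 ^ N * (C2 * T powr ((1 + \<delta>) * (1 - \<alpha>) - 1)) < \<eta> / 2" using elim by simp
          moreover have "norm (sifted_zeta N (Complex x y) - 1) \<le> norm (dirichlet_poly b M (Complex x y)) + norm (euler_prod N (Complex x y) * zeta_tail X (Complex x y))"
            unfolding zN by (rule norm_triangle_ineq)
          ultimately show ?thesis by linarith
        next
          case False
          have "norm (sifted_zeta N (Complex x y) - 1) \<le> real N powr (1 - x) / (x - 1)"
            using norm_sifted_zeta_minus_1_le[of "Complex x y" N] N False by simp
          also have "\<dots> \<le> real N powr (- 1) / 1"
            using N False by (intro frac_le powr_mono) auto
          also have "\<dots> = 1 / real N" using N by (simp add: powr_minus field_simps)
          also have "\<dots> < \<eta>" by (rule N)
          finally show ?thesis .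
        qed
      qed (use B in auto)
    qed
  qed
qed

section \<open>Simultaneous approximation by prime sums\<close>

lemma sum_cis_roots:
  fixes e :: int and Q :: nat
  assumes "\<bar>e\<bar> < int Q"
  shows "(\<Sum>j<Q. cis (2 * pi * (of_int e * real j / real Q))) = (if e = 0 then of_nat Q else 0)"
proof (cases "e = 0")
  case False
  define x where "x = cis (2 * pi * (of_int e / real Q))"
  have Q: "0 < real Q" using assms by linarith
  have "x \<noteq> 1"
  proof
    assume "x = 1"
    hence "cos (2 * pi * (of_int e / real Q)) = 1" unfolding x_def by (metis cis.sel(1) one_complex.sel(1))
    then obtain k :: int where "2 * pi * (of_int e / real Q) = of_int k * 2 * pi"
      by (auto simp: cos_one_2pi_int)
    hence "of_int e = of_int k * real Q" using Q by (simp add: field_simps)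
    hence "e = k * int Q" by (metis of_int_eq_iff of_int_mult of_int_of_nat_eq)
    thus False using assms False by (cases "k = 0") (auto simp: abs_mult)
  qed
  moreover have "x ^ Q = 1"
  proof -
    have "real Q * (2 * pi * (of_int e / real Q)) = 2 * pi * of_int e" using Q by simp
    hence "x ^ Q = cis (2 * pi * of_int e)" by (simp only: x_def Complex.DeMoivre)
    thus ?thesis using cis_multiple_2pi[of "of_int e"] by simp
  qed
  ultimately have "(\<Sum>j<Q. x ^ j) = 0" by (simp add: geometric_sum)
  moreover have "cis (2 * pi * (of_int e * real j / real Q)) = x ^ j" for j
    by (simp add: x_def Complex.DeMoivre mult_ac)
  ultimately show ?thesis using False by simp
qed auto

text \<open>Average over the \<open>Q\<close>-th roots of unity \<open>v\<close>, \<open>Q > 2 max d\<close>: the real part of the sum has mean \<open>0\<close> and mean square \<open>\<Sum> |a\<^sub>k|\<^sup>2 / 2\<close>, so its maximum cannot be small.\<close>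

lemma unit_direction:
  fixes a :: "'i \<Rightarrow> complex" and d :: "'i \<Rightarrow> nat"
  assumes I: "finite I" and d: "inj_on d I" "\<And>k. k \<in> I \<Longrightarrow> 0 < d k"
  shows "\<exists>v. norm v = 1 \<and> (\<Sum>k\<in>I. (norm (a k))\<^sup>2) \<le> 2 * (\<Sum>k\<in>I. norm (a k)) * Re (\<Sum>k\<in>I. a k * v ^ d k)"
proof -
  obtain D where D: "\<And>k. k \<in> I \<Longrightarrow> d k \<le> D"
    using finite_nat_set_iff_bounded_le[of "d ` I"] I by auto
  \<comment> \<open>All sums and differences of two exponents are at most \<open>2 * D\<close> in
    absolute value, so they are divisible by \<open>Q\<close> only if they are 0.\<close>
  define Q where "Q = 2 * D + 1"
  have Q: "0 < real Q" by (simp add: Q_def)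
  define c where "c = (\<lambda>(e::int) j. cis (2 * pi * (of_int e * real j / real Q)))"
  have c_mult: "c e j * c f j = c (e + f) j" for e f j
    by (simp add: c_def cis_mult add_divide_distrib algebra_simps)
  have c_cnj: "cnj (c e j) = c (- e) j" for e j by (simp add: c_def cis_cnj)
  have c_sum: "(\<Sum>j<Q. c e j) = (if e = 0 then of_nat Q else 0)" if "\<bar>e\<bar> \<le> 2 * int D" for e
    unfolding c_def by (rule sum_cis_roots) (use that in \<open>auto simp: Q_def\<close>)
  define A where "A = (\<lambda>j. \<Sum>k\<in>I. a k * c (int (d k)) j)"
  define K where "K = (\<Sum>k\<in>I. norm (a k))"
  define S where "S = (\<Sum>k\<in>I. (norm (a k))\<^sup>2)"
  have s1: "(\<Sum>j<Q. A j) = 0"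
  proof -
    have "(\<Sum>j<Q. A j) = (\<Sum>k\<in>I. a k * (\<Sum>j<Q. c (int (d k)) j))"
      unfolding A_def by (subst sum.swap) (simp add: sum_distrib_left)
    also have "\<dots> = 0"
      by (intro sum.neutral ballI) (use D d(2) in \<open>subst c_sum, force+\<close>)
    finally show ?thesis .
  qed
  \<comment> \<open>Positivity of the exponents makes \<open>d k + d l\<close> nonzero, so the plain
    square averages to 0; this is what yields half of \<open>S\<close> for the square of the real
    part.\<close>
  have s2: "(\<Sum>j<Q. (A j)\<^sup>2) = 0"
  proof -
    have "(\<Sum>j<Q. (A j)\<^sup>2) = (\<Sum>j<Q. \<Sum>k\<in>I. \<Sum>l\<in>I. a k * a l * c (int (d k) + int (d l)) j)"
      unfolding A_def power2_eq_square sum_product c_mult[symmetric] by (simp add: mult_ac)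
    also have "\<dots> = (\<Sum>k\<in>I. \<Sum>l\<in>I. a k * a l * (\<Sum>j<Q. c (int (d k) + int (d l)) j))"
      by (subst sum.swap, intro sum.cong refl, subst sum.swap) (simp add: sum_distrib_left)
    also have "\<dots> = 0"
    proof (intro sum.neutral ballI)
      fix k l assume "k \<in> I" "l \<in> I"
      thus "a k * a l * (\<Sum>j<Q. c (int (d k) + int (d l)) j) = 0"
        using D[of k] D[of l] d(2)[of k] by (subst c_sum) auto
    qed
    finally show ?thesis .
  qed
  have s3: "(\<Sum>j<Q. (norm (A j))\<^sup>2) = real Q * S"
  proof -
    have "complex_of_real (\<Sum>j<Q. (norm (A j))\<^sup>2) = (\<Sum>j<Q. A j * cnj (A j))"
      by (simp only: of_real_sum complex_norm_square)
    also have "\<dots> = (\<Sum>j<Q. \<Sum>k\<in>I. \<Sum>l\<in>I. a k * cnj (a l) * c (int (d k) + - int (d l)) j)"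
      unfolding A_def cnj_sum sum_product c_mult[symmetric] c_cnj[symmetric] by (simp add: mult_ac)
    also have "\<dots> = (\<Sum>k\<in>I. \<Sum>l\<in>I. a k * cnj (a l) * (\<Sum>j<Q. c (int (d k) + - int (d l)) j))"
      by (subst sum.swap, intro sum.cong refl, subst sum.swap) (simp add: sum_distrib_left)
    also have "\<dots> = (\<Sum>k\<in>I. \<Sum>l\<in>I. if l = k then a k * cnj (a k) * of_nat Q else 0)"
    proof (intro sum.cong refl)
      fix k l assume kl: "k \<in> I" "l \<in> I"
      hence "int (d k) + - int (d l) = 0 \<longleftrightarrow> l = k" using d(1) by (auto simp: inj_on_def)
      thus "a k * cnj (a l) * (\<Sum>j<Q. c (int (d k) + - int (d l)) j) = (if l = k then a k * cnj (a k) * of_nat Q else 0)"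
        using D[OF kl(1)] D[OF kl(2)] by (subst c_sum) auto
    qed
    also have "\<dots> = (\<Sum>k\<in>I. a k * cnj (a k) * of_nat Q)" using I by simp
    also have "\<dots> = complex_of_real (real Q * S)"
      unfolding S_def of_real_mult of_real_sum complex_norm_square by (simp add: sum_distrib_left mult_ac)
    finally show ?thesis by (simp only: of_real_eq_iff)
  qed
  have s4: "(\<Sum>j<Q. (Re (A j))\<^sup>2) = real Q * S / 2"
  proof -
    have "(\<Sum>j<Q. (Re (A j))\<^sup>2) = (\<Sum>j<Q. (norm (A j))\<^sup>2 / 2 + Re ((A j)\<^sup>2) / 2)"
      unfolding cmod_power2 by (intro sum.cong refl) (simp add: power2_eq_square field_simps)
    also have "\<dots> = (\<Sum>j<Q. (norm (A j))\<^sup>2) / 2 + Re (\<Sum>j<Q. (A j)\<^sup>2) / 2"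
      by (simp only: sum.distrib sum_divide_distrib Re_sum)
    finally show ?thesis by (simp add: s2 s3)
  qed
  have bd: "\<bar>Re (A j)\<bar> \<le> K" for j
  proof -
    have "\<bar>Re (A j)\<bar> \<le> norm (A j)" by (rule abs_Re_le_cmod)
    also have "\<dots> \<le> K" unfolding A_def K_def
      by (rule sum_norm_le) (simp add: norm_mult c_def)
    finally show ?thesis .
  qed
  define \<rho> where "\<rho> = Max ((\<lambda>j. Re (A j)) ` {..<Q})"
  have ne: "(\<lambda>j. Re (A j)) ` {..<Q} \<noteq> {}" by (auto simp: Q_def)
  have "\<rho> \<in> (\<lambda>j. Re (A j)) ` {..<Q}" unfolding \<rho>_def by (rule Max_in) (use ne in auto)
  then obtain j0 where j0: "\<rho> = Re (A j0)" by auto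
  have le: "Re (A j) \<le> \<rho>" if "j < Q" for j unfolding \<rho>_def using that by (intro Max_ge) auto
  \<comment> \<open>The real parts lie between \<open>- K\<close> and \<rho>. Averaging this
    product, whose linear term has mean 0, turns the second moment into a lower bound for the
    maximum \<rho>.\<close>
  have "0 \<le> (\<Sum>j<Q. (\<rho> - Re (A j)) * (K + Re (A j)))"
  proof (intro sum_nonneg mult_nonneg_nonneg)
    fix j assume "j \<in> {..<Q}"
    thus "0 \<le> \<rho> - Re (A j)" "0 \<le> K + Re (A j)" using le[of j] bd[of j] by auto
  qed
  also have "\<dots> = (\<Sum>j<Q. \<rho> * K + (\<rho> - K) * Re (A j) - (Re (A j))\<^sup>2)"
    by (intro sum.cong refl) (simp add: algebra_simps power2_eq_square)
  also have "\<dots> = real Q * (\<rho> * K) + (\<rho> - K) * Re (\<Sum>j<Q. A j) - (\<Sum>j<Q. (Re (A j))\<^sup>2)"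
    by (simp add: sum.distrib sum_subtractf sum_distrib_left)
  also have "\<dots> = real Q * (\<rho> * K - S / 2)" by (simp add: s1 s4 algebra_simps)
  finally have fin: "S \<le> 2 * K * \<rho>" using Q by (simp add: zero_le_mult_iff mult_ac)
  define v where "v = cis (2 * pi * (real j0 / real Q))"
  have "v ^ d k = c (int (d k)) j0" for k by (simp add: v_def c_def Complex.DeMoivre mult_ac)
  hence "\<rho> = Re (\<Sum>k\<in>I. a k * v ^ d k)" by (simp add: j0 A_def)
  thus ?thesis using fin by (intro exI[of _ v]) (simp add: S_def K_def v_def)
qed

text \<open>The cross term in the expanded squares is handled by \<open>unit_direction\<close> with
  \<open>cnj (w k) * b\<close> as coefficients. The Cauchy-Schwarz inequality converts the sum of
  the \<open>norm (w k)\<close> in that bound into \<open>sqrt (card I)\<close> times the root of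
  the sum of squares.\<close>

lemma greedy_step:
  fixes w :: "nat \<Rightarrow> complex" and d :: "nat \<Rightarrow> nat"
  assumes I: "finite I" "I \<noteq> {}" and d: "inj_on d I" "\<And>k. k \<in> I \<Longrightarrow> 0 < d k"
  shows "\<exists>v. norm v = 1 \<and> (\<Sum>k\<in>I. (norm (w k - b * v ^ d k))\<^sup>2) \<le>
    (\<Sum>k\<in>I. (norm (w k))\<^sup>2) - norm b * sqrt (\<Sum>k\<in>I. (norm (w k))\<^sup>2) / sqrt (card I) + card I * (norm b)\<^sup>2"
proof -
  define S where "S = (\<Sum>k\<in>I. (norm (w k))\<^sup>2)"
  have S0: "0 \<le> S" unfolding S_def by (intro sum_nonneg) auto
  have n: "0 < real (card I)" using I by (simp add: card_gt_0_iff)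
  obtain v where v: "norm v = 1"
    "(\<Sum>k\<in>I. (norm (cnj (w k) * b))\<^sup>2) \<le> 2 * (\<Sum>k\<in>I. norm (cnj (w k) * b)) * Re (\<Sum>k\<in>I. cnj (w k) * b * v ^ d k)"
    using unit_direction[OF I(1) d, of "\<lambda>k. cnj (w k) * b"] by blast
  define r where "r = Re (\<Sum>k\<in>I. cnj (w k) * b * v ^ d k)"
  have exp: "(\<Sum>k\<in>I. (norm (w k - b * v ^ d k))\<^sup>2) = S - 2 * r + card I * (norm b)\<^sup>2"
  proof -
    have "(norm (x - y))\<^sup>2 = (norm x)\<^sup>2 - 2 * Re (cnj x * y) + (norm y)\<^sup>2" for x y :: complex
      unfolding cmod_power2 by (simp add: power2_eq_square algebra_simps)
    hence "(\<Sum>k\<in>I. (norm (w k - b * v ^ d k))\<^sup>2) =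
       (\<Sum>k\<in>I. (norm (w k))\<^sup>2 - 2 * Re (cnj (w k) * (b * v ^ d k)) + (norm (b * v ^ d k))\<^sup>2)" by simp
    also have "\<dots> = S - 2 * r + (\<Sum>k\<in>I. (norm (b * v ^ d k))\<^sup>2)"
      by (simp add: S_def r_def sum.distrib sum_subtractf sum_distrib_left mult.assoc)
    also have "(\<Sum>k\<in>I. (norm (b * v ^ d k))\<^sup>2) = card I * (norm b)\<^sup>2"
      by (simp add: norm_mult norm_power v(1))
    finally show ?thesis .
  qed
  define L where "L = (\<Sum>k\<in>I. norm (w k))"
  have L0: "0 \<le> L" unfolding L_def by (intro sum_nonneg) auto
  have LS: "L \<le> sqrt (card I) * sqrt S"
  proof -
    have "L\<^sup>2 \<le> card I * S"
      unfolding L_def S_def using sum_squared_le_sum_of_squares[of "\<lambda>k. norm (w k)" I] by (simp add: mult.commute)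
    thus ?thesis using real_le_rsqrt by (simp add: real_sqrt_mult[symmetric])
  qed
  have "(norm b)\<^sup>2 * S \<le> 2 * (L * norm b) * r"
    using v(2) by (simp add: norm_mult power_mult_distrib S_def L_def r_def sum_distrib_right sum_distrib_left mult_ac)
  have "norm b * sqrt S / sqrt (card I) \<le> 2 * r"
  proof (cases "norm b = 0 \<or> S = 0")
    case True
    have "r \<ge> 0" if "S = 0"
    proof -
      have "\<forall>k\<in>I. w k = 0" using that I by (auto simp: S_def sum_nonneg_eq_0_iff)
      thus ?thesis by (simp add: r_def)
    qed
    thus ?thesis using True by (auto simp: r_def)
  next
    case False
    hence b: "0 < norm b" and S: "0 < S" using S0 by auto
    have "norm b * (norm b * S) \<le> norm b * (2 * L * r)"
      using \<open>(norm b)\<^sup>2 * S \<le> 2 * (L * norm b) * r\<close> by (simp add: power2_eq_square mult_ac)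
    hence 1: "norm b * S \<le> 2 * L * r" using b by (rule mult_left_le_imp_le)
    moreover have "0 < norm b * S" using b S by simp
    ultimately have "0 < L * r" by linarith
    hence r: "0 < r" using L0 by (simp add: zero_less_mult_iff)
    have "norm b * S \<le> 2 * (sqrt (card I) * sqrt S) * r"
      using 1 LS r by (smt (verit) mult_right_mono)
    moreover have "sqrt S * (norm b * sqrt S) = norm b * (sqrt S * sqrt S)" by (simp only: mult_ac)
    moreover have "sqrt S * sqrt S = S" using S by simp
    moreover have "sqrt S * (sqrt (card I) * (2 * r)) = 2 * (sqrt (card I) * sqrt S) * r" by (simp only: mult_ac)
    ultimately have "sqrt S * (norm b * sqrt S) \<le> sqrt S * (sqrt (card I) * (2 * r))" by (simp only:)
    hence "norm b * sqrt S \<le> sqrt (card I) * (2 * r)" using S by (simp only: mult_le_cancel_left_pos real_sqrt_gt_zero)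
    thus ?thesis using n by (simp add: field_simps)
  qed
  thus ?thesis using v(1) exp unfolding S_def by (intro exI[of _ v]) linarith
qed

text \<open>Beyond \<open>J\<close> the positive increments sum to less than
  \<open>\<epsilon> / 2\<close>. If \<open>S\<close> stayed above \<open>\<epsilon> / 2\<close>
  there, the decrements would dominate a multiple of the divergent series; once below, it can rise
  by less than \<open>\<epsilon> / 2\<close>.\<close>

lemma greedy_convergence:
  fixes S \<beta> :: "nat \<Rightarrow> real"
  assumes step: "\<And>j. S (Suc j) \<le> S j - c * \<beta> j * sqrt (S j) + C * (\<beta> j)\<^sup>2"
    and S0: "\<And>j. 0 \<le> S j" and \<beta>: "\<And>j. 0 \<le> \<beta> j" and c: "0 < c" and C: "0 \<le> C"
    and div: "\<not> summable \<beta>" and sq: "summable (\<lambda>j. (\<beta> j)\<^sup>2)" and \<epsilon>: "0 < \<epsilon>"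
  shows "\<forall>\<^sub>F j in sequentially. S j < \<epsilon>"
proof -
  have sqC: "summable (\<lambda>j. C * (\<beta> j)\<^sup>2)" using sq by (rule summable_mult)
  obtain J where J: "\<And>m n. m \<ge> J \<Longrightarrow> norm (\<Sum>j=m..<n. C * (\<beta> j)\<^sup>2) < \<epsilon> / 2"
    using sqC[unfolded summable_Cauchy] \<epsilon> by (meson half_gt_zero)
  have J': "(\<Sum>j=m..<n. C * (\<beta> j)\<^sup>2) < \<epsilon> / 2" if "m \<ge> J" for m n
    using J[OF that, of n] by (simp add: abs_less_iff)
  have mono: "S n \<le> S m + (\<Sum>j=m..<n. C * (\<beta> j)\<^sup>2)" if "m \<le> n" for m n
    using that
  proof (induction n rule: dec_induct)
    case (step n)
    have "0 \<le> c * \<beta> n * sqrt (S n)" using c \<beta> S0 by simp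
    thus ?case using step assms(1)[of n] by simp
  qed simp
  have "\<exists>j0\<ge>J. S j0 < \<epsilon> / 2"
  proof (rule ccontr)
    assume "\<not> (\<exists>j0\<ge>J. S j0 < \<epsilon> / 2)"
    hence ge: "S j \<ge> \<epsilon> / 2" if "j \<ge> J" for j using that by (meson not_less)
    define q where "q = c * sqrt (\<epsilon> / 2)"
    have q: "0 < q" using c \<epsilon> by (simp add: q_def)
    have dec: "S n \<le> S J + (\<Sum>j=J..<n. C * (\<beta> j)\<^sup>2) - q * (\<Sum>j=J..<n. \<beta> j)" if "J \<le> n" for n
      using that
    proof (induction n rule: dec_induct)
      case (step n)
      have "q * \<beta> n \<le> c * \<beta> n * sqrt (S n)"
        unfolding q_def using c \<beta>[of n] ge[of n] step by (simp add: mult_left_mono mult_ac)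
      thus ?case using step assms(1)[of n] by (simp add: algebra_simps)
    qed simp
    have bound: "(\<Sum>j=J..<n. \<beta> j) \<le> (S J + \<epsilon> / 2) / q" for n
    proof (cases "J \<le> n")
      case True
      have "q * (\<Sum>j=J..<n. \<beta> j) \<le> S J + \<epsilon> / 2" using dec[OF True] S0[of n] J'[of J n] by linarith
      thus ?thesis using q by (simp add: field_simps)
    next
      case False
      thus ?thesis using S0[of J] q \<epsilon> by simp
    qed
    have "summable \<beta>"
    proof (rule summableI_nonneg_bounded)
      fix n
      have "(\<Sum>j<n. \<beta> j) \<le> (\<Sum>j<J+n. \<beta> j)" by (intro sum_mono2) (use \<beta> in auto)
      also have "\<dots> = (\<Sum>j<J. \<beta> j) + (\<Sum>j=J..<J+n. \<beta> j)"
        by (simp add: lessThan_atLeast0 sum.atLeastLessThan_concat)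
      also have "\<dots> \<le> (\<Sum>j<J. \<beta> j) + (S J + \<epsilon> / 2) / q" using bound by simp
      finally show "(\<Sum>j<n. \<beta> j) \<le> (\<Sum>j<J. \<beta> j) + (S J + \<epsilon> / 2) / q" .
    qed (rule \<beta>)
    thus False using div by simp
  qed
  then obtain j0 where j0: "j0 \<ge> J" "S j0 < \<epsilon> / 2" by blast
  show ?thesis
  proof (rule eventually_sequentiallyI)
    fix j assume "j0 \<le> j"
    thus "S j < \<epsilon>" using mono[of j0 j] J'[OF j0(1), of j] j0 by linarith
  qed
qed

text \<open>Greedy steps apply to the linear terms of the logarithms. The primes up to
  \<open>M\<close> keep the rotation 1 and their exact contribution is moved into the target, so
  linearisation costs only the quadratic terms beyond \<open>M\<close>.\<close>

lemma joint_denseness: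
  fixes d :: "nat \<Rightarrow> nat" and z :: "nat \<Rightarrow> complex"
  assumes I: "finite I" "I \<noteq> {}" and d: "inj_on d I" "\<And>k. k \<in> I \<Longrightarrow> 0 < d k"
    and s: "1/2 < Re s" "Re s \<le> 1" and \<epsilon>: "0 < \<epsilon>"
  obtains v :: "nat \<Rightarrow> complex" where "\<And>p. norm (v p) = 1"
    "\<forall>\<^sub>F N in sequentially. \<forall>k\<in>I.
      norm ((\<Sum>p\<in>{p. prime p \<and> p \<le> N}. - Ln (1 - of_nat p powr (- s) * v p ^ d k)) - z k) < \<epsilon>"
proof -
  define \<sigma> where "\<sigma> = Re s"
  have \<sigma>: "1/2 < \<sigma>" "\<sigma> \<le> 1" using s by (auto simp: \<sigma>_def)
  have "(\<lambda>M. 4 * (real M powr (1 - 2 * \<sigma>) / (2 * \<sigma> - 1))) \<longlonglongrightarrow> 4 * (0 / (2 * \<sigma> - 1))"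
    using \<sigma> by (intro tendsto_intros tendsto_neg_powr filterlim_real_sequentially) auto
  hence "\<forall>\<^sub>F M in sequentially. 4 * (real M powr (1 - 2 * \<sigma>) / (2 * \<sigma> - 1)) < \<epsilon> / 2"
    by (rule order_tendstoD(2)) (use \<epsilon> in auto)
  moreover have "\<forall>\<^sub>F M in sequentially. 1 \<le> (M::nat)" by (rule eventually_ge_at_top)
  ultimately have "\<forall>\<^sub>F M in sequentially. 4 * (real M powr (1 - 2 * \<sigma>) / (2 * \<sigma> - 1)) < \<epsilon> / 2 \<and> 1 \<le> M"
    by eventually_elim auto
  then obtain M :: nat where M: "4 * (real M powr (1 - 2 * \<sigma>) / (2 * \<sigma> - 1)) < \<epsilon> / 2" "1 \<le> M"
    using eventually_happens' sequentially_bot by blast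
  \<comment> \<open>The value 0 off the relevant primes lets the recursion run over all integers; at
    the other indices it changes nothing.\<close>
  define b where "b = (\<lambda>p. if prime p \<and> M < p then of_nat p powr (- s) else 0 :: complex)"
  define z' where "z' = (\<lambda>k. z k - (\<Sum>p\<in>{p. prime p \<and> p \<le> M}. - Ln (1 - of_nat p powr (- s))))"
  define P where "P = (\<lambda>w b v. norm v = 1 \<and> (\<Sum>k\<in>I. (norm (w k - b * v ^ d k))\<^sup>2) \<le>
    (\<Sum>k\<in>I. (norm (w k))\<^sup>2) - norm b * sqrt (\<Sum>k\<in>I. (norm (w k :: complex))\<^sup>2) / sqrt (card I) + card I * (norm b)\<^sup>2)"
  define V where "V = (\<lambda>w b. SOME v. P w b v)"
  have V: "P w b (V w b)" for w b
    unfolding V_def by (rule someI_ex) (use greedy_step[OF I d] in \<open>simp add: P_def\<close>)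
  define w where "w = rec_nat z' (\<lambda>j wj k. wj k - b (Suc j) * V wj (b (Suc j)) ^ d k)"
  have w0: "w 0 = z'" and wS: "w (Suc j) = (\<lambda>k. w j k - b (Suc j) * V (w j) (b (Suc j)) ^ d k)" for j
    by (auto simp: w_def)
  \<comment> \<open>The step from \<open>p - 1\<close> to \<open>p\<close> treats the index
    \<open>p\<close>, hence the deviation \<open>w (p - 1)\<close> before that step.\<close>
  define u where "u = (\<lambda>p. if M < p then V (w (p - 1)) (b p) else 1)"
  have u1: "norm (u p) = 1" for p using V by (auto simp: u_def P_def)
  define S where "S = (\<lambda>j. \<Sum>k\<in>I. (norm (w j k))\<^sup>2)"
  define \<beta> where "\<beta> = (\<lambda>j. norm (b (Suc j)))"
  have nb: "norm (b p) = (if prime p \<and> M < p then real p powr (- \<sigma>) else 0)" for p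
    using prime_gt_0_nat[of p] by (auto simp: b_def norm_nat_powr \<sigma>_def)
  have "\<forall>\<^sub>F j in sequentially. S j < (\<epsilon> / 2)\<^sup>2"
  proof (rule greedy_convergence[where c = "1 / sqrt (card I)" and C = "card I" and \<beta> = \<beta>])
    fix j
    show "S (Suc j) \<le> S j - 1 / sqrt (card I) * \<beta> j * sqrt (S j) + card I * (\<beta> j)\<^sup>2"
      using V[of "w j" "b (Suc j)"] by (simp add: P_def S_def \<beta>_def wS)
    show "0 \<le> S j" unfolding S_def by (intro sum_nonneg) auto
    show "0 \<le> \<beta> j" by (simp add: \<beta>_def)
  next
    show "\<not> summable \<beta>"
    proof
      assume "summable \<beta>"
      hence "summable (\<lambda>j. norm (b j))" unfolding \<beta>_def by (subst (asm) summable_Suc_iff)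
      hence "summable (\<lambda>p. if prime p then 1 / real p else 0)"
      proof (rule summable_comparison_test'[of _ "M + 1"])
        fix p assume p: "M + 1 \<le> p"
        have "real p powr (- 1) \<le> real p powr (- \<sigma>)" using \<sigma> p by (intro powr_mono) auto
        thus "norm (if prime p then 1 / real p else 0) \<le> norm (b p)"
          using p by (auto simp: nb powr_minus_divide)
      qed
      thus False using prime_reciprocals_diverge by simp
    qed
    have "summable (\<lambda>j. real j powr (- (2 * \<sigma>)))" using \<sigma> by (simp add: summable_real_powr_iff)
    hence "summable (\<lambda>j. (norm (b j))\<^sup>2)"
      by (rule summable_comparison_test'[of _ 0]) (auto simp: nb power2_eq_square powr_add[symmetric])
    thus "summable (\<lambda>j. (\<beta> j)\<^sup>2)" unfolding \<beta>_def by (subst summable_Suc_iff)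
  qed (use I \<epsilon> in \<open>auto simp: card_gt_0_iff\<close>)
  moreover have "\<forall>\<^sub>F N in sequentially. M \<le> N" by (rule eventually_ge_at_top)
  ultimately have "\<forall>\<^sub>F N in sequentially. \<forall>k\<in>I.
      norm ((\<Sum>p\<in>{p. prime p \<and> p \<le> N}. - Ln (1 - of_nat p powr (- s) * u p ^ d k)) - z k) < \<epsilon>"
  proof eventually_elim
    case (elim N)
    show ?case
    proof
      fix k assume k: "k \<in> I"
      have fin: "finite {p. prime p \<and> M < p \<and> p \<le> N}" for N :: nat by (rule finite_subset[of _ "{..N}"]) auto
      have wN: "w N k = z' k - (\<Sum>p\<in>{p. prime p \<and> M < p \<and> p \<le> N}. of_nat p powr (- s) * u p ^ d k)" for N
      proof (induction N)
        case 0
        have "{p::nat. prime p \<and> M < p \<and> p \<le> 0} = {}" by auto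
        thus ?case by (simp add: w0)
      next
        case (Suc N)
        show ?case
        proof (cases "prime (Suc N) \<and> M < Suc N")
          case True
          have "{p. prime p \<and> M < p \<and> p \<le> Suc N} = insert (Suc N) {p. prime p \<and> M < p \<and> p \<le> N}"
            using True le_Suc_eq by auto
          moreover have "b (Suc N) * V (w N) (b (Suc N)) ^ d k = of_nat (Suc N) powr (- s) * u (Suc N) ^ d k"
            using True by (simp add: b_def u_def del: of_nat_Suc)
          ultimately show ?thesis using Suc fin[of N] by (simp add: wS del: of_nat_Suc)
        next
          case False
          have "{p. prime p \<and> M < p \<and> p \<le> Suc N} = {p. prime p \<and> M < p \<and> p \<le> N}"
            using False le_Suc_eq by auto
          moreover have "b (Suc N) = 0" using False by (auto simp: b_def)
          ultimately show ?thesis using Suc by (simp add: wS)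
        qed
      qed
      have "(norm (w N k))\<^sup>2 \<le> S N"
        unfolding S_def using I k by (intro member_le_sum) auto
      also have "\<dots> < (\<epsilon> / 2)\<^sup>2" using elim by simp
      finally have w: "norm (w N k) < \<epsilon> / 2" using \<epsilon> by (intro power_less_imp_less_base[of _ 2 "\<epsilon> / 2"]) auto
      let ?t = "\<lambda>p. of_nat p powr (- s) * u p ^ d k"
      have tn: "norm (?t p) = real p powr (- \<sigma>)" if "prime p" for p
        using u1[of p] prime_gt_0_nat[OF that] by (simp add: norm_mult norm_power norm_nat_powr \<sigma>_def)
      have un: "{p. prime p \<and> p \<le> N} = {p. prime p \<and> p \<le> M} \<union> {p. prime p \<and> M < p \<and> p \<le> N}" using elim by auto
      have "(\<Sum>p\<in>{p. prime p \<and> p \<le> N}. - Ln (1 - ?t p)) =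
          (\<Sum>p\<in>{p. prime p \<and> p \<le> M}. - Ln (1 - ?t p)) + (\<Sum>p\<in>{p. prime p \<and> M < p \<and> p \<le> N}. - Ln (1 - ?t p))"
        unfolding un by (rule sum.union_disjoint[OF finite_primes_le fin]) auto
      also have "(\<Sum>p\<in>{p. prime p \<and> p \<le> M}. - Ln (1 - ?t p)) = z k - z' k"
        by (simp add: z'_def u_def)
      finally have eq: "(\<Sum>p\<in>{p. prime p \<and> p \<le> N}. - Ln (1 - ?t p)) - z k =
         (\<Sum>p\<in>{p. prime p \<and> M < p \<and> p \<le> N}. - Ln (1 - ?t p) - ?t p) - w N k"
        unfolding wN by (simp add: sum_subtractf)
      have "norm (\<Sum>p\<in>{p. prime p \<and> M < p \<and> p \<le> N}. - Ln (1 - ?t p) - ?t p) \<le>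
          (\<Sum>p\<in>{p. prime p \<and> M < p \<and> p \<le> N}. 4 * real p powr (- (2 * \<sigma>)))"
      proof (rule sum_norm_le)
        fix p assume "p \<in> {p. prime p \<and> M < p \<and> p \<le> N}"
        hence p: "prime p" by simp
        have "norm (- Ln (1 - ?t p) - ?t p) \<le> 4 * (norm (?t p))\<^sup>2"
          using s tn[OF p] by (intro norm_prime_log_linear_le[OF p, of s]) (auto simp: \<sigma>_def)
        thus "norm (- Ln (1 - ?t p) - ?t p) \<le> 4 * real p powr (- (2 * \<sigma>))"
          using tn[OF p] by (simp add: power2_eq_square powr_add[symmetric])
      qed
      also have "\<dots> \<le> (\<Sum>p\<in>{M<..N}. 4 * real p powr (- (2 * \<sigma>)))"
        by (intro sum_mono2) auto
      also have "\<dots> = 4 * (\<Sum>p\<in>{M<..N}. real p powr (- (2 * \<sigma>)))" by (simp add: sum_distrib_left)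
      also have "\<dots> \<le> 4 * (real M powr (1 - 2 * \<sigma>) / (2 * \<sigma> - 1))"
        by (intro mult_left_mono sum_tail_powr_le) (use \<sigma> M in auto)
      finally have "norm (\<Sum>p\<in>{p. prime p \<and> M < p \<and> p \<le> N}. - Ln (1 - ?t p) - ?t p) < \<epsilon> / 2"
        using M by linarith
      thus "norm ((\<Sum>p\<in>{p. prime p \<and> p \<le> N}. - Ln (1 - ?t p)) - z k) < \<epsilon>"
        unfolding eq using w norm_triangle_ineq4[of "\<Sum>p\<in>{p. prime p \<and> M < p \<and> p \<le> N}. - Ln (1 - ?t p) - ?t p" "w N k"]
        by linarith
    qed
  qed
  thus ?thesis using that u1 by blast
qed

section \<open>Weighted means over the primes\<close>

text \<open>The set \<open>V\<close> contains the primes occurring in the frequencies of \<open>f\<close>, and \<open>c\<close> is the mean square of \<open>f\<close>. Over disjoint sets of primes mean squares are multiplicative.\<close>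

definition dirichlet_trig :: "nat set \<Rightarrow> (real \<Rightarrow> complex) \<Rightarrow> real \<Rightarrow> bool" where
  "dirichlet_trig V f c \<longleftrightarrow> (\<exists>A a. finite A \<and> (\<forall>n\<in>A. 0 < n \<and> (\<forall>q. prime q \<longrightarrow> q dvd n \<longrightarrow> q \<in> V)) \<and>
     (\<forall>\<tau>. f \<tau> = (\<Sum>n\<in>A. a n * cis (\<tau> * - ln (real n)))) \<and> c = (\<Sum>n\<in>A. (norm (a n))\<^sup>2))"

lemma dirichlet_trigE:
  assumes "dirichlet_trig V f c"
  obtains A a where "finite A" "\<And>n. n \<in> A \<Longrightarrow> 0 < n" "\<And>n q. n \<in> A \<Longrightarrow> prime q \<Longrightarrow> q dvd n \<Longrightarrow> q \<in> V"
    "\<And>\<tau>. f \<tau> = (\<Sum>n\<in>A. a n * cis (\<tau> * - ln (real n)))" "c = (\<Sum>n\<in>A. (norm (a n))\<^sup>2)"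
proof -
  from assms obtain A a where *: "finite A \<and> (\<forall>n\<in>A. 0 < n \<and> (\<forall>q. prime q \<longrightarrow> q dvd n \<longrightarrow> q \<in> V)) \<and>
     (\<forall>\<tau>. f \<tau> = (\<Sum>n\<in>A. a n * cis (\<tau> * - ln (real n)))) \<and> c = (\<Sum>n\<in>A. (norm (a n))\<^sup>2)"
    unfolding dirichlet_trig_def by (elim exE)
  show ?thesis by (rule that[of A a]) (use * in \<open>blast+\<close>)
qed

lemma dirichlet_trig_continuous: "dirichlet_trig V f c \<Longrightarrow> continuous_on A f"
  unfolding dirichlet_trig_def by (auto intro!: continuous_intros)

text \<open>Distinct positive integers give distinct frequencies, so the off-diagonal part is
  bounded by a constant and disappears after division by \<open>T\<close>.\<close>

lemma dirichlet_trig_mean: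
  assumes "dirichlet_trig V f c"
  shows "((\<lambda>T. integral {T..2*T} (\<lambda>\<tau>. (norm (f \<tau>))\<^sup>2) / T) \<longlongrightarrow> c) at_top"
proof -
  obtain A a where A: "finite A" "\<And>n. n \<in> A \<Longrightarrow> 0 < n" "\<And>n q. n \<in> A \<Longrightarrow> prime q \<Longrightarrow> q dvd n \<Longrightarrow> q \<in> V"
    and f: "\<And>\<tau>. f \<tau> = (\<Sum>n\<in>A. a n * cis (\<tau> * - ln (real n)))" and c: "c = (\<Sum>n\<in>A. (norm (a n))\<^sup>2)"
    by (rule dirichlet_trigE[OF assms]) (rule that)
  define D where "D = (\<Sum>m\<in>A. \<Sum>n\<in>A - {m}. 2 * norm (a m) * norm (a n) / \<bar>- ln (real m) - - ln (real n)\<bar>)"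
  have inj: "inj_on (\<lambda>n. - ln (real n)) A" using A(2) by (auto simp: inj_on_def)
  have "((\<lambda>T. integral {T..2*T} (\<lambda>\<tau>. (norm (f \<tau>))\<^sup>2) / T - c) \<longlongrightarrow> 0) at_top"
  proof (rule Lim_null_comparison)
    show "\<forall>\<^sub>F T in at_top. norm (integral {T..2*T} (\<lambda>\<tau>. (norm (f \<tau>))\<^sup>2) / T - c) \<le> D / T"
      using eventually_gt_at_top[of 0]
    proof eventually_elim
      case (elim T)
      have "\<bar>integral {T..2*T} (\<lambda>\<tau>. (norm (f \<tau>))\<^sup>2) - (2 * T - T) * c\<bar> \<le> D"
        unfolding f c D_def using mean_value_exponential_sum[OF A(1) inj, of T "2 * T" a] elim by simp
      hence "\<bar>integral {T..2*T} (\<lambda>\<tau>. (norm (f \<tau>))\<^sup>2) - T * c\<bar> / T \<le> D / T"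
        using elim by (intro divide_right_mono) auto
      moreover have "integral {T..2*T} (\<lambda>\<tau>. (norm (f \<tau>))\<^sup>2) / T - c = (integral {T..2*T} (\<lambda>\<tau>. (norm (f \<tau>))\<^sup>2) - T * c) / T"
        using elim by (simp add: diff_divide_distrib)
      ultimately show ?case using elim by simp
    qed
    show "((\<lambda>T. D / T) \<longlongrightarrow> 0) at_top"
      by (intro tendsto_divide_0[OF tendsto_const] filterlim_at_top_imp_at_infinity filterlim_ident)
  qed
  thus ?thesis by (simp add: LIM_zero_iff)
qed

text \<open>Products of one integer from each set are pairwise distinct by coprimality. No two
  frequencies merge, and the squared coefficients simply multiply; this is independence of disjoint
  sets of primes.\<close>

lemma dirichlet_trig_mult:
  assumes f: "dirichlet_trig V f c" and g: "dirichlet_trig V' g c'" and disj: "V \<inter> V' = {}"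
  shows "dirichlet_trig (V \<union> V') (\<lambda>\<tau>. f \<tau> * g \<tau>) (c * c')"
proof -
  obtain A a where A: "finite A" "\<And>n. n \<in> A \<Longrightarrow> 0 < n" "\<And>n q. n \<in> A \<Longrightarrow> prime q \<Longrightarrow> q dvd n \<Longrightarrow> q \<in> V"
    and f: "\<And>\<tau>. f \<tau> = (\<Sum>n\<in>A. a n * cis (\<tau> * - ln (real n)))" and c: "c = (\<Sum>n\<in>A. (norm (a n))\<^sup>2)"
    by (rule dirichlet_trigE[OF f]) (rule that)
  obtain B b where B: "finite B" "\<And>n. n \<in> B \<Longrightarrow> 0 < n" "\<And>n q. n \<in> B \<Longrightarrow> prime q \<Longrightarrow> q dvd n \<Longrightarrow> q \<in> V'"
    and g: "\<And>\<tau>. g \<tau> = (\<Sum>n\<in>B. b n * cis (\<tau> * - ln (real n)))" and c': "c' = (\<Sum>n\<in>B. (norm (b n))\<^sup>2)"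
    by (rule dirichlet_trigE[OF g]) (rule that)
  have cop: "coprime m n" if "m \<in> A" "n \<in> B" for m n
  proof (rule ccontr)
    assume "\<not> coprime m n"
    hence "gcd m n \<noteq> 1" by (simp add: coprime_iff_gcd_eq_1)
    then obtain q where "prime q" "q dvd gcd m n" using prime_factor_nat by blast
    hence "q dvd m" "q dvd n" by auto
    thus False using A(3)[OF that(1) \<open>prime q\<close>] B(3)[OF that(2) \<open>prime q\<close>] disj by auto
  qed
  let ?m = "\<lambda>(m, n). m * n :: nat"
  have inj: "inj_on ?m (A \<times> B)"
  proof (rule inj_onI, clarsimp)
    fix m n m' n' assume mn: "m \<in> A" "n \<in> B" "m' \<in> A" "n' \<in> B" and eq: "m * n = m' * n'"
    have "m dvd m' * n'" using eq by (metis dvd_triv_left)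
    hence 1: "m dvd m'" using cop[OF mn(1,4)] by (simp add: coprime_dvd_mult_left_iff)
    have "m' dvd m * n" using eq by (metis dvd_triv_left)
    hence 2: "m' dvd m" using cop[OF mn(3,2)] by (simp add: coprime_dvd_mult_left_iff)
    have "m = m'" using 1 2 by (rule dvd_antisym)
    thus "m = m' \<and> n = n'" using eq A(2)[OF mn(1)] by simp
  qed
  \<comment> \<open>Recovers the two factors from their product, so that the coefficients become a
    function of a single integer.\<close>
  define h where "h = the_inv_into (A \<times> B) ?m"
  have h: "h (m * n) = (m, n)" if "m \<in> A" "n \<in> B" for m n
    using the_inv_into_f_f[OF inj, of "(m, n)"] that by (simp add: h_def)
  define e where "e = (\<lambda>k. a (fst (h k)) * b (snd (h k)))"
  show ?thesis unfolding dirichlet_trig_def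
  proof (intro exI[of _ "?m ` (A \<times> B)"] exI[of _ e] conjI allI ballI impI)
    show "finite (?m ` (A \<times> B))" using A B by simp
    fix k assume "k \<in> ?m ` (A \<times> B)"
    then obtain m n where k: "k = m * n" "m \<in> A" "n \<in> B" by auto
    show "0 < k" using k A(2) B(2) by simp
    fix q assume "prime q" "q dvd k"
    thus "q \<in> V \<union> V'" using k A(3)[OF k(2)] B(3)[OF k(3)] by (auto simp: prime_dvd_mult_iff)
  next
    fix \<tau>
    have "f \<tau> * g \<tau> = (\<Sum>m\<in>A. \<Sum>n\<in>B. a m * b n * (cis (\<tau> * - ln (real m)) * cis (\<tau> * - ln (real n))))"
      unfolding f g sum_product by (simp add: mult_ac)
    also have "\<dots> = (\<Sum>m\<in>A. \<Sum>n\<in>B. e (m * n) * cis (\<tau> * - ln (real (m * n))))"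
    proof (intro sum.cong refl)
      fix m n assume mn: "m \<in> A" "n \<in> B"
      have "ln (real (m * n)) = ln (real m) + ln (real n)" using A(2)[OF mn(1)] B(2)[OF mn(2)] by (simp add: ln_mult)
      thus "a m * b n * (cis (\<tau> * - ln (real m)) * cis (\<tau> * - ln (real n))) = e (m * n) * cis (\<tau> * - ln (real (m * n)))"
        using mn by (simp add: e_def h cis_mult algebra_simps del: of_nat_mult)
    qed
    also have "\<dots> = (\<Sum>k\<in>?m ` (A \<times> B). e k * cis (\<tau> * - ln (real k)))"
      by (subst sum.reindex[OF inj]) (simp add: sum.cartesian_product split_beta o_def)
    finally show "f \<tau> * g \<tau> = (\<Sum>k\<in>?m ` (A \<times> B). e k * cis (\<tau> * - ln (real k)))" .
  next
    have "c * c' = (\<Sum>m\<in>A. \<Sum>n\<in>B. (norm (e (m * n)))\<^sup>2)"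
      unfolding c c' sum_product by (intro sum.cong refl) (simp add: e_def h norm_mult power_mult_distrib)
    also have "\<dots> = (\<Sum>k\<in>?m ` (A \<times> B). (norm (e k))\<^sup>2)"
      by (subst sum.reindex[OF inj]) (simp add: sum.cartesian_product split_beta o_def)
    finally show "c * c' = (\<Sum>k\<in>?m ` (A \<times> B). (norm (e k))\<^sup>2)" .
  qed
qed

lemma dirichlet_trig_prod:
  assumes "finite P" "\<And>p. p \<in> P \<Longrightarrow> dirichlet_trig {p} (f p) (c p)"
  shows "dirichlet_trig P (\<lambda>\<tau>. \<Prod>p\<in>P. f p \<tau>) (\<Prod>p\<in>P. c p)"
  using assms
proof (induction P rule: finite_induct)
  case empty
  show ?case unfolding dirichlet_trig_def by (intro exI[of _ "{1}"] exI[of _ "\<lambda>_. 1"]) auto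
next
  case (insert p P)
  have "dirichlet_trig ({p} \<union> P) (\<lambda>\<tau>. f p \<tau> * (\<Prod>p\<in>P. f p \<tau>)) (c p * (\<Prod>p\<in>P. c p))"
    using insert by (intro dirichlet_trig_mult) auto
  thus ?case using insert by simp
qed

section \<open>Trigonometric polynomials built from prime rotations\<close>

definition prime_rot :: "nat \<Rightarrow> real \<Rightarrow> complex" where
  "prime_rot p \<tau> = cis (\<tau> * - ln (real p))"

lemma norm_prime_rot [simp]: "norm (prime_rot p \<tau>) = 1" by (simp add: prime_rot_def)

lemma dirichlet_trig_prime_poly:
  assumes "prime p"
  shows "dirichlet_trig {p} (\<lambda>\<tau>. \<Sum>j\<le>m. b j * prime_rot p \<tau> ^ j) (\<Sum>j\<le>m. (norm (b j))\<^sup>2)"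
proof -
  have p: "1 < p" using assms prime_gt_1_nat by blast
  have inj: "inj_on (\<lambda>j. p ^ j) {..m}" using p by (auto simp: inj_on_def power_inject_exp)
  define h where "h = the_inv_into {..m} (\<lambda>j. p ^ j)"
  have h: "h (p ^ j) = j" if "j \<le> m" for j
    using the_inv_into_f_f[OF inj, of j] that by (simp add: h_def)
  show ?thesis unfolding dirichlet_trig_def
  proof (intro exI[of _ "(\<lambda>j. p ^ j) ` {..m}"] exI[of _ "b \<circ> h"] conjI allI ballI impI)
    fix k assume "k \<in> (\<lambda>j. p ^ j) ` {..m}"
    then obtain j where k: "k = p ^ j" by auto
    show "0 < k" using k p by simp
    fix q assume "prime q" "q dvd k"
    thus "q \<in> {p}" using k assms by (metis prime_dvd_power primes_dvd_imp_eq singletonI)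
  next
    fix \<tau>
    have "b j * prime_rot p \<tau> ^ j = (b \<circ> h) (p ^ j) * cis (\<tau> * - ln (real (p ^ j)))" if "j \<in> {..m}" for j
      using h[of j] that p by (simp add: prime_rot_def Complex.DeMoivre ln_realpow mult_ac)
    thus "(\<Sum>j\<le>m. b j * prime_rot p \<tau> ^ j) = (\<Sum>k\<in>(\<lambda>j. p ^ j) ` {..m}. (b \<circ> h) k * cis (\<tau> * - ln (real k)))"
      by (subst sum.reindex[OF inj]) (simp del: of_nat_power o_apply add: comp_apply[of _ "\<lambda>j. p ^ j"])
  next
    show "(\<Sum>j\<le>m. (norm (b j))\<^sup>2) = (\<Sum>k\<in>(\<lambda>j. p ^ j) ` {..m}. (norm ((b \<circ> h) k))\<^sup>2)"
      by (subst sum.reindex[OF inj]) (simp add: h)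
  qed auto
qed

text \<open>The mean of \<open>norm ((1 + x) / 2) ^ (2 * m)\<close> over the unit circle.\<close>

definition central_weight :: "nat \<Rightarrow> real" where "central_weight m = real ((2 * m) choose m) / 4 ^ m"

lemma central_weight_Suc: "central_weight (Suc m) = central_weight m * ((2 * real m + 1) / (2 * real m + 2))"
proof -
  have f: "central_weight m = fact (2 * m) / ((fact m)\<^sup>2 * 4 ^ m)" for m
    by (simp add: central_weight_def binomial_fact power2_eq_square mult_2)
  have "fact (2 * Suc m) = (2 * real m + 2) * ((2 * real m + 1) * fact (2 * m))"
    by (simp add: algebra_simps)
  moreover have "(fact (Suc m))\<^sup>2 * 4 ^ Suc m = (2 * real m + 2) * ((2 * real m + 2) * ((fact m)\<^sup>2 * 4 ^ m))"
    by (simp add: power2_eq_square algebra_simps)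
  ultimately have "central_weight (Suc m) = ((2 * real m + 2) * ((2 * real m + 1) * fact (2 * m))) /
      ((2 * real m + 2) * ((2 * real m + 2) * ((fact m)\<^sup>2 * 4 ^ m)))"
    unfolding f by (simp only:)
  also have "\<dots> = ((2 * real m + 1) * fact (2 * m)) / ((2 * real m + 2) * ((fact m)\<^sup>2 * 4 ^ m))"
    by (rule mult_divide_mult_cancel_left) (simp add: add_nonneg_eq_0_iff)
  finally show ?thesis unfolding f by (simp only: times_divide_times_eq mult.commute)
qed

lemma central_weight_pos: "0 < central_weight m"
  by (simp add: central_weight_def)

text \<open>The squared binomial coefficients add up to the central one by Vandermonde's
  identity.\<close>

lemma dirichlet_trig_weight:
  assumes "prime p" "norm v = 1"
  shows "dirichlet_trig {p} (\<lambda>\<tau>. ((1 + cnj v * prime_rot p \<tau>) / 2) ^ m) (central_weight m)"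
proof -
  have "((1 + cnj v * prime_rot p \<tau>) / 2) ^ m = (\<Sum>j\<le>m. (of_nat (m choose j) * cnj v ^ j / 2 ^ m) * prime_rot p \<tau> ^ j)" for \<tau>
    using binomial_ring[of "cnj v * prime_rot p \<tau>" 1 m]
    by (simp add: power_divide add.commute power_mult_distrib sum_divide_distrib mult_ac)
  moreover have "central_weight m = (\<Sum>j\<le>m. (norm (of_nat (m choose j) * cnj v ^ j / 2 ^ m :: complex))\<^sup>2)"
  proof -
    have "(\<Sum>j\<le>m. (norm (of_nat (m choose j) * cnj v ^ j / 2 ^ m :: complex))\<^sup>2) = (\<Sum>j\<le>m. (real (m choose j))\<^sup>2 / 4 ^ m)"
      using assms by (intro sum.cong refl) (simp add: norm_mult norm_divide norm_power power_divide power_mult[symmetric] mult.commute[of m 2] power_mult)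
    also have "\<dots> = real (\<Sum>j\<le>m. (m choose j)\<^sup>2) / 4 ^ m" by (simp add: sum_divide_distrib)
    also have "\<dots> = central_weight m" by (simp add: choose_square_sum central_weight_def)
    finally show ?thesis by simp
  qed
  ultimately show ?thesis using dirichlet_trig_prime_poly[OF assms(1), of "\<lambda>j. of_nat (m choose j) * cnj v ^ j / 2 ^ m" m] by simp
qed

lemma parallelogram_unit:
  fixes x :: complex
  assumes "norm x = 1"
  shows "(norm ((1 + x) / 2))\<^sup>2 + (norm ((1 - x) / 2))\<^sup>2 = 1"
proof -
  have "(Re x)\<^sup>2 + (Im x)\<^sup>2 = 1" using assms by (metis cmod_power2 one_power2)
  thus ?thesis unfolding cmod_power2 by (simp add: power2_eq_square field_simps)
qed

text \<open>By the parallelogram identity the squared norm is the difference of the weights with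
  exponents \<open>m\<close> and \<open>Suc m\<close>. Its mean is thus a fraction
  \<open>1 / (2 * m + 2)\<close> of the mean weight, which expresses that the weight concentrates at
  \<open>v\<close>. A mean exists because the function is a polynomial in the rotation; its value
  follows from uniqueness of limits.\<close>

lemma dirichlet_trig_weight_off:
  assumes "prime p" "norm v = 1"
  shows "dirichlet_trig {p} (\<lambda>\<tau>. ((1 + cnj v * prime_rot p \<tau>) / 2) ^ m * ((1 - cnj v * prime_rot p \<tau>) / 2)) (central_weight m / (2 * real m + 2))"
proof -
  let ?f = "\<lambda>\<tau>. ((1 + cnj v * prime_rot p \<tau>) / 2) ^ m * ((1 - cnj v * prime_rot p \<tau>) / 2)"
  define q where "q = [:1/2, cnj v / 2:] ^ m * [:1/2, - cnj v / 2:]"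
  have "?f \<tau> = poly q (prime_rot p \<tau>)" for \<tau> by (simp add: q_def poly_power field_simps)
  hence "?f = (\<lambda>\<tau>. \<Sum>j\<le>degree q. coeff q j * prime_rot p \<tau> ^ j)" by (simp add: poly_altdef)
  then obtain c where c: "dirichlet_trig {p} ?f c" using dirichlet_trig_prime_poly[OF assms(1), of "coeff q" "degree q"] by metis
  have "((\<lambda>T. integral {T..2*T} (\<lambda>\<tau>. (norm (((1 + cnj v * prime_rot p \<tau>) / 2) ^ m))\<^sup>2) / T -
      integral {T..2*T} (\<lambda>\<tau>. (norm (((1 + cnj v * prime_rot p \<tau>) / 2) ^ Suc m))\<^sup>2) / T) \<longlongrightarrow> central_weight m - central_weight (Suc m)) at_top"
    by (intro tendsto_diff dirichlet_trig_mean[OF dirichlet_trig_weight[OF assms]])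
  moreover have "integral {T..2*T} (\<lambda>\<tau>. (norm (((1 + cnj v * prime_rot p \<tau>) / 2) ^ m))\<^sup>2) / T -
      integral {T..2*T} (\<lambda>\<tau>. (norm (((1 + cnj v * prime_rot p \<tau>) / 2) ^ Suc m))\<^sup>2) / T =
      integral {T..2*T} (\<lambda>\<tau>. (norm (?f \<tau>))\<^sup>2) / T" for T
  proof -
    have "integral {T..2*T} (\<lambda>\<tau>. (norm (((1 + cnj v * prime_rot p \<tau>) / 2) ^ m))\<^sup>2) -
      integral {T..2*T} (\<lambda>\<tau>. (norm (((1 + cnj v * prime_rot p \<tau>) / 2) ^ Suc m))\<^sup>2) =
      integral {T..2*T} (\<lambda>\<tau>. (norm (((1 + cnj v * prime_rot p \<tau>) / 2) ^ m))\<^sup>2 - (norm (((1 + cnj v * prime_rot p \<tau>) / 2) ^ Suc m))\<^sup>2)"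
      by (intro Henstock_Kurzweil_Integration.integral_diff[symmetric] integrable_continuous_real continuous_intros)
         (auto simp: prime_rot_def intro!: continuous_intros)
    also have "\<dots> = integral {T..2*T} (\<lambda>\<tau>. (norm (?f \<tau>))\<^sup>2)"
    proof (intro integral_cong)
      fix \<tau>
      define x where "x = cnj v * prime_rot p \<tau>"
      have "norm x = 1" using assms by (simp add: x_def norm_mult)
      hence e: "(norm ((1 - x) / 2))\<^sup>2 = 1 - (norm ((1 + x) / 2))\<^sup>2" using parallelogram_unit[of x] by linarith
      have "(norm (((1 + x) / 2) ^ m * ((1 - x) / 2)))\<^sup>2 = (norm (((1 + x) / 2) ^ m))\<^sup>2 * (norm ((1 - x) / 2))\<^sup>2"
        by (simp only: norm_mult power_mult_distrib)
      also have "\<dots> = (norm (((1 + x) / 2) ^ m))\<^sup>2 - (norm (((1 + x) / 2) ^ Suc m))\<^sup>2"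
        unfolding e by (simp only: norm_mult power_mult_distrib power_Suc2 right_diff_distrib mult_1_right)
      finally show "(norm (((1 + cnj v * prime_rot p \<tau>) / 2) ^ m))\<^sup>2 - (norm (((1 + cnj v * prime_rot p \<tau>) / 2) ^ Suc m))\<^sup>2 = (norm (?f \<tau>))\<^sup>2"
        by (simp only: x_def)
    qed
    finally show ?thesis by (simp only: diff_divide_distrib[symmetric])
  qed
  ultimately have "((\<lambda>T. integral {T..2*T} (\<lambda>\<tau>. (norm (?f \<tau>))\<^sup>2) / T) \<longlongrightarrow> central_weight m - central_weight (Suc m)) at_top"
    by (simp only:)
  from tendsto_unique[OF trivial_limit_at_top_linorder dirichlet_trig_mean[OF c] this]
  have "c = central_weight m - central_weight (Suc m)" .
  also have "\<dots> = central_weight m * (1 - (2 * real m + 1) / (2 * real m + 2))"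
    by (simp add: central_weight_Suc algebra_simps)
  also have "1 - (2 * real m + 1) / (2 * real m + 2) = 1 / (2 * real m + 2)" by (simp add: field_simps)
  finally show ?thesis using c by simp
qed

lemma dirichlet_trig_prime_sum:
  assumes P: "finite P" "\<And>p. p \<in> P \<Longrightarrow> prime p" and d: "0 < d"
  shows "dirichlet_trig P (\<lambda>\<tau>. \<Sum>p\<in>P. b p * prime_rot p \<tau> ^ d) (\<Sum>p\<in>P. (norm (b p))\<^sup>2)"
proof -
  have inj: "inj_on (\<lambda>p. p ^ d) P" using d by (auto simp: inj_on_def power_eq_iff_eq_base)
  define h where "h = the_inv_into P (\<lambda>p. p ^ d)"
  have h: "h (p ^ d) = p" if "p \<in> P" for p
    using the_inv_into_f_f[OF inj, of p] that by (simp add: h_def)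
  have p0: "0 < p" if "p \<in> P" for p using P(2)[OF that] prime_gt_0_nat by blast
  show ?thesis unfolding dirichlet_trig_def
  proof (intro exI[of _ "(\<lambda>p. p ^ d) ` P"] exI[of _ "b \<circ> h"] conjI allI ballI impI)
    fix k assume "k \<in> (\<lambda>p. p ^ d) ` P"
    then obtain p where k: "k = p ^ d" "p \<in> P" by auto
    show "0 < k" using k p0 by simp
    fix q assume "prime q" "q dvd k"
    thus "q \<in> P" using k P(2) by (metis prime_dvd_power primes_dvd_imp_eq)
  next
    fix \<tau>
    have "b p * prime_rot p \<tau> ^ d = (b \<circ> h) (p ^ d) * cis (\<tau> * - ln (real (p ^ d)))" if "p \<in> P" for p
      using h[OF that] p0[OF that] by (simp add: prime_rot_def Complex.DeMoivre ln_realpow mult_ac)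
    thus "(\<Sum>p\<in>P. b p * prime_rot p \<tau> ^ d) = (\<Sum>k\<in>(\<lambda>p. p ^ d) ` P. (b \<circ> h) k * cis (\<tau> * - ln (real k)))"
      by (subst sum.reindex[OF inj]) (simp del: of_nat_power o_apply add: comp_apply[of _ "\<lambda>p. p ^ d"])
  next
    show "(\<Sum>p\<in>P. (norm (b p))\<^sup>2) = (\<Sum>k\<in>(\<lambda>p. p ^ d) ` P. (norm ((b \<circ> h) k))\<^sup>2)"
      by (subst sum.reindex[OF inj]) (simp add: h)
  qed (use P in auto)
qed

text \<open>\<open>H\<close> is the weight minus a penalty for each unwanted event. It is at most 1
  and is nonpositive outside \<open>G\<close> and \<open>B\<close>, so its integral bounds the sum
  of their measures from below. Each of the two kinds of penalty costs at most a fifth of the mean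
  weight. The threshold for \<open>T\<close> is uniform in \<open>B\<close> and \<open>G\<close>,
  which vary with \<open>T\<close>, and \<mu> is fixed before \<open>N'\<close>; both are essential
  for the application.\<close>

lemma weighted_density:
  fixes v :: "nat \<Rightarrow> complex" and d :: "nat \<Rightarrow> nat" and \<delta> e :: real
  assumes I: "finite I" and d: "\<And>k. k \<in> I \<Longrightarrow> 0 < d k" and v: "\<And>p. norm (v p) = 1"
    and s: "1/2 < Re s" and \<delta>: "0 < \<delta>" and e: "0 < e" and N: "1 \<le> N"
    and tail: "real (card I) * (real N powr (1 - 2 * Re s) / (2 * Re s - 1)) / e\<^sup>2 \<le> 1 / 5"
  obtains \<mu> where "0 < \<mu>" "\<And>N'. \<forall>\<^sub>F T in at_top. \<forall>B G. B \<in> lmeasurable \<longrightarrow> G \<in> lmeasurable \<longrightarrow>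
     B \<subseteq> {T..2*T} \<longrightarrow> G \<subseteq> {T..2*T} \<longrightarrow> measure lebesgue B \<le> \<mu> * T \<longrightarrow>
     (\<forall>\<tau>\<in>{T..2*T} - B. (\<forall>p. prime p \<and> p \<le> N \<longrightarrow> norm (prime_rot p \<tau> - v p) < \<delta>) \<longrightarrow>
        (\<forall>k\<in>I. norm (\<Sum>p\<in>{p. prime p \<and> N < p \<and> p \<le> N'}. of_nat p powr (- s) * prime_rot p \<tau> ^ d k) < e) \<longrightarrow> \<tau> \<in> G) \<longrightarrow>
     \<mu> * T \<le> measure lebesgue G"
proof -
  define P where "P = {p. prime p \<and> p \<le> N}"
  have P: "finite P" "\<And>p. p \<in> P \<Longrightarrow> prime p" by (auto simp: P_def)
  define r where "r = real (card P) / \<delta>\<^sup>2"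
  \<comment> \<open>Makes the penalties at the primes up to \<open>N\<close>, of total relative size
    \<open>4 * r / (2 * m + 2)\<close>, at most 1/5.\<close>
  obtain m :: nat where m: "10 * r \<le> real m" using real_arch_simple by blast
  define x where "x = (\<lambda>p \<tau>. cnj (v p) * prime_rot p \<tau>)"
  define f where "f = (\<lambda>p \<tau>. ((1 + x p \<tau>) / 2) ^ m)"
  define F where "F = (\<lambda>\<tau>. \<Prod>p\<in>P. f p \<tau>)"
  define \<gamma> where "\<gamma> = central_weight m"
  define Mw where "Mw = (\<Prod>p\<in>P. \<gamma>)"
  have \<gamma>: "0 < \<gamma>" using central_weight_pos by (simp add: \<gamma>_def)
  have Mw: "0 < Mw" unfolding Mw_def using \<gamma> by (simp add: prod_pos)
  have dF: "dirichlet_trig P F Mw"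
    unfolding F_def Mw_def f_def x_def \<gamma>_def using P v by (intro dirichlet_trig_prod dirichlet_trig_weight) auto
  have dq: "dirichlet_trig P (\<lambda>\<tau>. F \<tau> * ((1 - x q \<tau>) / 2)) (Mw / (2 * real m + 2))" if q: "q \<in> P" for q
  proof -
    let ?g = "\<lambda>p \<tau>. f p \<tau> * (if p = q then (1 - x p \<tau>) / 2 else 1)"
    let ?c = "\<lambda>p. \<gamma> * (if p = q then 1 / (2 * real m + 2) else 1)"
    have "dirichlet_trig P (\<lambda>\<tau>. \<Prod>p\<in>P. ?g p \<tau>) (\<Prod>p\<in>P. ?c p)"
    proof (rule dirichlet_trig_prod[OF P(1)])
      fix p assume p: "p \<in> P"
      show "dirichlet_trig {p} (?g p) (?c p)"
      proof (cases "p = q")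
        case True
        thus ?thesis using dirichlet_trig_weight_off[OF P(2)[OF p] v] by (simp add: f_def x_def \<gamma>_def)
      next
        case False
        thus ?thesis using dirichlet_trig_weight[OF P(2)[OF p] v] by (simp add: f_def x_def \<gamma>_def)
      qed
    qed
    moreover have "(\<Prod>p\<in>P. ?g p \<tau>) = F \<tau> * ((1 - x q \<tau>) / 2)" for \<tau>
      unfolding prod.distrib F_def using P(1) q by (simp add: prod.delta)
    moreover have "(\<Prod>p\<in>P. ?c p) = Mw / (2 * real m + 2)"
      unfolding prod.distrib Mw_def using P(1) q by (simp add: prod.delta)
    ultimately show ?thesis by simp
  qed
  \<comment> \<open>Three fifths of the mean survive the penalties; one is lost in passing from the
    limit to large \<open>T\<close>, one is spent on \<open>B\<close>, and one remains for
    \<open>G\<close>.\<close>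
  define \<mu> where "\<mu> = Mw / 5"
  show ?thesis
  proof (rule that[of \<mu>])
    show "0 < \<mu>" using Mw by (simp add: \<mu>_def)
    fix N'
    define Q where "Q = {p. prime p \<and> N < p \<and> p \<le> N'}"
    have Q: "finite Q" "\<And>p. p \<in> Q \<Longrightarrow> prime p" by (auto simp: Q_def intro: finite_subset[of _ "{..N'}"])
    define tl where "tl = (\<lambda>k \<tau>. \<Sum>p\<in>Q. of_nat p powr (- s) * prime_rot p \<tau> ^ d k)"
    define ct where "ct = (\<Sum>p\<in>Q. (norm (of_nat p powr (- s) :: complex))\<^sup>2)"
    have dk: "dirichlet_trig (P \<union> Q) (\<lambda>\<tau>. F \<tau> * tl k \<tau>) (Mw * ct)" if "k \<in> I" for k
      unfolding tl_def ct_def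
      by (intro dirichlet_trig_mult dF dirichlet_trig_prime_sum Q d that) (auto simp: P_def Q_def)
    have ct: "ct \<le> real N powr (1 - 2 * Re s) / (2 * Re s - 1)"
    proof -
      have "ct = (\<Sum>p\<in>Q. real p powr (- (2 * Re s)))"
        unfolding ct_def
      proof (intro sum.cong refl)
        fix p assume "p \<in> Q"
        hence "0 < p" using Q(2) prime_gt_0_nat by blast
        thus "(norm (of_nat p powr (- s) :: complex))\<^sup>2 = real p powr (- (2 * Re s))"
          by (simp add: norm_nat_powr power2_eq_square powr_add[symmetric])
      qed
      also have "\<dots> \<le> (\<Sum>p\<in>{N<..N'}. real p powr (- (2 * Re s)))" by (intro sum_mono2) (auto simp: Q_def)
      also have "\<dots> \<le> real N powr (1 - 2 * Re s) / (2 * Re s - 1)"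
        using s N by (intro sum_tail_powr_le) auto
      finally show ?thesis .
    qed
    \<comment> \<open>The scalings make any single violation cancel the weight: a rotation off by
      \<delta> gives \<open>norm ((1 - x q \<tau>) / 2) \<ge> \<delta> / 2\<close>, and a large tail
      gives \<open>norm (tl k \<tau>) \<ge> e\<close>.\<close>
    define H where "H = (\<lambda>\<tau>. (norm (F \<tau>))\<^sup>2 - (\<Sum>q\<in>P. 4 / \<delta>\<^sup>2 * (norm (F \<tau> * ((1 - x q \<tau>) / 2)))\<^sup>2)
        - (\<Sum>k\<in>I. 1 / e\<^sup>2 * (norm (F \<tau> * tl k \<tau>))\<^sup>2))"
    have Hcont: "continuous_on A H" for A
      unfolding H_def
      by (intro continuous_intros dirichlet_trig_continuous[OF dF] dirichlet_trig_continuous[OF dq] dirichlet_trig_continuous[OF dk])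
    have intH: "integral {T..2*T} H = integral {T..2*T} (\<lambda>\<tau>. (norm (F \<tau>))\<^sup>2)
        - (\<Sum>q\<in>P. 4 / \<delta>\<^sup>2 * integral {T..2*T} (\<lambda>\<tau>. (norm (F \<tau> * ((1 - x q \<tau>) / 2)))\<^sup>2))
        - (\<Sum>k\<in>I. 1 / e\<^sup>2 * integral {T..2*T} (\<lambda>\<tau>. (norm (F \<tau> * tl k \<tau>))\<^sup>2))" for T
      unfolding H_def
      by (intro integral_unique has_integral_diff has_integral_sum has_integral_mult_right integrable_integral
            integrable_continuous_real continuous_intros dirichlet_trig_continuous[OF dF] dirichlet_trig_continuous[OF dq] dirichlet_trig_continuous[OF dk] P I)
    have lim: "((\<lambda>T. integral {T..2*T} H / T) \<longlongrightarrow>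
        Mw - (\<Sum>q\<in>P. 4 / \<delta>\<^sup>2 * (Mw / (2 * real m + 2))) - (\<Sum>k\<in>I. 1 / e\<^sup>2 * (Mw * ct))) at_top"
    proof -
      have eq: "integral {T..2*T} H / T = integral {T..2*T} (\<lambda>\<tau>. (norm (F \<tau>))\<^sup>2) / T
        - (\<Sum>q\<in>P. 4 / \<delta>\<^sup>2 * (integral {T..2*T} (\<lambda>\<tau>. (norm (F \<tau> * ((1 - x q \<tau>) / 2)))\<^sup>2) / T))
        - (\<Sum>k\<in>I. 1 / e\<^sup>2 * (integral {T..2*T} (\<lambda>\<tau>. (norm (F \<tau> * tl k \<tau>))\<^sup>2) / T))" for T
        unfolding intH by (simp only: diff_divide_distrib sum_divide_distrib times_divide_eq_right)
      show ?thesis unfolding eq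
        by (intro tendsto_diff tendsto_sum tendsto_mult_left dirichlet_trig_mean[OF dF] dirichlet_trig_mean[OF dq] dirichlet_trig_mean[OF dk])
    qed
    have "Mw - (\<Sum>q\<in>P. 4 / \<delta>\<^sup>2 * (Mw / (2 * real m + 2))) - (\<Sum>k\<in>I. 1 / e\<^sup>2 * (Mw * ct)) \<ge> 3 * \<mu>"
    proof -
      have "(\<Sum>q\<in>P. 4 / \<delta>\<^sup>2 * (Mw / (2 * real m + 2))) = Mw * (4 * real (card P) / \<delta>\<^sup>2 / (2 * real m + 2))" by simp
      also have "\<dots> \<le> Mw * (1 / 5)"
      proof (intro mult_left_mono)
        have "4 * real (card P) / \<delta>\<^sup>2 \<le> 1/5 * (2 * real m + 2)"
          unfolding times_divide_eq_right[symmetric] r_def[symmetric] using m by simp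
        thus "4 * real (card P) / \<delta>\<^sup>2 / (2 * real m + 2) \<le> 1 / 5" by (subst pos_divide_le_eq) auto
      qed (use Mw in auto)
      finally have 1: "(\<Sum>q\<in>P. 4 / \<delta>\<^sup>2 * (Mw / (2 * real m + 2))) \<le> Mw * (1 / 5)" .
      have "(\<Sum>k\<in>I. 1 / e\<^sup>2 * (Mw * ct)) = Mw * (real (card I) * ct / e\<^sup>2)" by simp
      also have "\<dots> \<le> Mw * (real (card I) * (real N powr (1 - 2 * Re s) / (2 * Re s - 1)) / e\<^sup>2)"
        using ct Mw by (intro mult_left_mono divide_right_mono) auto
      also have "\<dots> \<le> Mw * (1 / 5)" using tail Mw by (intro mult_left_mono) auto
      finally show ?thesis using 1 unfolding \<mu>_def by linarith
    qed
    moreover have "2 * \<mu> < 3 * \<mu>" using Mw by (simp add: \<mu>_def)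
    ultimately have "2 * \<mu> < Mw - (\<Sum>q\<in>P. 4 / \<delta>\<^sup>2 * (Mw / (2 * real m + 2))) - (\<Sum>k\<in>I. 1 / e\<^sup>2 * (Mw * ct))" by linarith
    from order_tendstoD(1)[OF lim this] eventually_gt_at_top[of 0]
    have "\<forall>\<^sub>F T in at_top. \<forall>B G. B \<in> lmeasurable \<longrightarrow> G \<in> lmeasurable \<longrightarrow>
     B \<subseteq> {T..2*T} \<longrightarrow> G \<subseteq> {T..2*T} \<longrightarrow> measure lebesgue B \<le> \<mu> * T \<longrightarrow>
     (\<forall>\<tau>\<in>{T..2*T} - B. (\<forall>p. prime p \<and> p \<le> N \<longrightarrow> norm (prime_rot p \<tau> - v p) < \<delta>) \<longrightarrow>
        (\<forall>k\<in>I. norm (tl k \<tau>) < e) \<longrightarrow> \<tau> \<in> G) \<longrightarrow> \<mu> * T \<le> measure lebesgue G"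
    proof eventually_elim
      case (elim T)
      hence HT: "2 * \<mu> * T \<le> integral {T..2*T} H" by (simp add: field_simps)
      show ?case
      proof (intro allI impI)
        fix B G assume B: "B \<in> lmeasurable" and G: "G \<in> lmeasurable" and sub: "B \<subseteq> {T..2*T}" "G \<subseteq> {T..2*T}"
          and mB: "measure lebesgue B \<le> \<mu> * T"
          and imp: "\<forall>\<tau>\<in>{T..2*T} - B. (\<forall>p. prime p \<and> p \<le> N \<longrightarrow> norm (prime_rot p \<tau> - v p) < \<delta>) \<longrightarrow>
             (\<forall>k\<in>I. norm (tl k \<tau>) < e) \<longrightarrow> \<tau> \<in> G"
        have BI: "B \<inter> {T..2*T} = B" "G \<inter> {T..2*T} = G" using sub by auto
        have int: "indicat_real G integrable_on {T..2*T}" "indicat_real B integrable_on {T..2*T}"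
          using B G by (auto simp: integrable_on_indicator BI)
        have "integral {T..2*T} H \<le> integral {T..2*T} (\<lambda>\<tau>. indicat_real G \<tau> + indicat_real B \<tau>)"
        proof (rule integral_le)
          show "H integrable_on {T..2*T}" by (intro integrable_continuous_real Hcont)
          show "(\<lambda>\<tau>. indicat_real G \<tau> + indicat_real B \<tau>) integrable_on {T..2*T}" by (intro integrable_add int)
          fix \<tau> assume \<tau>: "\<tau> \<in> {T..2*T}"
          have nonneg: "0 \<le> (\<Sum>q\<in>P. 4 / \<delta>\<^sup>2 * (norm (F \<tau> * ((1 - x q \<tau>) / 2)))\<^sup>2)"
            "0 \<le> (\<Sum>k\<in>I. 1 / e\<^sup>2 * (norm (F \<tau> * tl k \<tau>))\<^sup>2)" by (auto intro!: sum_nonneg)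
          have "norm (f p \<tau>) \<le> 1" for p
          proof -
            have "norm (x p \<tau>) = 1" by (simp add: x_def norm_mult v)
            hence "norm ((1 + x p \<tau>) / 2) \<le> 1" using norm_triangle_ineq[of 1 "x p \<tau>"] by (simp add: norm_divide)
            thus ?thesis unfolding f_def norm_power by (intro power_le_one) auto
          qed
          hence "norm (F \<tau>) \<le> 1" unfolding F_def prod_norm[symmetric] by (intro prod_le_1) auto
          hence W1: "(norm (F \<tau>))\<^sup>2 \<le> 1" by (intro power_le_one) auto
          show "H \<tau> \<le> indicat_real G \<tau> + indicat_real B \<tau>"
          proof (cases "\<tau> \<in> G \<or> \<tau> \<in> B")
            case True
            have "H \<tau> \<le> 1" using nonneg W1 unfolding H_def by linarith
            thus ?thesis using True by (auto simp: indicator_def)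
          next
            case False
            hence "(\<exists>q. prime q \<and> q \<le> N \<and> \<delta> \<le> norm (prime_rot q \<tau> - v q)) \<or> (\<exists>k\<in>I. e \<le> norm (tl k \<tau>))"
              using imp \<tau> by (meson DiffI not_less)
            hence "H \<tau> \<le> 0"
            proof (elim disjE exE bexE)
              fix q assume "prime q \<and> q \<le> N \<and> \<delta> \<le> norm (prime_rot q \<tau> - v q)"
              hence q: "q \<in> P" "\<delta> \<le> norm (prime_rot q \<tau> - v q)" by (auto simp: P_def)
              have "cnj (v q) * v q = 1" using v[of q] complex_norm_square[of "v q"] by (simp add: mult.commute)
              hence "1 - x q \<tau> = cnj (v q) * (v q - prime_rot q \<tau>)" by (simp add: x_def right_diff_distrib)
              hence "norm (1 - x q \<tau>) = norm (prime_rot q \<tau> - v q)" by (simp add: norm_mult v norm_minus_commute)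
              hence "\<delta>\<^sup>2 \<le> (norm (1 - x q \<tau>))\<^sup>2" using q \<delta> by (intro power_mono) auto
              hence "1 \<le> (norm (1 - x q \<tau>))\<^sup>2 / \<delta>\<^sup>2" using \<delta> by simp
              hence "(norm (F \<tau>))\<^sup>2 * 1 \<le> (norm (F \<tau>))\<^sup>2 * ((norm (1 - x q \<tau>))\<^sup>2 / \<delta>\<^sup>2)" by (intro mult_left_mono) auto
              also have "\<dots> = 4 / \<delta>\<^sup>2 * (norm (F \<tau> * ((1 - x q \<tau>) / 2)))\<^sup>2"
                by (simp add: norm_mult norm_divide power_mult_distrib power_divide)
              also have "\<dots> \<le> (\<Sum>q\<in>P. 4 / \<delta>\<^sup>2 * (norm (F \<tau> * ((1 - x q \<tau>) / 2)))\<^sup>2)"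
                using P q by (intro member_le_sum) auto
              finally show ?thesis using nonneg unfolding H_def by linarith
            next
              fix k assume k: "k \<in> I" "e \<le> norm (tl k \<tau>)"
              have "e\<^sup>2 \<le> (norm (tl k \<tau>))\<^sup>2" using k e by (intro power_mono) auto
              hence "1 \<le> (norm (tl k \<tau>))\<^sup>2 / e\<^sup>2" using e by simp
              hence "(norm (F \<tau>))\<^sup>2 * 1 \<le> (norm (F \<tau>))\<^sup>2 * ((norm (tl k \<tau>))\<^sup>2 / e\<^sup>2)" by (intro mult_left_mono) auto
              also have "\<dots> = 1 / e\<^sup>2 * (norm (F \<tau> * tl k \<tau>))\<^sup>2"
                by (simp add: norm_mult power_mult_distrib)
              also have "\<dots> \<le> (\<Sum>k\<in>I. 1 / e\<^sup>2 * (norm (F \<tau> * tl k \<tau>))\<^sup>2)"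
                using I k by (intro member_le_sum) auto
              finally show ?thesis using nonneg unfolding H_def by linarith
            qed
            thus ?thesis by (simp add: indicator_def)
          qed
        qed
        also have "\<dots> = measure lebesgue G + measure lebesgue B"
          using Henstock_Kurzweil_Integration.integral_add[OF int] B G BI
          by (simp add: Equivalence_Lebesgue_Henstock_Integration.integral_indicator)
        finally show "\<mu> * T \<le> measure lebesgue G" using HT mB by linarith
      qed
    qed
    thus "\<forall>\<^sub>F T in at_top. \<forall>B G. B \<in> lmeasurable \<longrightarrow> G \<in> lmeasurable \<longrightarrow>
     B \<subseteq> {T..2*T} \<longrightarrow> G \<subseteq> {T..2*T} \<longrightarrow> measure lebesgue B \<le> \<mu> * T \<longrightarrow>
     (\<forall>\<tau>\<in>{T..2*T} - B. (\<forall>p. prime p \<and> p \<le> N \<longrightarrow> norm (prime_rot p \<tau> - v p) < \<delta>) \<longrightarrow>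
        (\<forall>k\<in>I. norm (\<Sum>p\<in>{p. prime p \<and> N < p \<and> p \<le> N'}. of_nat p powr (- s) * prime_rot p \<tau> ^ d k) < e) \<longrightarrow> \<tau> \<in> G) \<longrightarrow>
     \<mu> * T \<le> measure lebesgue G"
      unfolding tl_def Q_def .
  qed
qed

section \<open>The continuous branch of log zeta\<close>

text \<open>The logarithms of 1 are spaced by \<open>2 * pi\<close>, so a continuous choice is
  constant on a connected set, and one value of norm below \<open>2 * pi\<close> identifies it as
  0.\<close>

lemma exp_eq_1_imp_zero:
  fixes D :: "'a::topological_space \<Rightarrow> complex"
  assumes S: "connected S" and cont: "continuous_on S D" and ex: "\<And>x. x \<in> S \<Longrightarrow> exp (D x) = 1"
    and x1: "x1 \<in> S" "norm (D x1) < 2 * pi" and x: "x \<in> S"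
  shows "D x = 0"
proof -
  have sep: "c = 0 \<or> 2 * pi \<le> norm c" if "exp c = 1" for c :: complex
  proof -
    obtain n :: int where n: "Re c = 0" "Im c = of_int (2 * n) * pi" using \<open>exp c = 1\<close> unfolding exp_eq_1 by blast
    show ?thesis
    proof (cases "n = 0")
      case False
      hence "1 \<le> \<bar>real_of_int n\<bar>" by linarith
      hence "2 * pi \<le> \<bar>Im c\<bar>" unfolding n(2) by (simp add: abs_mult)
      thus ?thesis using abs_Im_le_cmod[of c] by linarith
    qed (use n in \<open>auto simp: complex_eq_iff\<close>)
  qed
  have "D constant_on S"
  proof (rule continuous_discrete_range_constant[OF S cont])
    fix x assume x: "x \<in> S"
    show "\<exists>e>0. \<forall>y. y \<in> S \<and> D y \<noteq> D x \<longrightarrow> e \<le> norm (D y - D x)"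
    proof (intro exI[of _ "2 * pi"] conjI allI impI)
      fix y assume y: "y \<in> S \<and> D y \<noteq> D x"
      have "exp (D y - D x) = 1" using ex x y by (simp add: exp_diff)
      from sep[OF this] show "2 * pi \<le> norm (D y - D x)" using y by auto
    qed auto
  qed
  then obtain c where c: "\<And>x. x \<in> S \<Longrightarrow> D x = c" by (auto simp: constant_on_def)
  have "exp c = 1" using ex[OF x1(1)] c[OF x1(1)] by simp
  hence "c = 0" using sep[of c] x1 c[OF x1(1)] by auto
  thus ?thesis using c[OF x] by simp
qed

lemma continuous_on_log_zeta_series_line:
  "continuous_on {x. 1 < x} (\<lambda>x. log_zeta_series (Complex x y))"
  by (rule continuous_on_compose2[OF holomorphic_on_imp_continuous_on[OF log_zeta_series_holomorphic]])
     (auto intro!: continuous_intros)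

text \<open>Agreement with the series has to be tested only approximately and at one point, because
  two continuous logarithms differ by a constant multiple of \<open>2 * pi * \<i>\<close>.\<close>

lemma log_zeta_branchI:
  assumes L: "continuous_on {\<sigma>..} L" "\<And>x. \<sigma> \<le> x \<Longrightarrow> exp (L x) = zeta (Complex x y)"
    and x1: "1 < x1" "\<sigma> \<le> x1" "norm (L x1 - log_zeta_series (Complex x1 y)) < 2 * pi"
  shows "log_zeta_branch (Complex \<sigma> y) L"
proof -
  have "L x - log_zeta_series (Complex x y) = 0" if x: "\<sigma> \<le> x" "1 < x" for x
  proof (rule exp_eq_1_imp_zero[where S = "{\<sigma>..} \<inter> {1<..}" and D = "\<lambda>x. L x - log_zeta_series (Complex x y)" and ?x1.0 = x1])
    show "connected ({\<sigma>..} \<inter> {1<..} :: real set)"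
      by (intro convex_connected convex_Int convex_real_interval)
    show "continuous_on ({\<sigma>..} \<inter> {1<..}) (\<lambda>x. L x - log_zeta_series (Complex x y))"
      by (intro continuous_intros continuous_on_subset[OF L(1)] continuous_on_subset[OF continuous_on_log_zeta_series_line]) auto
    fix u assume u: "u \<in> {\<sigma>..} \<inter> {1<..}"
    have "exp (log_zeta_series (Complex u y)) = zeta (Complex u y)" using u by (intro exp_log_zeta_series) auto
    moreover have "exp (L u) = zeta (Complex u y)" using u L(2) by auto
    moreover have "zeta (Complex u y) \<noteq> 0" using u by (intro zeta_nonzero) auto
    ultimately show "exp (L u - log_zeta_series (Complex u y)) = 1" by (simp add: exp_diff)
  qed (use x x1 in auto)
  thus ?thesis using L by (simp add: log_zeta_branch_def)
qed

text \<open>The segment up to abscissa 2 is compact and has positive distance from the zeros and the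
  pole, and there are none to the right of 1. Hence a thin convex strip carries a holomorphic
  logarithm of zeta, which gives local continuity of \<open>log_zeta\<close> in the
  ordinate.\<close>

lemma log_zeta_strip:
  assumes y0: "y0 \<noteq> 0" and nz: "\<And>x. \<sigma> \<le> x \<Longrightarrow> zeta (Complex x y0) \<noteq> 0" and \<sigma>: "\<sigma> \<le> 1"
  obtains \<delta> g where "0 < \<delta>" "continuous_on {y. \<bar>y - y0\<bar> < \<delta>} g"
    "\<And>y x. \<bar>y - y0\<bar> < \<delta> \<Longrightarrow> \<sigma> \<le> x \<Longrightarrow> zeta (Complex x y) \<noteq> 0"
    "\<And>y. \<bar>y - y0\<bar> < \<delta> \<Longrightarrow> log_zeta (Complex \<sigma> y) = g y"
proof -
  let ?Z = "{w. zeta w = 0} \<union> {1}"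
  have "open ((- {1}) \<inter> zeta -` (- {0}))"
    by (intro continuous_open_preimage holomorphic_on_imp_continuous_on[OF holomorphic_zeta]) auto
  moreover have "- ?Z = (- {1}) \<inter> zeta -` (- {0})" by auto
  ultimately have clZ: "closed ?Z" by (metis closed_def)
  define K where "K = (\<lambda>x. Complex x y0) ` {\<sigma>..2}"
  have K: "compact K" unfolding K_def by (intro compact_continuous_image continuous_intros) auto
  have "K \<inter> ?Z = {}"
  proof -
    have "Complex x y0 \<noteq> 1" for x using y0 by (auto simp: complex_eq_iff)
    thus ?thesis using nz by (auto simp: K_def)
  qed
  from separate_compact_closed[OF K clZ this]
  obtain e where e: "0 < e" "\<And>u w. u \<in> K \<Longrightarrow> w \<in> ?Z \<Longrightarrow> e \<le> dist u w" by blast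
  define \<delta> where "\<delta> = e / 2"
  have \<delta>: "0 < \<delta>" using e by (simp add: \<delta>_def)
  define \<Omega> where "\<Omega> = {w. \<sigma> - \<delta> < Re w} \<inter> ({w. y0 - \<delta> < Im w} \<inter> {w. Im w < y0 + \<delta>})"
  have \<Omega>: "open \<Omega>" "convex \<Omega>"
    unfolding \<Omega>_def by (auto intro!: open_Int convex_Int simp: open_halfspace_Re_gt open_halfspace_Im_gt
      open_halfspace_Im_lt convex_halfspace_Re_gt convex_halfspace_Im_gt convex_halfspace_Im_lt)
  have notZ: "w \<notin> ?Z" if w: "w \<in> \<Omega>" for w
  proof (cases "1 < Re w")
    case True
    thus ?thesis using zeta_nonzero[of w] by auto
  next
    case False
    \<comment> \<open>A nearby point of the segment; the maximum is there because the open strip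
      extends slightly to the left of \<sigma>.\<close>
    let ?u = "Complex (max \<sigma> (Re w)) y0"
    have u: "?u \<in> K" using False \<sigma> by (auto simp: K_def)
    have "dist ?u w \<le> \<bar>Re (?u - w)\<bar> + \<bar>Im (?u - w)\<bar>" unfolding dist_norm by (rule cmod_le)
    also have "\<dots> < \<delta> + \<delta>" using w by (auto simp: \<Omega>_def)
    finally show ?thesis using e(2)[OF u, of w] by (auto simp: \<delta>_def)
  qed
  have hol: "zeta holomorphic_on \<Omega>" by (rule holomorphic_on_subset[OF holomorphic_zeta]) (use notZ in auto)
  obtain g where g: "g holomorphic_on \<Omega>" "\<And>w. w \<in> \<Omega> \<Longrightarrow> zeta w = exp (g w)"
    using contractible_imp_holomorphic_log[OF hol convex_imp_contractible[OF \<Omega>(2)]] notZ by blast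
  define w1 where "w1 = Complex 2 y0"
  have w1: "w1 \<in> \<Omega>" "1 < Re w1" using \<sigma> \<delta> by (auto simp: w1_def \<Omega>_def)
  \<comment> \<open>Subtracting this multiple of \<open>2 * pi * \<i>\<close> preserves the
    logarithm and matches it with the series.\<close>
  define c where "c = g w1 - log_zeta_series w1"
  have expc: "exp c = 1"
    using g(2)[OF w1(1)] exp_log_zeta_series[OF w1(2)] zeta_nonzero[OF w1(2)] by (simp add: c_def exp_diff)
  define h where "h = (\<lambda>w. g w - c)"
  have h: "continuous_on \<Omega> h" "\<And>w. w \<in> \<Omega> \<Longrightarrow> exp (h w) = zeta w"
    using g(2) expc unfolding h_def
    by (intro continuous_intros holomorphic_on_imp_continuous_on[OF g(1)], simp add: exp_diff)
  have hs: "h w - log_zeta_series w = 0" if w: "w \<in> \<Omega>" "1 < Re w" for w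
  proof (rule exp_eq_1_imp_zero[where S = "\<Omega> \<inter> {w. 1 < Re w}" and D = "\<lambda>w. h w - log_zeta_series w" and ?x1.0 = w1])
    show "connected (\<Omega> \<inter> {w. 1 < Re w})"
      by (intro convex_connected convex_Int \<Omega> convex_halfspace_Re_gt)
    show "continuous_on (\<Omega> \<inter> {w. 1 < Re w}) (\<lambda>w. h w - log_zeta_series w)"
      by (intro continuous_intros continuous_on_subset[OF h(1)]
           continuous_on_subset[OF holomorphic_on_imp_continuous_on[OF log_zeta_series_holomorphic]]) auto
    fix u assume u: "u \<in> \<Omega> \<inter> {w. 1 < Re w}"
    show "exp (h u - log_zeta_series u) = 1"
      using u h(2)[of u] exp_log_zeta_series[of u] zeta_nonzero[of u] by (simp add: exp_diff)
  qed (use w w1 in \<open>auto simp: h_def c_def\<close>)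
  show ?thesis
  proof (rule that[OF \<delta>, of "\<lambda>y. h (Complex \<sigma> y)"])
    have in\<Omega>: "Complex x y \<in> \<Omega>" if "\<bar>y - y0\<bar> < \<delta>" "\<sigma> \<le> x" for x y
      using that \<delta> by (auto simp: \<Omega>_def)
    show "continuous_on {y. \<bar>y - y0\<bar> < \<delta>} (\<lambda>y. h (Complex \<sigma> y))"
      by (rule continuous_on_compose2[OF h(1)]) (auto intro!: continuous_intros in\<Omega>)
    fix y assume y: "\<bar>y - y0\<bar> < \<delta>"
    show "zeta (Complex x y) \<noteq> 0" if "\<sigma> \<le> x" for x using notZ[OF in\<Omega>[OF y that]] by auto
    have "log_zeta_branch (Complex \<sigma> y) (\<lambda>x. h (Complex x y))"
    proof (rule log_zeta_branchI[of _ _ _ 2])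
      show "continuous_on {\<sigma>..} (\<lambda>x. h (Complex x y))"
        by (rule continuous_on_compose2[OF h(1)]) (auto intro!: continuous_intros in\<Omega> y)
      show "exp (h (Complex x y)) = zeta (Complex x y)" if "\<sigma> \<le> x" for x
        using h(2)[OF in\<Omega>[OF y that]] .
      show "norm (h (Complex 2 y) - log_zeta_series (Complex 2 y)) < 2 * pi"
        using hs[OF in\<Omega>[OF y, of 2]] \<sigma> by simp
    qed (use \<sigma> in auto)
    from log_zeta_eqI[OF this] show "log_zeta (Complex \<sigma> y) = h (Complex \<sigma> y)" by simp
  qed
qed

text \<open>Openness supplies the measurability of the set of hits, although \<open>log_zeta\<close>
  need not be continuous across ordinates of zeros.\<close>

lemma log_zeta_close_open:
  assumes \<sigma>: "\<sigma> \<le> 1"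
  shows "open {y. 0 < y \<and> (\<forall>x\<ge>\<sigma>. zeta (Complex x y) \<noteq> 0) \<and> norm (log_zeta (Complex \<sigma> y) - z) < \<epsilon>}" (is "open ?Y")
proof (rule openI)
  fix y0 assume y0: "y0 \<in> ?Y"
  obtain \<delta> g where g: "0 < \<delta>" "continuous_on {y. \<bar>y - y0\<bar> < \<delta>} g"
    "\<And>y x. \<bar>y - y0\<bar> < \<delta> \<Longrightarrow> \<sigma> \<le> x \<Longrightarrow> zeta (Complex x y) \<noteq> 0"
    "\<And>y. \<bar>y - y0\<bar> < \<delta> \<Longrightarrow> log_zeta (Complex \<sigma> y) = g y"
  proof (rule log_zeta_strip[of y0 \<sigma>])
    show "y0 \<noteq> 0" using y0 by auto
    show "zeta (Complex x y0) \<noteq> 0" if "\<sigma> \<le> x" for x using y0 that by auto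
  qed (use \<sigma> in auto)
  have ball: "{y. \<bar>y - y0\<bar> < \<delta>} = ball y0 \<delta>" by (auto simp: dist_real_def)
  let ?W = "ball y0 \<delta> \<inter> (\<lambda>y. norm (g y - z)) -` {..<\<epsilon>}"
  have "continuous_on (ball y0 \<delta>) (\<lambda>y. norm (g y - z))"
    using g(2) unfolding ball by (intro continuous_intros)
  hence "open ?W" by (intro continuous_open_preimage) auto
  hence "open (?W \<inter> {0<..})" by auto
  moreover have "y0 \<in> ?W \<inter> {0<..}" using y0 g(1) g(4)[of y0] by auto
  moreover have "?W \<inter> {0<..} \<subseteq> ?Y" using g(3,4) by (auto simp: dist_real_def abs_minus_commute)
  ultimately show "\<exists>e>0. ball y0 e \<subseteq> ?Y" by (meson open_contains_ball order_trans)
qed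

text \<open>A nonconstant holomorphic function on a connected domain has countably many zeros. A
  constant value would have to be 1, the limit along the real axis, whereas \<open>zeta 2\<close>
  has norm at least 5/4.\<close>

lemma countable_zeta_zeros: "countable {w. w \<noteq> 1 \<and> zeta w = 0}"
proof -
  have "\<not> zeta constant_on - {1}"
  proof
    assume "zeta constant_on - {1}"
    then obtain c where c: "\<And>w. w \<noteq> 1 \<Longrightarrow> zeta w = c" by (auto simp: constant_on_def)
    \<comment> \<open>At level 1 there is no prime to remove, so \<open>sifted_zeta 1\<close> is
      \<open>zeta\<close> itself.\<close>
    have "norm (c - 1) \<le> 1 / (x - 1)" if "1 < x" for x :: real
      using norm_sifted_zeta_minus_1_le[of "of_real x" 1] that c[of "of_real x"] zero_neq_one
      by (simp add: sifted_zeta_def euler_prod_Suc[of 0, simplified])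
    hence "norm (c - 1) \<le> 1 / (1 / e)" if "0 < e" for e using that by (metis add_diff_cancel_left' less_add_same_cancel1 zero_less_divide_1_iff)
    hence "norm (c - 1) \<le> e" if "0 < e" for e using that by fastforce
    hence "norm (c - 1) \<le> 0" by (meson field_le_epsilon add_increasing order_refl field_lbound_gt_zero leI not_le dense_ge)
    hence c1: "c = 1" by simp
    have "1 + (1/4 :: real) \<le> norm (zeta 2)"
    proof -
      have "(\<lambda>n. real (Suc n) powr (- 2)) sums (\<Sum>n. real (Suc n) powr (- 2))"
        using summable_Suc_iff[of "\<lambda>n. real n powr (- 2)"] by (simp add: summable_real_powr_iff summable_sums)
      hence "(\<lambda>n. complex_of_real (real (Suc n) powr (- 2))) sums of_real (\<Sum>n. real (Suc n) powr (- 2))"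
        by (rule sums_of_real)
      moreover have "complex_of_real (real (Suc n) powr (- 2)) = of_nat (Suc n) powr (- 2)" for n
        using powr_of_real[of "real (Suc n)" "- 2"] by simp
      ultimately have "zeta 2 = of_real (\<Sum>n. real (Suc n) powr (- 2))"
        using zeta_eq_series[of 2] by (simp add: sums_iff)
      moreover have "(\<Sum>n<2. real (Suc n) powr (- 2)) \<le> (\<Sum>n. real (Suc n) powr (- 2))"
        using summable_Suc_iff[of "\<lambda>n. real n powr (- 2)"] by (intro sum_le_suminf) (auto simp: summable_real_powr_iff)
      moreover have "(\<Sum>n<2. real (Suc n) powr (- 2)) = 1 + 1/4"
        by (simp add: numeral_2_eq_2 powr_minus powr_numeral)
      ultimately show ?thesis by simp
    qed
    thus False using c[of 2] c1 by simp
  qed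
  hence "countable {w \<in> - {1}. zeta w = 0}"
  proof (intro holomorphic_countable_zeros holomorphic_zeta connected_punctured_universe)
    have "fsigma (\<Union>n::nat. - ball (1::complex) (1 / real (Suc n)))" by (rule fsigma.intros) auto
    also have "(\<Union>n::nat. - ball (1::complex) (1 / real (Suc n))) = - {1}"
    proof (intro equalityI subsetI)
      fix w :: complex assume "w \<in> - {1}"
      hence "0 < dist 1 w" by auto
      then obtain n where "1 / real (Suc n) < dist 1 w" using nat_approx_posE by blast
      thus "w \<in> (\<Union>n::nat. - ball 1 (1 / real (Suc n)))" by (auto intro!: exI[of _ n])
    qed auto
    finally show "fsigma (- {1::complex})" .
  qed auto
  thus ?thesis by (rule countable_subset[rotated]) auto
qed

section \<open>Positive lower density\<close>

lemma one_minus_not_nonpos: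
  fixes u :: complex
  assumes "norm u < 1"
  shows "1 - u \<notin> \<real>\<^sub>\<le>\<^sub>0"
proof -
  have "Re u < 1" using assms complex_Re_le_cmod[of u] by linarith
  thus ?thesis by (auto simp: complex_nonpos_Reals_iff)
qed

text \<open>Near 1 the principal logarithm of \<open>sifted_zeta\<close> is continuous along the
  whole half-line, and adding \<open>prime_log_sum\<close> makes it a logarithm of zeta. At abscissa
  2 it differs from the series by at most \<open>1/2 + 2 < 2 * pi\<close>, so it is the right
  branch.\<close>

lemma log_zeta_approx_prime_log_sum:
  assumes \<sigma>: "0 < \<sigma>" "\<sigma> \<le> 1" and y: "y \<noteq> 0" and N: "1 \<le> N" and \<eta>: "\<eta> \<le> 1/4"
    and close: "\<And>x. \<sigma> \<le> x \<Longrightarrow> norm (sifted_zeta N (Complex x y) - 1) < \<eta>"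
  shows "\<sigma> \<le> x \<Longrightarrow> zeta (Complex x y) \<noteq> 0"
    and "norm (log_zeta (Complex \<sigma> y) - prime_log_sum N (Complex \<sigma> y)) \<le> 2 * \<eta>"
proof -
  have lnb: "norm (Ln (sifted_zeta N (Complex x y))) \<le> 2 * \<eta>" if "\<sigma> \<le> x" for x
  proof -
    have "norm (Ln (1 + (sifted_zeta N (Complex x y) - 1))) \<le> 2 * norm (sifted_zeta N (Complex x y) - 1)"
      using close[OF that] \<eta> by (intro norm_Ln_le) linarith
    thus ?thesis using close[OF that] by simp
  qed
  have pos: "sifted_zeta N (Complex x y) \<notin> \<real>\<^sub>\<le>\<^sub>0" if "\<sigma> \<le> x" for x
    using one_minus_not_nonpos[of "- (sifted_zeta N (Complex x y) - 1)"] close[OF that] \<eta> by (auto simp: norm_minus_commute)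
  have nz: "sifted_zeta N (Complex x y) \<noteq> 0" if "\<sigma> \<le> x" for x using pos[OF that] by auto
  thus "\<sigma> \<le> x \<Longrightarrow> zeta (Complex x y) \<noteq> 0" by (auto simp: sifted_zeta_def)
  define L where "L = (\<lambda>x. Ln (sifted_zeta N (Complex x y)) + prime_log_sum N (Complex x y))"
  have "log_zeta_branch (Complex \<sigma> y) L"
  proof (rule log_zeta_branchI[of _ _ _ 2])
    have zc: "continuous_on {\<sigma>..} (\<lambda>x. zeta (Complex x y))"
      by (rule continuous_on_compose2[OF holomorphic_on_imp_continuous_on[OF holomorphic_zeta]])
         (use y in \<open>auto intro!: continuous_intros simp: complex_eq_iff\<close>)
    have pc: "continuous_on {\<sigma>..} (\<lambda>x. of_nat p powr (- Complex x y))" for p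
      by (cases "p = 0") (auto intro!: continuous_intros simp: powr_def)
    show "continuous_on {\<sigma>..} L"
      unfolding L_def
    proof (intro continuous_on_add continuous_on_Ln')
      show "continuous_on {\<sigma>..} (\<lambda>x. sifted_zeta N (Complex x y))"
        unfolding sifted_zeta_def euler_prod_def by (intro continuous_intros zc pc)
      show "continuous_on {\<sigma>..} (\<lambda>x. prime_log_sum N (Complex x y))"
        unfolding prime_log_sum_def
      proof (intro continuous_on_sum continuous_on_minus continuous_on_Ln' continuous_on_diff continuous_on_const pc)
        fix p x assume "p \<in> {p. prime p \<and> p \<le> N}" "x \<in> {\<sigma>..}"
        thus "1 - of_nat p powr (- Complex x y) \<notin> \<real>\<^sub>\<le>\<^sub>0"
          using \<sigma> by (intro one_minus_not_nonpos prime_powr_norm_less_1) auto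
      qed
    qed (use pos in auto)
    show "exp (L x) = zeta (Complex x y)" if x: "\<sigma> \<le> x" for x
      using exp_prime_log_sum(1)[of "Complex x y" N] \<sigma> x nz[OF x]
      by (simp add: L_def exp_add exp_Ln sifted_zeta_def mult_ac)
    have "norm (L 2 - log_zeta_series (Complex 2 y)) \<le>
        norm (Ln (sifted_zeta N (Complex 2 y))) + norm (log_zeta_series (Complex 2 y) - prime_log_sum N (Complex 2 y))"
      unfolding L_def using norm_triangle_ineq4[of "Ln (sifted_zeta N (Complex 2 y))" "log_zeta_series (Complex 2 y) - prime_log_sum N (Complex 2 y)"]
      by (simp add: algebra_simps)
    also have "\<dots> \<le> 2 * \<eta> + 2 * (real N powr (- 1) / 1)"
      using lnb[of 2] \<sigma> norm_log_zeta_series_minus_prime_log_sum_le[of "Complex 2 y" N] N by simp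
    also have "\<dots> \<le> 1 / 2 + 2"
    proof -
      have "real N powr (- 1) \<le> real N powr 0" using N by (intro powr_mono) auto
      also have "\<dots> = 1" using N by simp
      finally show ?thesis using \<eta> by linarith
    qed
    also have "\<dots> < 2 * pi" using pi_gt3 by simp
    finally show "norm (L 2 - log_zeta_series (Complex 2 y)) < 2 * pi" .
  qed (use \<sigma> in auto)
  from log_zeta_eqI[OF this] show "norm (log_zeta (Complex \<sigma> y) - prime_log_sum N (Complex \<sigma> y)) \<le> 2 * \<eta>"
    using lnb[of \<sigma>] by (simp add: L_def)
qed

text \<open>This is why the shifts by different multiples of \<tau> are governed by powers of the
  same rotation at each prime.\<close>

lemma nat_powr_shift:
  assumes "0 < p"
  shows "of_nat p powr (- (s + \<i> * of_nat d * of_real \<tau>)) = of_nat p powr (- s) * prime_rot p \<tau> ^ d"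
proof -
  have "prime_rot p \<tau> ^ d = exp (\<i> * of_real (real d * (\<tau> * - ln (real p))))"
    by (simp only: prime_rot_def Complex.DeMoivre) (simp only: cis_conv_exp)
  moreover have "- (s + \<i> * of_nat d * of_real \<tau>) * of_real (ln (real p)) =
      - s * of_real (ln (real p)) + \<i> * of_real (real d * (\<tau> * - ln (real p)))"
    by (simp add: algebra_simps)
  ultimately show ?thesis using assms by (simp add: powr_def exp_add[symmetric])
qed

lemma prime_log_sum_continuous_at_units:
  fixes v :: "nat \<Rightarrow> complex"
  assumes I: "finite I" and v: "\<And>p. norm (v p) = 1" and s: "0 < Re s" and e: "0 < e"
  obtains \<delta> where "0 < \<delta>" "\<And>u k. (\<forall>p. prime p \<and> p \<le> N \<longrightarrow> norm (u p - v p) < \<delta>) \<Longrightarrow> k \<in> I \<Longrightarrow>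
    norm ((\<Sum>p\<in>{p. prime p \<and> p \<le> N}. - Ln (1 - of_nat p powr (- s) * u p ^ d k)) -
          (\<Sum>p\<in>{p. prime p \<and> p \<le> N}. - Ln (1 - of_nat p powr (- s) * v p ^ d k))) < e"
proof -
  define P where "P = {p. prime p \<and> p \<le> N}"
  have P: "finite P" by (simp add: P_def)
  let ?f = "\<lambda>p k u. - Ln (1 - of_nat p powr (- s) * u ^ d k)"
  \<comment> \<open>The \<open>+ 1\<close> in the share of each prime covers an empty
    \<open>P\<close> and keeps the total strictly below \<open>e\<close>.\<close>
  have "\<forall>\<^sub>F \<delta> in at_right 0. \<forall>k\<in>I. \<forall>p\<in>P. \<forall>u. norm (u - v p) < \<delta> \<longrightarrow> norm (?f p k u - ?f p k (v p)) < e / (real (card P) + 1)"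
  proof (intro eventually_ball_finite[OF I] eventually_ball_finite[OF P] ballI)
    fix k p assume kp: "k \<in> I" "p \<in> P"
    have "norm (of_nat p powr (- s) * v p ^ d k) < 1"
      using prime_powr_norm_less_1[of p s] kp s by (simp add: P_def norm_mult norm_power v)
    hence "isCont (?f p k) (v p)"
      by (intro continuous_intros isCont_Ln' one_minus_not_nonpos)
    moreover have "0 < e / (real (card P) + 1)" using e by simp
    ultimately obtain \<delta> where \<delta>: "0 < \<delta>" "\<And>u. norm (u - v p) < \<delta> \<Longrightarrow> norm (?f p k u - ?f p k (v p)) < e / (real (card P) + 1)"
      unfolding continuous_at_eps_delta dist_norm by metis
    show "\<forall>\<^sub>F \<delta> in at_right 0. \<forall>u. norm (u - v p) < \<delta> \<longrightarrow> norm (?f p k u - ?f p k (v p)) < e / (real (card P) + 1)"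
      by (rule eventually_at_rightI[of 0 \<delta>]) (use \<delta> in auto)
  qed
  moreover have "\<forall>\<^sub>F \<delta> in at_right 0. (0::real) < \<delta>" by (rule eventually_at_right_less)
  ultimately have "\<forall>\<^sub>F \<delta> in at_right 0. 0 < \<delta> \<and> (\<forall>k\<in>I. \<forall>p\<in>P. \<forall>u. norm (u - v p) < \<delta> \<longrightarrow> norm (?f p k u - ?f p k (v p)) < e / (real (card P) + 1))"
    by eventually_elim auto
  then obtain \<delta> where \<delta>: "0 < \<delta>" "\<And>k p u. k \<in> I \<Longrightarrow> p \<in> P \<Longrightarrow> norm (u - v p) < \<delta> \<Longrightarrow> norm (?f p k u - ?f p k (v p)) < e / (real (card P) + 1)"
    using eventually_happens'[OF trivial_limit_at_right_real] by blast
  show ?thesis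
  proof (rule that[OF \<delta>(1)])
    fix u k assume u: "\<forall>p. prime p \<and> p \<le> N \<longrightarrow> norm (u p - v p) < \<delta>" and k: "k \<in> I"
    have "norm ((\<Sum>p\<in>P. ?f p k (u p)) - (\<Sum>p\<in>P. ?f p k (v p))) \<le> (\<Sum>p\<in>P. e / (real (card P) + 1))"
      unfolding sum_subtractf[symmetric]
      by (rule sum_norm_le) (use \<delta>(2)[OF k] u in \<open>auto simp: P_def intro: less_imp_le\<close>)
    also have "\<dots> < e" using e by (simp add: field_simps)
    finally show "norm ((\<Sum>p\<in>{p. prime p \<and> p \<le> N}. ?f p k (u p)) - (\<Sum>p\<in>{p. prime p \<and> p \<le> N}. ?f p k (v p))) < e"
      by (simp only: P_def)
  qed
qed

lemma measure_affine_preimage: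
  fixes B :: "real set" and d t :: real
  assumes B: "B \<in> sets lebesgue" "B \<subseteq> {a..b}" and d: "0 < d"
  shows "{\<tau>. t + d * \<tau> \<in> B} \<in> lmeasurable" "measure lebesgue {\<tau>. t + d * \<tau> \<in> B} = measure lebesgue B / d"
proof -
  have eq: "{\<tau>. t + d * \<tau> \<in> B} = (\<lambda>y. (1 / d) *\<^sub>R y + (- t / d)) ` B"
  proof (intro equalityI subsetI)
    fix \<tau> assume "\<tau> \<in> {\<tau>. t + d * \<tau> \<in> B}"
    moreover have "\<tau> = (1 / d) *\<^sub>R (t + d * \<tau>) + (- t / d)" using d by (simp add: field_simps)
    ultimately show "\<tau> \<in> (\<lambda>y. (1 / d) *\<^sub>R y + (- t / d)) ` B" by blast
  qed (use d in \<open>auto simp: field_simps\<close>)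
  show "measure lebesgue {\<tau>. t + d * \<tau> \<in> B} = measure lebesgue B / d"
    unfolding eq measure_lebesgue_affine using d by simp
  have "(+) (- t) ` B \<in> sets lebesgue" using B(1) by (rule lebesgue_sets_translation)
  from measurable_sets[OF lebesgue_measurable_scaling this, of d]
  have "((*\<^sub>R) d) -` ((+) (- t) ` B) \<inter> space lebesgue \<in> sets lebesgue" .
  moreover have "((*\<^sub>R) d) -` ((+) (- t) ` B) \<inter> space lebesgue = {\<tau>. t + d * \<tau> \<in> B}"
  proof (intro equalityI subsetI)
    fix \<tau> assume "\<tau> \<in> {\<tau>. t + d * \<tau> \<in> B}"
    moreover have "d *\<^sub>R \<tau> = - t + (t + d * \<tau>)" by simp
    ultimately have "d *\<^sub>R \<tau> \<in> (+) (- t) ` B" by blast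
    thus "\<tau> \<in> ((*\<^sub>R) d) -` ((+) (- t) ` B) \<inter> space lebesgue" by simp
  qed auto
  ultimately have "{\<tau>. t + d * \<tau> \<in> B} \<in> sets lebesgue" by simp
  moreover have "bounded {\<tau>. t + d * \<tau> \<in> B}"
  proof (rule bounded_subset[of "{(a - t) / d..(b - t) / d}"])
    show "{\<tau>. t + d * \<tau> \<in> B} \<subseteq> {(a - t) / d..(b - t) / d}"
      using B(2) d by (auto simp: field_simps)
  qed auto
  ultimately show "{\<tau>. t + d * \<tau> \<in> B} \<in> lmeasurable"
    by (simp add: bounded_set_imp_lmeasurable)
qed

text \<open>The values of \<open>\<tau>\<close> at which all targets are met, apart from the countably many \<open>\<tau>\<close>
  that the condition \<open>log_zeta_domain\<close> excludes; in contrast to the latter set this one is open.\<close>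

definition hits :: "complex \<Rightarrow> (nat \<Rightarrow> nat) \<Rightarrow> (nat \<Rightarrow> complex) \<Rightarrow> nat set \<Rightarrow> real \<Rightarrow> real set" where
  "hits s d z I \<epsilon> = (\<Inter>k\<in>I. (\<lambda>\<tau>. Im s + real (d k) * \<tau>) -`
     {y. 0 < y \<and> (\<forall>x\<ge>Re s. zeta (Complex x y) \<noteq> 0) \<and> norm (log_zeta (Complex (Re s) y) - z k) < \<epsilon>})"

lemma open_hits:
  assumes "finite I" "Re s \<le> 1"
  shows "open (hits s d z I \<epsilon>)"
  unfolding hits_def using assms
  by (intro open_INT ballI open_vimage log_zeta_close_open) (auto intro!: continuous_intros)

lemma shift_Complex: "s + \<i> * of_nat d * of_real \<tau> = Complex (Re s) (Im s + real d * \<tau>)"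
  by (simp add: complex_eq_iff)

text \<open>The choices follow the order \<open>v\<close>, \<open>N\<close>, \<delta>, \<mu>,
  \<open>N'\<close>. The level \<open>N\<close> fixes the weight and makes all later primes
  negligible; only then is \<open>N'\<close> taken so large that the exceptional sets are small
  compared with \<mu>.\<close>

lemma hits_density:
  fixes d :: "nat \<Rightarrow> nat"
  assumes I: "finite I" "I \<noteq> {}" and d: "inj_on d I" "\<And>k. k \<in> I \<Longrightarrow> 0 < d k"
    and s: "1/2 < Re s" "Re s \<le> 1" "0 < Im s" and \<epsilon>: "0 < \<epsilon>"
  obtains \<mu> where "0 < \<mu>" "\<forall>\<^sub>F T in at_top. \<mu> * T \<le> measure lebesgue (hits s d z I \<epsilon> \<inter> {T..2*T})"
proof -
  define \<sigma> where "\<sigma> = Re s"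
  define t where "t = Im s"
  define \<eta> where "\<eta> = min (1/4) (\<epsilon> / 10)"
  have \<eta>: "0 < \<eta>" "\<eta> \<le> 1/4" "2 * \<eta> \<le> \<epsilon> / 5" using \<epsilon> by (auto simp: \<eta>_def)
  define n where "n = real (card I)"
  have n: "0 < n" using I by (simp add: n_def card_gt_0_iff)
  \<comment> \<open>Five errors are added: zeta against the prime sum, the rotations against
    \<open>v\<close>, the sum at \<open>v\<close> against the target, and the quadratic and linear
    parts of the primes between \<open>N\<close> and \<open>N'\<close>.\<close>
  define e where "e = \<epsilon> / 5"
  have e: "0 < e" using \<epsilon> by (simp add: e_def)
  obtain v :: "nat \<Rightarrow> complex" where v: "\<And>p. norm (v p) = 1"
    "\<forall>\<^sub>F N in sequentially. \<forall>k\<in>I.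
      norm ((\<Sum>p\<in>{p. prime p \<and> p \<le> N}. - Ln (1 - of_nat p powr (- s) * v p ^ d k)) - z k) < e"
    by (rule joint_denseness[OF I d s(1,2) e, where z = z]) (assumption, rule that)
  define q where "q = (\<lambda>N. real N powr (1 - 2 * Re s) / (2 * Re s - 1))"
  have q: "q \<longlonglongrightarrow> 0 / (2 * Re s - 1)"
    unfolding q_def using s by (intro tendsto_intros tendsto_neg_powr filterlim_real_sequentially) auto
  have "(\<lambda>N. real (card I) * q N / e\<^sup>2) \<longlonglongrightarrow> real (card I) * (0 / (2 * Re s - 1)) / e\<^sup>2"
    using e by (intro tendsto_intros q) auto
  hence "\<forall>\<^sub>F N in sequentially. real (card I) * q N / e\<^sup>2 < 1 / 5" by (rule order_tendstoD(2)) auto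
  moreover have "(\<lambda>N. 4 * q N) \<longlonglongrightarrow> 4 * (0 / (2 * Re s - 1))" by (intro tendsto_intros q)
  hence "\<forall>\<^sub>F N in sequentially. 4 * q N < e" by (rule order_tendstoD(2)) (use e in auto)
  moreover have "\<forall>\<^sub>F N in sequentially. 1 \<le> (N::nat)" by (rule eventually_ge_at_top)
  ultimately have "\<forall>\<^sub>F N in sequentially. real (card I) * q N / e\<^sup>2 < 1 / 5 \<and> 4 * q N < e \<and> 1 \<le> N \<and> (\<forall>k\<in>I.
      norm ((\<Sum>p\<in>{p. prime p \<and> p \<le> N}. - Ln (1 - of_nat p powr (- s) * v p ^ d k)) - z k) < e)"
    using v(2) by eventually_elim auto
  then obtain N :: nat where N: "real (card I) * q N / e\<^sup>2 < 1 / 5" "4 * q N < e" "1 \<le> N"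
    "\<And>k. k \<in> I \<Longrightarrow> norm ((\<Sum>p\<in>{p. prime p \<and> p \<le> N}. - Ln (1 - of_nat p powr (- s) * v p ^ d k)) - z k) < e"
    using eventually_happens'[OF sequentially_bot] by blast
  have s0: "0 < Re s" using s by simp
  obtain \<delta> where \<delta>: "0 < \<delta>" "\<And>u k. (\<forall>p. prime p \<and> p \<le> N \<longrightarrow> norm (u p - v p) < \<delta>) \<Longrightarrow> k \<in> I \<Longrightarrow>
    norm ((\<Sum>p\<in>{p. prime p \<and> p \<le> N}. - Ln (1 - of_nat p powr (- s) * u p ^ d k)) -
          (\<Sum>p\<in>{p. prime p \<and> p \<le> N}. - Ln (1 - of_nat p powr (- s) * v p ^ d k))) < e"
    by (rule prime_log_sum_continuous_at_units[OF I(1) v(1) s0 e, where N = N and d = d]) (rule that)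
  have tail: "real (card I) * (real N powr (1 - 2 * Re s) / (2 * Re s - 1)) / e\<^sup>2 \<le> 1 / 5"
    using N(1) by (simp add: q_def)
  obtain \<mu> where \<mu>: "0 < \<mu>" "\<And>N'. \<forall>\<^sub>F T in at_top. \<forall>B G. B \<in> lmeasurable \<longrightarrow> G \<in> lmeasurable \<longrightarrow>
     B \<subseteq> {T..2*T} \<longrightarrow> G \<subseteq> {T..2*T} \<longrightarrow> measure lebesgue B \<le> \<mu> * T \<longrightarrow>
     (\<forall>\<tau>\<in>{T..2*T} - B. (\<forall>p. prime p \<and> p \<le> N \<longrightarrow> norm (prime_rot p \<tau> - v p) < \<delta>) \<longrightarrow>
        (\<forall>k\<in>I. norm (\<Sum>p\<in>{p. prime p \<and> N < p \<and> p \<le> N'}. of_nat p powr (- s) * prime_rot p \<tau> ^ d k) < e) \<longrightarrow> \<tau> \<in> G) \<longrightarrow>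
     \<mu> * T \<le> measure lebesgue G"
    by (rule weighted_density[OF I(1) d(2) v(1) s(1) \<delta>(1) e N(3) tail]) (assumption, rule that)
  \<comment> \<open>Each of the n shifts contributes one exceptional set; their union may have
    measure at most \<open>\<mu> * T\<close>.\<close>
  define \<kappa> where "\<kappa> = \<mu> / n"
  have \<kappa>: "0 < \<kappa>" using \<mu> n by (simp add: \<kappa>_def)
  have "\<forall>\<^sub>F N' in sequentially. N \<le> N'" by (rule eventually_ge_at_top)
  with sifted_zeta_close_to_1[OF s(1,2) \<eta>(1) \<kappa>]
  have "\<forall>\<^sub>F N' in sequentially. N \<le> N' \<and> (\<forall>\<^sub>F T in at_top. \<exists>B. B \<in> sets lebesgue \<and> B \<subseteq> {T..3*T} \<and>
    measure lebesgue B \<le> \<kappa> * T \<and> (\<forall>y\<in>{T..3*T} - B. \<forall>x\<ge>Re s. norm (sifted_zeta N' (Complex x y) - 1) < \<eta>))"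
    by eventually_elim auto
  then obtain N' where N': "N \<le> N'" "\<forall>\<^sub>F T in at_top. \<exists>B. B \<in> sets lebesgue \<and> B \<subseteq> {T..3*T} \<and>
    measure lebesgue B \<le> \<kappa> * T \<and> (\<forall>y\<in>{T..3*T} - B. \<forall>x\<ge>Re s. norm (sifted_zeta N' (Complex x y) - 1) < \<eta>)"
    using eventually_happens'[OF sequentially_bot] by blast
  \<comment> \<open>For \<tau> in \<open>{T..2*T}\<close> and \<open>t \<le> T\<close> the ordinate
    \<open>t + d k * \<tau>\<close> lies between \<open>d k * T\<close> and
    \<open>3 * (d k * T)\<close>, since \<open>d k \<ge> 1\<close>.\<close>
  have "\<forall>\<^sub>F T in at_top. \<forall>k\<in>I. \<exists>B. B \<in> sets lebesgue \<and> B \<subseteq> {real (d k) * T..3 * (real (d k) * T)} \<and>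
    measure lebesgue B \<le> \<kappa> * (real (d k) * T) \<and>
    (\<forall>y\<in>{real (d k) * T..3 * (real (d k) * T)} - B. \<forall>x\<ge>Re s. norm (sifted_zeta N' (Complex x y) - 1) < \<eta>)"
  proof (intro eventually_ball_finite[OF I(1)] ballI)
    fix k assume "k \<in> I"
    hence "filterlim (\<lambda>T. real (d k) * T) at_top at_top"
      using d(2) by (intro filterlim_tendsto_pos_mult_at_top[OF tendsto_const _ filterlim_ident]) auto
    from eventually_compose_filterlim[OF N'(2) this]
    show "\<forall>\<^sub>F T in at_top. \<exists>B. B \<in> sets lebesgue \<and> B \<subseteq> {real (d k) * T..3 * (real (d k) * T)} \<and>
      measure lebesgue B \<le> \<kappa> * (real (d k) * T) \<and>
      (\<forall>y\<in>{real (d k) * T..3 * (real (d k) * T)} - B. \<forall>x\<ge>Re s. norm (sifted_zeta N' (Complex x y) - 1) < \<eta>)" .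
  qed
  moreover have "\<forall>\<^sub>F T in at_top. t \<le> T" by (rule eventually_ge_at_top)
  moreover note \<mu>(2)[of N']
  ultimately have "\<forall>\<^sub>F T in at_top. \<mu> * T \<le> measure lebesgue (hits s d z I \<epsilon> \<inter> {T..2*T})"
  proof eventually_elim
    case (elim T)
    have T: "0 < t" "t \<le> T" using elim s by (auto simp: t_def)
    obtain B0 where B0: "\<And>k. k \<in> I \<Longrightarrow> B0 k \<in> sets lebesgue"
      "\<And>k. k \<in> I \<Longrightarrow> B0 k \<subseteq> {real (d k) * T..3 * (real (d k) * T)}"
      "\<And>k. k \<in> I \<Longrightarrow> measure lebesgue (B0 k) \<le> \<kappa> * (real (d k) * T)"
      "\<And>k y x. k \<in> I \<Longrightarrow> y \<in> {real (d k) * T..3 * (real (d k) * T)} - B0 k \<Longrightarrow> Re s \<le> x \<Longrightarrow> norm (sifted_zeta N' (Complex x y) - 1) < \<eta>"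
      using elim(1) unfolding bchoice_iff by blast
    \<comment> \<open>Pulling back to \<tau> divides the measure by \<open>d k\<close> and thus
      cancels that factor in the bound for \<open>B0 k\<close>.\<close>
    define B1 where "B1 = (\<lambda>k. {\<tau>. t + real (d k) * \<tau> \<in> B0 k})"
    have B1: "B1 k \<in> lmeasurable" "measure lebesgue (B1 k) \<le> \<kappa> * T" if k: "k \<in> I" for k
    proof -
      have dk: "0 < real (d k)" using d(2)[OF k] by simp
      show "B1 k \<in> lmeasurable" unfolding B1_def by (rule measure_affine_preimage[OF B0(1,2)[OF k] dk])
      have "measure lebesgue (B1 k) = measure lebesgue (B0 k) / real (d k)"
        unfolding B1_def by (rule measure_affine_preimage[OF B0(1,2)[OF k] dk])
      also have "\<dots> \<le> \<kappa> * (real (d k) * T) / real (d k)" using B0(3)[OF k] by (intro divide_right_mono) auto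
      also have "\<dots> = \<kappa> * T" using dk by simp
      finally show "measure lebesgue (B1 k) \<le> \<kappa> * T" .
    qed
    define B where "B = (\<Union>k\<in>I. B1 k) \<inter> {T..2*T}"
    have BU: "(\<Union>k\<in>I. B1 k) \<in> lmeasurable" using B1 I by (intro fmeasurable.finite_UN) auto
    have B: "B \<in> lmeasurable" unfolding B_def by (intro fmeasurable.Int BU) auto
    have mB: "measure lebesgue B \<le> \<mu> * T"
    proof -
      have "measure lebesgue B \<le> measure lebesgue (\<Union>k\<in>I. B1 k)"
        by (rule measure_mono_fmeasurable) (use B BU in \<open>auto simp: B_def\<close>)
      also have "\<dots> \<le> (\<Sum>k\<in>I. measure lebesgue (B1 k))"
        using B1 I by (intro measure_UNION_le) auto
      also have "\<dots> \<le> (\<Sum>k\<in>I. \<kappa> * T)" by (intro sum_mono B1)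
      also have "\<dots> = \<mu> * T" using n by (simp add: \<kappa>_def n_def)
      finally show ?thesis .
    qed
    define G where "G = hits s d z I \<epsilon> \<inter> {T..2*T}"
    have "hits s d z I \<epsilon> \<in> sets lebesgue" using open_hits[OF I(1) s(2)] by (simp add: borel_open)
    hence G: "G \<in> lmeasurable" unfolding G_def by (intro bounded_set_imp_lmeasurable bounded_Int) auto
    have inG: "\<tau> \<in> G" if \<tau>: "\<tau> \<in> {T..2*T} - B" and ang: "\<forall>p. prime p \<and> p \<le> N \<longrightarrow> norm (prime_rot p \<tau> - v p) < \<delta>"
      and tl: "\<forall>k\<in>I. norm (\<Sum>p\<in>{p. prime p \<and> N < p \<and> p \<le> N'}. of_nat p powr (- s) * prime_rot p \<tau> ^ d k) < e" for \<tau>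
    proof -
      have "0 < t + real (d k) * \<tau> \<and> (\<forall>x\<ge>\<sigma>. zeta (Complex x (t + real (d k) * \<tau>)) \<noteq> 0) \<and>
          norm (log_zeta (Complex \<sigma> (t + real (d k) * \<tau>)) - z k) < \<epsilon>" if k: "k \<in> I" for k
      proof -
        define y where "y = t + real (d k) * \<tau>"
        have dk: "1 \<le> real (d k)" using d(2)[OF k] by simp
        have y0: "0 < y" using T \<tau> dk by (simp add: y_def add_pos_nonneg)
        have "\<tau> \<notin> B1 k" using \<tau> k by (auto simp: B_def)
        moreover have "real (d k) * T \<le> y" using \<tau> T mult_left_mono[of T \<tau> "real (d k)"] by (simp add: y_def)
        moreover have "y \<le> 3 * (real (d k) * T)"
        proof -
          have "real (d k) * \<tau> \<le> 2 * (real (d k) * T)" using \<tau> mult_left_mono[of \<tau> "2 * T" "real (d k)"] by simp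
          moreover have "T \<le> real (d k) * T" using T dk mult_right_mono[of 1 "real (d k)" T] by simp
          ultimately show ?thesis using T unfolding y_def by linarith
        qed
        ultimately have y: "y \<in> {real (d k) * T..3 * (real (d k) * T)} - B0 k" by (simp add: B1_def y_def)
        have close: "norm (sifted_zeta N' (Complex x y) - 1) < \<eta>" if "\<sigma> \<le> x" for x
          using B0(4)[OF k y] that by (simp add: \<sigma>_def)
        have \<sigma>: "0 < \<sigma>" "\<sigma> \<le> 1" "y \<noteq> 0" "1 \<le> N'" using s y0 N N' by (auto simp: \<sigma>_def)
        note approx = log_zeta_approx_prime_log_sum[OF \<sigma> \<eta>(2) close]
        define u where "u = (\<lambda>p. of_nat p powr (- s) * prime_rot p \<tau> ^ d k)"
        have un: "norm (u p) = real p powr (- Re s)" if "prime p" for p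
          using prime_gt_0_nat[OF that] by (simp add: u_def norm_mult norm_power norm_nat_powr)
        have Cy: "Complex \<sigma> y = s + \<i> * of_nat (d k) * of_real \<tau>"
          unfolding shift_Complex by (simp add: \<sigma>_def y_def t_def)
        define Q where "Q = {p. prime p \<and> N < p \<and> p \<le> N'}"
        have Q: "finite Q" unfolding Q_def by (rule finite_subset[of _ "{..N'}"]) auto
        have un2: "{p. prime p \<and> p \<le> N'} = {p. prime p \<and> p \<le> N} \<union> Q" using N' by (auto simp: Q_def)
        have "prime_log_sum N' (Complex \<sigma> y) = (\<Sum>p\<in>{p. prime p \<and> p \<le> N'}. - Ln (1 - u p))"
          unfolding prime_log_sum_def Cy u_def
          by (intro sum.cong refl) (simp only: nat_powr_shift prime_gt_0_nat mem_Collect_eq)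
        also have "\<dots> = (\<Sum>p\<in>{p. prime p \<and> p \<le> N}. - Ln (1 - u p)) + (\<Sum>p\<in>Q. - Ln (1 - u p))"
          unfolding un2 by (rule sum.union_disjoint[OF finite_primes_le Q]) (auto simp: Q_def)
        also have "(\<Sum>p\<in>Q. - Ln (1 - u p)) = (\<Sum>p\<in>Q. - Ln (1 - u p) - u p) + (\<Sum>p\<in>Q. u p)"
          by (simp add: sum.distrib[symmetric])
        finally have llog_eq: "prime_log_sum N' (Complex \<sigma> y) = (\<Sum>p\<in>{p. prime p \<and> p \<le> N}. - Ln (1 - u p)) +
           ((\<Sum>p\<in>Q. - Ln (1 - u p) - u p) + (\<Sum>p\<in>Q. u p))" .
        define V where "V = (\<Sum>p\<in>{p. prime p \<and> p \<le> N}. - Ln (1 - of_nat p powr (- s) * v p ^ d k))"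
        have b1: "norm ((\<Sum>p\<in>{p. prime p \<and> p \<le> N}. - Ln (1 - u p)) - V) < e"
          unfolding u_def V_def by (rule \<delta>(2)[OF ang k])
        have b2: "norm (V - z k) < e" unfolding V_def by (rule N(4)[OF k])
        have b3: "norm (\<Sum>p\<in>Q. u p) < e" using tl k by (simp add: u_def Q_def)
        have b4: "norm (\<Sum>p\<in>Q. - Ln (1 - u p) - u p) < e"
        proof -
          have "norm (\<Sum>p\<in>Q. - Ln (1 - u p) - u p) \<le> (\<Sum>p\<in>Q. 4 * real p powr (- (2 * Re s)))"
          proof (rule sum_norm_le)
            fix p assume "p \<in> Q"
            hence p: "prime p" by (simp add: Q_def)
            have "norm (- Ln (1 - u p) - u p) \<le> 4 * (norm (u p))\<^sup>2"
              using s un[OF p] by (intro norm_prime_log_linear_le[OF p, of s]) auto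
            thus "norm (- Ln (1 - u p) - u p) \<le> 4 * real p powr (- (2 * Re s))"
              using un[OF p] by (simp add: power2_eq_square powr_add[symmetric])
          qed
          also have "\<dots> \<le> (\<Sum>p\<in>{N<..N'}. 4 * real p powr (- (2 * Re s)))"
            by (intro sum_mono2) (auto simp: Q_def)
          also have "\<dots> = 4 * (\<Sum>p\<in>{N<..N'}. real p powr (- (2 * Re s)))" by (simp add: sum_distrib_left)
          also have "\<dots> \<le> 4 * q N" unfolding q_def
            by (intro mult_left_mono sum_tail_powr_le) (use s N in auto)
          finally show ?thesis using N(2) by linarith
        qed
        have five: "norm (a - z k) \<le> norm (a - b) + norm (c1 - w) + norm (w - z k) + norm c2 + norm c3"
          if "b = c1 + (c2 + c3)" for a b c1 c2 c3 w :: complex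
        proof -
          have "a - z k = (a - b) + ((c1 - w) + ((w - z k) + (c2 + c3)))" using that by simp
          hence "norm (a - z k) = norm ((a - b) + ((c1 - w) + ((w - z k) + (c2 + c3))))" by (simp only:)
          thus ?thesis
            using norm_triangle_ineq[of "a - b" "(c1 - w) + ((w - z k) + (c2 + c3))"]
              norm_triangle_ineq[of "c1 - w" "(w - z k) + (c2 + c3)"]
              norm_triangle_ineq[of "w - z k" "c2 + c3"] norm_triangle_ineq[of c2 c3] by linarith
        qed
        have "norm (log_zeta (Complex \<sigma> y) - z k) < \<epsilon>"
          using five[OF llog_eq, of "log_zeta (Complex \<sigma> y)" V] approx(2) b1 b2 b3 b4 \<eta>(3) e
          unfolding e_def by linarith
        thus ?thesis using y0 approx(1) by (auto simp: y_def)
      qed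
      thus ?thesis using \<tau> by (auto simp: G_def hits_def \<sigma>_def t_def)
    qed
    have all: "\<forall>\<tau>\<in>{T..2*T} - B. (\<forall>p. prime p \<and> p \<le> N \<longrightarrow> norm (prime_rot p \<tau> - v p) < \<delta>) \<longrightarrow>
        (\<forall>k\<in>I. norm (\<Sum>p\<in>{p. prime p \<and> N < p \<and> p \<le> N'}. of_nat p powr (- s) * prime_rot p \<tau> ^ d k) < e) \<longrightarrow> \<tau> \<in> G"
      using inG by blast
    have sub: "B \<subseteq> {T..2*T}" "G \<subseteq> {T..2*T}" by (auto simp: B_def G_def)
    have "\<mu> * T \<le> measure lebesgue G"
      by (rule elim(3)[THEN spec[of _ B], THEN spec[of _ G], THEN mp, OF B, THEN mp, OF G, THEN mp, OF sub(1),
            THEN mp, OF sub(2), THEN mp, OF mB, THEN mp, OF all])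
    thus ?case by (simp add: G_def)
  qed
  thus ?thesis using that \<mu>(1) by blast
qed

theorem theorem1p1:
  fixes n :: nat and d :: "nat \<Rightarrow> nat" and s :: complex
    and z :: "nat \<Rightarrow> complex" and \<epsilon> :: real
  assumes "1 \<le> n"
    and "\<And>k. k \<in> {1..n} \<Longrightarrow> 0 < d k"
    and "strict_mono_on {1..n} d"
    and "1/2 < Re s" and "Re s \<le> 1" and "0 < Im s"
    and "0 < \<epsilon>"
  shows "0 < Liminf at_top (\<lambda>T::real. ereal (1 / T * measure lebesgue
           {\<tau> \<in> {0..T}.
              (\<forall>k\<in>{1..n}. s + \<i> * of_nat (d k) * of_real \<tau> \<in> log_zeta_domain) \<and>
              Max ((\<lambda>k. norm (log_zeta (s + \<i> * of_nat (d k) * of_real \<tau>) - z k)) ` {1..n}) < \<epsilon>}))"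
proof -
  let ?S = "\<lambda>T. {\<tau> \<in> {0..T}. (\<forall>k\<in>{1..n}. s + \<i> * of_nat (d k) * of_real \<tau> \<in> log_zeta_domain) \<and>
     Max ((\<lambda>k. norm (log_zeta (s + \<i> * of_nat (d k) * of_real \<tau>) - z k)) ` {1..n}) < \<epsilon>}"
  let ?I = "{1..n}"
  let ?H = "hits s d z ?I \<epsilon>"
  have I: "finite ?I" "?I \<noteq> {}" "inj_on d ?I"
    using assms(1,3) by (auto intro: strict_mono_on_imp_inj_on)
  \<comment> \<open>The parameters for which some shifted point has a zero anywhere on its
    horizontal line. Off this countable set the domain condition holds automatically and the set of
    the theorem coincides with \<open>hits\<close>.\<close>
  define R where "R = (\<Union>k\<in>?I. (\<lambda>y. (y - Im s) / real (d k)) ` Im ` {w. w \<noteq> 1 \<and> zeta w = 0})"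
  have "countable R" unfolding R_def using countable_zeta_zeros by (intro countable_UN countable_image) auto
  hence Rnull: "A \<in> null_sets lebesgue" if "A \<subseteq> R" for A
    using that countable_subset countable_imp_null_set_lborel null_sets_completionI by blast
  have nozero: "zeta (Complex x (Im s + real (d k) * \<tau>)) \<noteq> 0 \<or> Complex x (Im s + real (d k) * \<tau>) = 1"
    if "\<tau> \<notin> R" "k \<in> ?I" for \<tau> k x
  proof (rule ccontr)
    assume *: "\<not> ?thesis"
    have "\<tau> = (Im (Complex x (Im s + real (d k) * \<tau>)) - Im s) / real (d k)"
      using assms(2)[OF that(2)] by simp
    hence "\<tau> \<in> R" unfolding R_def using * that(2) by blast
    thus False using that by simp
  qed
  have iff: "\<tau> \<in> ?S T \<longleftrightarrow> \<tau> \<in> ?H" if \<tau>: "\<tau> \<notin> R" "\<tau> \<in> {0..T}" for \<tau> T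
  proof -
    have y: "0 < Im s + real (d k) * \<tau>" for k using assms(6) \<tau> by (simp add: add_pos_nonneg)
    have ne1: "Complex x (Im s + real (d k) * \<tau>) \<noteq> 1" for x k using y[of k] by (auto simp: complex_eq_iff)
    have nz: "zeta (Complex x (Im s + real (d k) * \<tau>)) \<noteq> 0" if "k \<in> ?I" for x k
      using nozero[OF \<tau>(1) that] ne1 by blast
    have dom: "s + \<i> * of_nat (d k) * of_real \<tau> \<in> log_zeta_domain" if k: "k \<in> ?I" for k
    proof -
      have "False" if "\<rho> \<noteq> 1" "zeta \<rho> = 0" "Complex (Re s) (Im s + real (d k) * \<tau>) = \<rho> + of_real u" for \<rho> u
      proof -
        have "Im \<rho> = Im s + real (d k) * \<tau>" using that(3) by (simp add: complex_eq_iff)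
        hence "\<rho> = Complex (Re \<rho>) (Im s + real (d k) * \<tau>)" by (simp add: complex_eq_iff)
        thus False using nz[OF k, of "Re \<rho>"] that(2) by simp
      qed
      thus ?thesis unfolding shift_Complex log_zeta_domain_def using assms(4) by auto
    qed
    have "\<tau> \<in> ?S T \<longleftrightarrow> (\<forall>k\<in>?I. norm (log_zeta (s + \<i> * of_nat (d k) * of_real \<tau>) - z k) < \<epsilon>)"
      using dom \<tau>(2) I by simp
    also have "\<dots> \<longleftrightarrow> \<tau> \<in> ?H" unfolding shift_Complex hits_def using nz y by simp
    finally show ?thesis .
  qed
  have Hs: "?H \<in> sets lebesgue" using open_hits[OF I(1) assms(5)] by (simp add: borel_open)
  \<comment> \<open>The set differs from a measurable one only inside the null set \<open>R\<close>,
    and Lebesgue measure is complete.\<close>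
  have Ssets: "?S T \<in> sets lebesgue" for T
  proof -
    have eq: "(?H \<inter> {0..T} - R) \<union> (?S T \<inter> R) = ?S T" using iff[of _ T] by blast
    have "?H \<inter> {0..T} - R \<in> sets lebesgue"
      using Hs Rnull[of R] by (intro sets.Diff sets.Int) (auto dest: null_setsD2)
    moreover have "?S T \<inter> R \<in> sets lebesgue" using Rnull[of "?S T \<inter> R"] by (auto dest: null_setsD2)
    ultimately have "(?H \<inter> {0..T} - R) \<union> (?S T \<inter> R) \<in> sets lebesgue" by (rule sets.Un)
    thus ?thesis by (simp only: eq)
  qed
  obtain \<mu> where \<mu>: "0 < \<mu>" "\<forall>\<^sub>F T in at_top. \<mu> * T \<le> measure lebesgue (?H \<inter> {T..2*T})"
    using hits_density[OF I(1,2,3) assms(2,4,5,6,7)] by blast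
  \<comment> \<open>The lower half of \<open>{0..T}\<close> is discarded: the density bound is
    applied to \<open>{T/2..T}\<close>, which halves the constant.\<close>
  have "filterlim (\<lambda>T::real. 1/2 * T) at_top at_top"
    by (intro filterlim_tendsto_pos_mult_at_top[OF tendsto_const _ filterlim_ident]) auto
  from eventually_compose_filterlim[OF \<mu>(2) this] eventually_gt_at_top[of 0]
  have "\<forall>\<^sub>F T in at_top. ereal (\<mu> / 2) \<le> ereal (1 / T * measure lebesgue (?S T))"
  proof eventually_elim
    case (elim T)
    let ?G = "?H \<inter> {1/2 * T..2 * (1/2 * T)}"
    have Gs: "?G \<in> sets lebesgue" using Hs by (intro sets.Int) auto
    have "\<mu> * (1/2 * T) \<le> measure lebesgue ?G" using elim by simp
    also have "\<dots> = measure lebesgue (?G - R)" using measure_Diff_null_set[OF Gs Rnull[of R]] by simp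
    also have "\<dots> \<le> measure lebesgue (?S T)"
    proof (rule measure_mono_fmeasurable)
      show "?G - R \<subseteq> ?S T"
      proof
        fix \<tau> assume \<tau>: "\<tau> \<in> ?G - R"
        hence "\<tau> \<in> {0..T}" using elim by auto
        thus "\<tau> \<in> ?S T" using iff[of \<tau> T] \<tau> by blast
      qed
      show "?G - R \<in> sets lebesgue" using Gs Rnull[of R] by (intro sets.Diff) (auto dest: null_setsD2)
      show "?S T \<in> lmeasurable"
        by (rule bounded_set_imp_lmeasurable[OF _ Ssets]) (rule bounded_subset[of "{0..T}"], auto)
    qed
    finally have "\<mu> * (1/2 * T) \<le> measure lebesgue (?S T)" .
    hence "\<mu> / 2 \<le> 1 / T * measure lebesgue (?S T)" using elim by (simp add: field_simps)
    thus ?case by simp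
  qed
  from Liminf_bounded[OF this] have "ereal (\<mu> / 2) \<le> Liminf at_top (\<lambda>T. ereal (1 / T * measure lebesgue (?S T)))" .
  moreover have "0 < ereal (\<mu> / 2)" using \<mu> by simp
  ultimately show ?thesis by (rule order_less_le_trans[rotated])
qed

end
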